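(* For every integer $s\geq 3$, the moduli space $\widetilde X_s=\mathcal{MHG}_{1,s}$ of holocolored one-loop graphs with $s$ legs satisfies $$H_{s-1}(\widetilde X_s;\mathbb{Z})\cong\mathbb{Z}^{\frac{(s-1)!}{2}}.$$
   Context: Graphs are finite non-empty multigraphs (self-loops and multiple edges allowed) with a set $E(G)$ of internal edges and $s$ external legs labeled bijectively by $1,\ldots,s$, each leg attached to a vertex. The valency of a vertex is the number of half-edges at it (legs count once, self-loops twice). A graph is admissible if it is connected, stays connected upon removal of any single internal edge, and all vertices have valency $\geq 3$. Its rank is its first Betti number. Hence an admissible graph of rank one with $s$ legs is a cycle with $k$ vertices and $k$ internal edges, $1\leq k\leq s$ ($k=1$: one vertex with a self-loop; $k=2$: two vertices joined by a double edge), each vertex carrying at least one leg. A holocoloring of such a graph is an injective map $c:E(G)\to\{1,\ldots,s\}$. A metric $\lambda:E(G)\to\mathbb{R}_{\geq 0}$ is regular if $Z=\{e:\lambda(e)=0\}$ is (the edge set of) a forest; in rank one this means $\lambda\not\equiv 0$. $G/Z$ denotes $G$ with the edges of $Z$ collapsed. The points of $\widetilde X_s$ are the triples $(G,\lambda,c)$ with $G$ admissible of rank one with $s$ legs, $\lambda$ a regular metric, $c$ a holocoloring, modulo the relation: $(G,\lambda,c)\sim(G',\lambda',c')$ iff, with $Z,Z'$ the zero sets of $\lambda,\lambda'$, there are a graph isomorphism $\varphi:G/Z\to G'/Z'$ preserving the leg labels and a constant $a>0$ with $\lambda'\circ\varphi=a\lambda$ and $c'\circ\varphi=c$ on $E(G)\setminus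 Z$ (so colors of collapsed edges are forgotten). Topology: for each isomorphism class of pairs $(G,c)$ the regular metrics of total length $1$ form a closed simplex of dimension $|E(G)|-1$; $\widetilde X_s$ carries the quotient topology from the disjoint union of these simplices. *)

theory Defs
  imports "HOL-Homology.Homology" "HOL-Library.Multiset"
begin

section \<open>Multigraphs with labelled legs\<close>

text \<open>
  The two ends of an edge form a multiset of size two; a self-loop at \<open>v\<close> has ends \<open>{#v, v#}\<close>.
  The legs are identified with their labels \<open>1, \<dots>, s\<close>; \<open>leg G i\<close> is the vertex
  carrying leg \<open>i\<close>. The values of \<open>ends G\<close> off \<open>edges G\<close> and of \<open>leg G\<close> off \<open>{1..s}\<close> are irrelevant.
\<close>

record ('v, 'e) legged_graph =
  verts :: "'v set"
  edges :: "'e set"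
  ends :: "'e \<Rightarrow> 'v multiset"
  leg :: "nat \<Rightarrow> 'v"

definition wf_graph :: "nat \<Rightarrow> ('v, 'e) legged_graph \<Rightarrow> bool" where
  "wf_graph s G \<longleftrightarrow>
     finite (verts G) \<and> verts G \<noteq> {} \<and> finite (edges G) \<and>
     (\<forall>e\<in>edges G. size (ends G e) = 2 \<and> set_mset (ends G e) \<subseteq> verts G) \<and>
     (\<forall>i\<in>{1..s}. leg G i \<in> verts G)"

text \<open>A self-loop at \<open>v\<close> contributes \<open>2\<close> through the multiplicity of \<open>v\<close> in its ends.\<close>

definition valency :: "nat \<Rightarrow> ('v, 'e) legged_graph \<Rightarrow> 'v \<Rightarrow> nat" where
  "valency s G v = (\<Sum>e\<in>edges G. count (ends G e) v) + card {i\<in>{1..s}. leg G i = v}"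

text \<open>Vertices that are joined by a walk using only edges from \<open>F\<close>.\<close>

definition joined :: "('v, 'e) legged_graph \<Rightarrow> 'e set \<Rightarrow> ('v \<times> 'v) set" where
  "joined G F = {(u, v). \<exists>e\<in>F. ends G e = {#u, v#}}\<^sup>* \<inter> verts G \<times> verts G"

text \<open>Components of the spanning subgraph with edge set \<open>F\<close>.\<close>

definition comps :: "('v, 'e) legged_graph \<Rightarrow> 'e set \<Rightarrow> 'v set set" where
  "comps G F = verts G // joined G F"

definition connected_by :: "('v, 'e) legged_graph \<Rightarrow> 'e set \<Rightarrow> bool" where
  "connected_by G F \<longleftrightarrow> verts G \<noteq> {} \<and> joined G F = verts G \<times> verts G"

text \<open>First Betti number (Euler characteristic formula).\<close>

definition first_betti :: "('v, 'e) legged_graph \<Rightarrow> int" where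
  "first_betti G = int (card (edges G)) - int (card (verts G)) + int (card (comps G (edges G)))"

definition admissible :: "nat \<Rightarrow> ('v, 'e) legged_graph \<Rightarrow> bool" where
  "admissible s G \<longleftrightarrow>
     wf_graph s G \<and>
     connected_by G (edges G) \<and>
     (\<forall>e\<in>edges G. connected_by G (edges G - {e})) \<and>
     (\<forall>v\<in>verts G. 3 \<le> valency s G v)"

text \<open>
  A cycle runs through distinct vertices \<open>vs\<close> along distinct edges \<open>es\<close>; length one is a
  self-loop, length two a pair of parallel edges.
\<close>

definition is_cycle :: "('v, 'e) legged_graph \<Rightarrow> 'v list \<Rightarrow> 'e list \<Rightarrow> bool" where
  "is_cycle G vs es \<longleftrightarrow>
     es \<noteq> [] \<and> length vs = length es \<and> distinct vs \<and> distinct es \<and>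
     (\<forall>i<length es. ends G (es ! i) = {#vs ! i, vs ! ((i + 1) mod length es)#})"

definition forest :: "('v, 'e) legged_graph \<Rightarrow> 'e set \<Rightarrow> bool" where
  "forest G F \<longleftrightarrow> (\<nexists>vs es. set es \<subseteq> F \<and> is_cycle G vs es)"

text \<open>The graph \<open>G/Z\<close>: its vertices are the components of the spanning subgraph with edge set \<open>Z\<close>.\<close>

definition collapse :: "('v, 'e) legged_graph \<Rightarrow> 'e set \<Rightarrow> ('v set, 'e) legged_graph" where
  "collapse G Z =
     \<lparr>verts = comps G Z,
      edges = edges G - Z,
      ends = (\<lambda>e. image_mset (\<lambda>v. joined G Z `` {v}) (ends G e)),
      leg = (\<lambda>i. joined G Z `` {leg G i})\<rparr>"

definition graph_iso ::
    "nat \<Rightarrow> ('v, 'e) legged_graph \<Rightarrow> ('w, 'f) legged_graph \<Rightarrow> ('v \<Rightarrow> 'w) \<Rightarrow> ('e \<Rightarrow> 'f) \<Rightarrow> bool" where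
  "graph_iso s G H f \<phi> \<longleftrightarrow>
     bij_betw f (verts G) (verts H) \<and>
     bij_betw \<phi> (edges G) (edges H) \<and>
     (\<forall>e\<in>edges G. ends H (\<phi> e) = image_mset f (ends G e)) \<and>
     (\<forall>i\<in>{1..s}. leg H i = f (leg G i))"


section \<open>Holocolored metric graphs of rank one\<close>

text \<open>
  Vertices and edges are taken from \<open>nat\<close>, which represents every finite graph up to isomorphism.
  Colorings and metrics are extensional functions on the edge set.
\<close>

type_synonym ngraph = "(nat, nat) legged_graph"

definition holocolorings :: "nat \<Rightarrow> ngraph \<Rightarrow> (nat \<Rightarrow> nat) set" where
  "holocolorings s G = {c \<in> edges G \<rightarrow>\<^sub>E {1..s}. inj_on c (edges G)}"

definition zeros :: "ngraph \<Rightarrow> (nat \<Rightarrow> real) \<Rightarrow> nat set" where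
  "zeros G l = {e\<in>edges G. l e = 0}"

definition regular_metrics :: "ngraph \<Rightarrow> (nat \<Rightarrow> real) set" where
  "regular_metrics G = {l \<in> edges G \<rightarrow>\<^sub>E {0..}. forest G (zeros G l)}"

definition holocolored_graphs :: "nat \<Rightarrow> (ngraph \<times> (nat \<Rightarrow> nat)) set" where
  "holocolored_graphs s = {(G, c). admissible s G \<and> first_betti G = 1 \<and> c \<in> holocolorings s G}"

type_synonym metric_graph = "ngraph \<times> (nat \<Rightarrow> real) \<times> (nat \<Rightarrow> nat)"

definition holocolored_metric_graphs :: "nat \<Rightarrow> metric_graph set" where
  "holocolored_metric_graphs s =
     {(G, l, c). (G, c) \<in> holocolored_graphs s \<and> l \<in> regular_metrics G}"

definition mhg_rel :: "nat \<Rightarrow> metric_graph rel" where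
  "mhg_rel s =
     {((G, l, c), (G', l', c')).
        (G, l, c) \<in> holocolored_metric_graphs s \<and>
        (G', l', c') \<in> holocolored_metric_graphs s \<and>
        (\<exists>f \<phi> a. graph_iso s (collapse G (zeros G l)) (collapse G' (zeros G' l')) f \<phi> \<and> 0 < a \<and>
           (\<forall>e\<in>edges G - zeros G l. l' (\<phi> e) = a * l e \<and> c' (\<phi> e) = c e))}"

lemma leg_collapse:
  assumes "wf_graph s G" "i \<in> {1..s}"
  shows "leg (collapse G Z) i \<in> verts (collapse G Z)"
  using assms by (auto simp: wf_graph_def collapse_def comps_def intro: quotientI)

lemma ends_collapse:
  assumes "wf_graph s G" "e \<in> edges G"
  shows "set_mset (ends (collapse G Z) e) \<subseteq> verts (collapse G Z)"
  using assms by (fastforce simp: wf_graph_def collapse_def comps_def intro: quotientI)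

lemma graph_iso_trans:
  assumes "graph_iso s G H f \<phi>" "graph_iso s H K g \<psi>"
  shows "graph_iso s G K (g \<circ> f) (\<psi> \<circ> \<phi>)"
  using assms unfolding graph_iso_def
  by (auto simp: bij_betw_apply multiset.map_comp intro: bij_betw_trans)

lemma graph_iso_sym:
  assumes iso: "graph_iso s G H f \<phi>"
    and leg: "\<And>i. i \<in> {1..s} \<Longrightarrow> leg G i \<in> verts G"
    and ends: "\<And>e. e \<in> edges G \<Longrightarrow> set_mset (ends G e) \<subseteq> verts G"
  shows "graph_iso s H G (inv_into (verts G) f) (inv_into (edges G) \<phi>)"
proof -
  have f: "bij_betw f (verts G) (verts H)" and p: "bij_betw \<phi> (edges G) (edges H)"
    using iso by (auto simp: graph_iso_def)
  have "ends G (inv_into (edges G) \<phi> e) = image_mset (inv_into (verts G) f) (ends H e)"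
    if e: "e \<in> edges H" for e
  proof -
    obtain d where d: "d \<in> edges G" "e = \<phi> d"
      using e p by (auto simp: bij_betw_def)
    have "image_mset (inv_into (verts G) f) (ends H e)
        = image_mset (\<lambda>v. inv_into (verts G) f (f v)) (ends G d)"
      using iso d by (simp add: graph_iso_def multiset.map_comp comp_def)
    also have "\<dots> = image_mset (\<lambda>v. v) (ends G d)"
      using ends[OF d(1)] f by (intro image_mset_cong) (auto simp: bij_betw_def)
    finally show ?thesis
      using d p by (simp add: bij_betw_def)
  qed
  moreover have "leg G i = inv_into (verts G) f (leg H i)" if "i \<in> {1..s}" for i
    using iso leg[OF that] f that by (simp add: graph_iso_def bij_betw_def)
  ultimately show ?thesis
    using f p by (simp add: graph_iso_def bij_betw_inv_into)
qed

lemma wf_holocolored_metric_graph: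
  "(G, l, c) \<in> holocolored_metric_graphs s \<Longrightarrow> wf_graph s G"
  by (simp add: holocolored_metric_graphs_def holocolored_graphs_def admissible_def)

lemma edges_collapse [simp]: "edges (collapse G Z) = edges G - Z"
  by (simp add: collapse_def)

lemma equiv_mhg_rel: "equiv (holocolored_metric_graphs s) (mhg_rel s)"
proof (rule equivI)
  show "mhg_rel s \<subseteq> holocolored_metric_graphs s \<times> holocolored_metric_graphs s"
    by (auto simp: mhg_rel_def)
  show "refl_on (holocolored_metric_graphs s) (mhg_rel s)"
  proof (rule refl_onI)
    fix x assume x: "x \<in> holocolored_metric_graphs s"
    obtain G l c where [simp]: "x = (G, l, c)" by (cases x)
    have "graph_iso s (collapse G (zeros G l)) (collapse G (zeros G l)) id id"
      by (simp add: graph_iso_def)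
    then show "(x, x) \<in> mhg_rel s"
      using x by (auto simp: mhg_rel_def intro!: exI[of _ id] exI[of _ "1::real"])
  qed
  show "sym (mhg_rel s)"
  proof (rule symI)
    fix x y assume xy: "(x, y) \<in> mhg_rel s"
    obtain G l c G' l' c' where [simp]: "x = (G, l, c)" "y = (G', l', c')"
      by (metis prod_cases3)
    let ?E = "edges G - zeros G l" and ?E' = "edges G' - zeros G' l'"
    obtain f p a where
      mem: "x \<in> holocolored_metric_graphs s" "y \<in> holocolored_metric_graphs s" and
      iso: "graph_iso s (collapse G (zeros G l)) (collapse G' (zeros G' l')) f p" and
      a: "0 < a" "\<And>e. e \<in> ?E \<Longrightarrow> l' (p e) = a * l e \<and> c' (p e) = c e"
      using xy by (auto simp: mhg_rel_def)
    have wf: "wf_graph s G" using mem(1) wf_holocolored_metric_graph by simp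
    have p: "bij_betw p ?E ?E'" using iso by (simp add: graph_iso_def)
    have iso': "graph_iso s (collapse G' (zeros G' l')) (collapse G (zeros G l))
        (inv_into (verts (collapse G (zeros G l))) f) (inv_into ?E p)"
      using graph_iso_sym[OF iso] leg_collapse[OF wf] ends_collapse[OF wf] by force
    have "l (inv_into ?E p e) = (1/a) * l' e \<and> c (inv_into ?E p e) = c' e" if "e \<in> ?E'" for e
    proof -
      have "p (inv_into ?E p e) = e" "inv_into ?E p e \<in> ?E"
        using bij_betw_inv_into_right[OF p that] bij_betw_apply[OF bij_betw_inv_into[OF p] that]
        by auto
      with a(2)[of "inv_into ?E p e"] a(1) show ?thesis by simp
    qed
    then have "\<exists>f p b. graph_iso s (collapse G' (zeros G' l')) (collapse G (zeros G l)) f p \<and> 0 < b \<and>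
        (\<forall>e\<in>?E'. l (p e) = b * l' e \<and> c (p e) = c' e)"
      using iso' a(1) by (metis zero_less_divide_1_iff)
    then show "(y, x) \<in> mhg_rel s"
      using mem by (simp add: mhg_rel_def)
  qed
  show "trans (mhg_rel s)"
  proof (rule transI)
    fix x y z assume xy: "(x, y) \<in> mhg_rel s" and yz: "(y, z) \<in> mhg_rel s"
    obtain G l c G' l' c' G2 l2 c2
      where [simp]: "x = (G, l, c)" "y = (G', l', c')" "z = (G2, l2, c2)"
      by (metis prod_cases3)
    obtain f p a where
      mem: "x \<in> holocolored_metric_graphs s" and
      iso: "graph_iso s (collapse G (zeros G l)) (collapse G' (zeros G' l')) f p" and
      a: "0 < a" "\<And>e. e \<in> edges G - zeros G l \<Longrightarrow> l' (p e) = a * l e \<and> c' (p e) = c e"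
      using xy by (auto simp: mhg_rel_def)
    obtain g q b where
      mem': "z \<in> holocolored_metric_graphs s" and
      iso': "graph_iso s (collapse G' (zeros G' l')) (collapse G2 (zeros G2 l2)) g q" and
      b: "0 < b" "\<And>e. e \<in> edges G' - zeros G' l' \<Longrightarrow> l2 (q e) = b * l' e \<and> c2 (q e) = c' e"
      using yz by (auto simp: mhg_rel_def)
    have "p e \<in> edges G' - zeros G' l'" if "e \<in> edges G - zeros G l" for e
      using iso that by (auto simp: graph_iso_def dest: bij_betwE)
    then have "\<forall>e\<in>edges G - zeros G l. l2 ((q \<circ> p) e) = (b * a) * l e \<and> c2 ((q \<circ> p) e) = c e"
      using a b by simp
    moreover have "0 < b * a" using a b by simp
    ultimately have "\<exists>f p a. graph_iso s (collapse G (zeros G l)) (collapse G2 (zeros G2 l2)) f p \<and> 0 < a \<and>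
        (\<forall>e\<in>edges G - zeros G l. l2 (p e) = a * l e \<and> c2 (p e) = c e)"
      using graph_iso_trans[OF iso iso'] by blast
    then show "(x, z) \<in> mhg_rel s"
      using mem mem' by (simp add: mhg_rel_def)
  qed
qed


section \<open>The moduli space\<close>

definition quotient_space :: "'a topology \<Rightarrow> ('a \<Rightarrow> 'b) \<Rightarrow> 'b topology" where
  "quotient_space X q =
     topology (\<lambda>U. U \<subseteq> q ` topspace X \<and> openin X {x \<in> topspace X. q x \<in> U})"

lemma openin_quotient_space:
  "openin (quotient_space X q) U \<longleftrightarrow> U \<subseteq> q ` topspace X \<and> openin X {x \<in> topspace X. q x \<in> U}"
proof -
  have "istopology (\<lambda>U. U \<subseteq> q ` topspace X \<and> openin X {x \<in> topspace X. q x \<in> U})"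
    unfolding istopology_def
  proof (intro conjI allI impI)
    fix S T assume "S \<subseteq> q ` topspace X \<and> openin X {x \<in> topspace X. q x \<in> S}"
      and "T \<subseteq> q ` topspace X \<and> openin X {x \<in> topspace X. q x \<in> T}"
    moreover have "{x \<in> topspace X. q x \<in> S \<inter> T}
        = {x \<in> topspace X. q x \<in> S} \<inter> {x \<in> topspace X. q x \<in> T}" by auto
    ultimately show "S \<inter> T \<subseteq> q ` topspace X" "openin X {x \<in> topspace X. q x \<in> S \<inter> T}" by auto
  next
    fix K assume K: "\<forall>S\<in>K. S \<subseteq> q ` topspace X \<and> openin X {x \<in> topspace X. q x \<in> S}"
    have "{x \<in> topspace X. q x \<in> \<Union>K} = (\<Union>S\<in>K. {x \<in> topspace X. q x \<in> S})" by auto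
    with K show "\<Union>K \<subseteq> q ` topspace X" "openin X {x \<in> topspace X. q x \<in> \<Union>K}" by auto
  qed
  then show ?thesis by (simp add: quotient_space_def)
qed

lemma topspace_quotient_space: "topspace (quotient_space X q) = q ` topspace X"
proof -
  have "{x \<in> topspace X. q x \<in> q ` topspace X} = topspace X" by auto
  then have "openin (quotient_space X q) (q ` topspace X)"
    by (simp add: openin_quotient_space)
  then show ?thesis
    by (meson openin_quotient_space openin_subset openin_topspace subset_antisym)
qed

lemma quotient_map_quotient_space: "quotient_map X (quotient_space X q) q"
  by (auto simp: quotient_map_def topspace_quotient_space openin_quotient_space)

definition metric_simplex :: "ngraph \<Rightarrow> (nat \<Rightarrow> real) topology" where
  "metric_simplex G =
     subtopology (product_topology (\<lambda>_. euclideanreal) (edges G))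
       {l \<in> regular_metrics G. (\<Sum>e\<in>edges G. l e) = 1}"

text \<open>
  The disjoint union below has one simplex for every pair \<open>(G, c)\<close> on the carrier \<open>nat\<close> rather than
  one for every isomorphism class. Simplices of isomorphic pairs are identified with each other
  by homeomorphisms over the quotient, so the repeated copies do not change the quotient topology.
  Every class of \<open>mhg_rel s\<close> has a representative of total length one, so the points are all the
  classes.
\<close>

definition MHG1 :: "nat \<Rightarrow> metric_graph set topology" where
  "MHG1 s =
     quotient_space (sum_topology (\<lambda>(G, c). metric_simplex G) (holocolored_graphs s))
       (\<lambda>((G, c), l). mhg_rel s `` {(G, l, c)})"

end

theory Submission
  imports Defs "HOL-Analysis.Abstract_Topological_Spaces" "HOL-Combinatorics.Permutations"
begin

text \<open>
  Let \<open>n = s - 1\<close>. Every colored cycle is a degeneration of one with \<open>s\<close> vertices, so the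
  moduli space is glued from finitely many \<open>n\<close>-simplices, one for each way to arrange the legs and
  the colors along a cycle. Barycentric coordinates are indexed by the colors, and only faces spanned
  by the same colors are identified. Hence \<open>H\<^sub>n\<close> is computed cellularly: it is
  the group of integer functions on the top simplices whose coefficients cancel along every facet.
  Collapsing the edge between two adjacent legs forgets only their order, so a facet lies in exactly
  two top simplices, which are related by an adjacent transposition of the legs. A cycle is therefore
  alternating in the leg permutation, and is freely determined by one integer for each cyclic
  arrangement of the \<open>s\<close> colors up to reflection; there are \<open>(s - 1)! / 2\<close> of them.
\<close>

section \<open>Relative homology\<close>

text \<open>Singular homology knows nothing of cells, so each cell is attached by hand: a subcomplex
  minus the barycenter of a maximal open cell retracts onto the complement of that cell, and
  excision compares the cell with a standard simplex. The same invariance removes all signs from the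
  cycle condition: simplices at a common facet induce the same orientation on it, so their
  coefficients add up to zero, which is the source of the alternation. Adjacent transpositions
  already generate all leg permutations; the exchange of the last and the first position adds no
  contradiction, being odd as well. Rotations and reflections of the positions act on colors and
  legs at once; normalising the colors uses up this symmetry, so the legs remain a full permutation.
  With \<open>s = 2\<close> the two edges are parallel and exchanging the legs changes nothing, so a
  facet would lie in one top simplex only; hence \<open>s \<ge> 3\<close>.\<close>

lemma iso_of_comp_iso:
  assumes f: "f \<in> hom G H" and h: "h \<in> iso H K" and k: "k \<in> iso G K"
    and eq: "\<And>x. x \<in> carrier G \<Longrightarrow> h (f x) = k x"
  shows "f \<in> iso G H"
proof -
  have f': "f ` carrier G \<subseteq> carrier H" using f by (auto simp: hom_def)
  have h': "bij_betw h (carrier H) (carrier K)" using h by (simp add: iso_def)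
  have "bij_betw k (carrier G) (carrier K)" using k by (simp add: iso_def)
  moreover have "bij_betw (h \<circ> f) (carrier G) (carrier K) \<longleftrightarrow> bij_betw k (carrier G) (carrier K)"
    by (rule bij_betw_cong) (simp add: eq)
  ultimately have "bij_betw (h \<circ> f) (carrier G) (carrier K)"
    by blast
  then have "bij_betw f (carrier G) (carrier H)"
    using bij_betw_comp_iff2[OF h' f'] by blast
  with f show ?thesis by (simp add: iso_def)
qed

text \<open>In the exact sequence of the triple, both neighbours of the map in question are homology
  groups of \<open>(S, T)\<close>, which vanish.\<close>

lemma iso_relative_of_trivial_triple:
  assumes "T \<subseteq> S" and triv: "\<And>p. trivial_group (relative_homology_group p (subtopology X S) T)"
  shows "hom_induced p X T X S id \<in> iso (relative_homology_group p X T) (relative_homology_group p X S)"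
proof -
  let ?f = "hom_induced p X T X S id"
  have hom: "?f \<in> hom (relative_homology_group p X T) (relative_homology_group p X S)"
    by (rule hom_induced_hom)
  have e1: "?f ` carrier (relative_homology_group p X T)
      = kernel (relative_homology_group p X S) (relative_homology_group (p-1) (subtopology X S) T)
          (hom_relboundary p X S T)"
    using homology_exactness_triple_1[OF assms(1), of p X] by simp
  have e3: "hom_induced p (subtopology X S) T X T id ` carrier (relative_homology_group p (subtopology X S) T)
      = kernel (relative_homology_group p X T) (relative_homology_group p X S) ?f"
    using homology_exactness_triple_3[OF assms(1), of p X] by simp
  have "hom_relboundary p X S T x = \<one>\<^bsub>relative_homology_group (p-1) (subtopology X S) T\<^esub>" for x
    using triv[of "p-1"] hom_relboundary[of p X S T x] unfolding trivial_group_def by blast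
  then have surj: "?f ` carrier (relative_homology_group p X T) = carrier (relative_homology_group p X S)"
    unfolding e1 kernel_def by blast
  have "hom_induced p (subtopology X S) T X T id \<one>\<^bsub>relative_homology_group p (subtopology X S) T\<^esub>
      = \<one>\<^bsub>relative_homology_group p X T\<^esub>"
    by (rule hom_one[OF hom_induced_hom]) simp_all
  then have ker: "kernel (relative_homology_group p X T) (relative_homology_group p X S) ?f
      = {\<one>\<^bsub>relative_homology_group p X T\<^esub>}"
    using triv[of p] unfolding e3[symmetric] trivial_group_def by (metis image_empty image_insert)
  have "group_hom (relative_homology_group p X T) (relative_homology_group p X S) ?f"
    using hom by (simp add: group_hom_def group_hom_axioms_def)
  then have "inj_on ?f (carrier (relative_homology_group p X T))"
    using ker by (simp only: group_hom.inj_iff_trivial_ker)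
  with hom surj show ?thesis by (simp add: iso_def bij_betw_def)
qed

text \<open>
  A map of pairs \<open>(Y, L) \<rightarrow> (Z, B)\<close> that is a homeomorphism off \<open>L\<close> and \<open>B\<close>
  induces isomorphisms as soon as \<open>L\<close> and \<open>B\<close> have corresponding open neighbourhoods \<open>W\<close> and \<open>V\<close>
  with no relative homology: thicken to \<open>W\<close> and \<open>V\<close>, then excise \<open>L\<close> and \<open>B\<close>.
\<close>

lemma iso_relative_homeomorphism:
  assumes L: "closedin Y L" and W: "openin Y W" and LW: "L \<subseteq> W"
    and B: "closedin Z B" and V: "openin Z V" and BV: "B \<subseteq> V"
    and trivW: "\<And>p. trivial_group (relative_homology_group p (subtopology Y W) L)"
    and trivV: "\<And>p. trivial_group (relative_homology_group p (subtopology Z V) B)"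
    and f: "continuous_map Y Z f" and fL: "f ` L \<subseteq> B"
    and homeo: "homeomorphic_map (subtopology Y (topspace Y - L)) (subtopology Z (topspace Z - B)) f"
    and fW: "f ` (W - L) = V - B"
  shows "hom_induced p Y L Z B f \<in> iso (relative_homology_group p Y L) (relative_homology_group p Z B)"
proof (rule iso_of_comp_iso)
  let ?Y' = "subtopology Y (topspace Y - L)" and ?Z' = "subtopology Z (topspace Z - B)"
  have fWV: "f ` W \<subseteq> V" using fL fW BV by blast
  have WY: "W \<subseteq> topspace Y" and VZ: "V \<subseteq> topspace Z" using W V by (auto dest: openin_subset)
  have excY: "hom_induced p ?Y' (W - L) Y W id
      \<in> iso (relative_homology_group p ?Y' (W - L)) (relative_homology_group p Y W)"
    using homology_excision_axiom[of Y L W "topspace Y" p] L W LW WY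
    by (simp add: closure_of_closedin interior_of_openin)
  have excZ: "hom_induced p ?Z' (V - B) Z V id
      \<in> iso (relative_homology_group p ?Z' (V - B)) (relative_homology_group p Z V)"
    using homology_excision_axiom[of Z B V "topspace Z" p] B V BV VZ
    by (simp add: closure_of_closedin interior_of_openin)
  have hom': "hom_induced p ?Y' (W - L) ?Z' (V - B) f
      \<in> iso (relative_homology_group p ?Y' (W - L)) (relative_homology_group p ?Z' (V - B))"
    using WY by (intro homeomorphic_map_relative_homology_iso homeo fW) auto
  have thickW: "hom_induced p Y L Y W id \<in> iso (relative_homology_group p Y L) (relative_homology_group p Y W)"
    by (rule iso_relative_of_trivial_triple[OF LW trivW])
  have thickV: "hom_induced p Z B Z V id \<in> iso (relative_homology_group p Z B) (relative_homology_group p Z V)"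
    by (rule iso_relative_of_trivial_triple[OF BV trivV])
  have fYZ': "continuous_map ?Y' ?Z' f" using homeo by (rule homeomorphic_imp_continuous_map)
  \<comment> \<open>Naturality of excision: \<open>f\<close> is an isomorphism between the excised
    pairs, and both excision maps are isomorphisms, so the remaining side of the square is one
    too.\<close>
  have mid: "hom_induced p Y W Z V f \<in> iso (relative_homology_group p Y W) (relative_homology_group p Z V)"
  proof -
    have "hom_induced p Y W Z V f \<circ> hom_induced p ?Y' (W - L) Y W id
        = hom_induced p ?Y' (W - L) Z V (f \<circ> id)"
      using fWV f by (intro hom_induced_compose[symmetric]) (auto simp: continuous_map_from_subtopology)
    moreover have "hom_induced p ?Z' (V - B) Z V id \<circ> hom_induced p ?Y' (W - L) ?Z' (V - B) f
        = hom_induced p ?Y' (W - L) Z V (id \<circ> f)"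
      using fYZ' fW by (intro hom_induced_compose[symmetric]) (auto simp: continuous_map_from_subtopology)
    ultimately have eq: "hom_induced p Y W Z V f \<circ> hom_induced p ?Y' (W - L) Y W id
        = hom_induced p ?Z' (V - B) Z V id \<circ> hom_induced p ?Y' (W - L) ?Z' (V - B) f" by simp
    let ?e = "hom_induced p ?Y' (W - L) Y W id"
    let ?k = "hom_induced p ?Z' (V - B) Z V id \<circ> hom_induced p ?Y' (W - L) ?Z' (V - B) f"
    have "?k \<in> iso (relative_homology_group p ?Y' (W - L)) (relative_homology_group p Z V)"
      using hom' excZ by (rule iso_set_trans)
    then have "bij_betw (hom_induced p Y W Z V f \<circ> ?e) (carrier (relative_homology_group p ?Y' (W - L)))
        (carrier (relative_homology_group p Z V))"
      unfolding eq by (simp add: iso_def)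
    moreover have "bij_betw ?e (carrier (relative_homology_group p ?Y' (W - L))) (carrier (relative_homology_group p Y W))"
      using excY by (simp add: iso_def)
    ultimately have "bij_betw (hom_induced p Y W Z V f) (carrier (relative_homology_group p Y W))
        (carrier (relative_homology_group p Z V))"
      using bij_betw_comp_iff by blast
    then show ?thesis by (simp add: iso_def hom_induced_hom)
  qed
  show "hom_induced p Y L Z B f \<in> hom (relative_homology_group p Y L) (relative_homology_group p Z B)"
    by (rule hom_induced_hom)
  show "hom_induced p Z B Z V id \<in> iso (relative_homology_group p Z B) (relative_homology_group p Z V)"
    by (rule thickV)
  show "hom_induced p Y W Z V f \<circ> hom_induced p Y L Y W id
      \<in> iso (relative_homology_group p Y L) (relative_homology_group p Z V)"
    using thickW mid by (rule iso_set_trans)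
  have "hom_induced p Z B Z V id \<circ> hom_induced p Y L Z B f = hom_induced p Y L Z V (id \<circ> f)"
    using f fL BV by (intro hom_induced_compose[symmetric]) auto
  moreover have "hom_induced p Y W Z V f \<circ> hom_induced p Y L Y W id = hom_induced p Y L Z V (f \<circ> id)"
    using f LW fWV by (intro hom_induced_compose[symmetric]) auto
  ultimately show "hom_induced p Z B Z V id (hom_induced p Y L Z B f x)
      = (hom_induced p Y W Z V f \<circ> hom_induced p Y L Y W id) x" for x
    by (simp add: fun_eq_iff)
qed

text \<open>Surjectivity and injectivity of the induced map, unpacked to chains; the cell
  computations below manipulate explicit chains rather than classes.\<close>

lemma
  assumes f: "continuous_map Y Z f" and fL: "f ` L \<subseteq> B"
    and iso: "hom_induced (int p) Y L Z B f
      \<in> iso (relative_homology_group (int p) Y L) (relative_homology_group (int p) Z B)"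
  shows relcycle_from_iso: "singular_relcycle p Z B c
      \<Longrightarrow> \<exists>c'. singular_relcycle p Y L c' \<and> homologous_rel p Z B c (chain_map p f c')"
    and relboundary_from_iso: "singular_relcycle p Y L c'
      \<Longrightarrow> singular_relboundary p Z B (chain_map p f c') \<Longrightarrow> singular_relboundary p Y L c'"
proof -
  have fL': "f \<in> L \<rightarrow> B" using fL by auto
  have bij: "bij_betw (hom_induced (int p) Y L Z B f) (carrier (relative_homology_group (int p) Y L))
      (carrier (relative_homology_group (int p) Z B))"
    using iso by (simp add: iso_def)
  {
    assume "singular_relcycle p Z B c"
    then have "homologous_rel_set p Z B c \<in> carrier (relative_homology_group (int p) Z B)"
      by (auto simp: carrier_relative_homology_group)
    then obtain x where "x \<in> carrier (relative_homology_group (int p) Y L)"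
      "hom_induced (int p) Y L Z B f x = homologous_rel_set p Z B c"
      using bij_betw_imp_surj_on[OF bij] by (metis imageE)
    then obtain c' where c': "singular_relcycle p Y L c'"
      "hom_induced (int p) Y L Z B f (homologous_rel_set p Y L c') = homologous_rel_set p Z B c"
      by (auto simp: carrier_relative_homology_group)
    then have "homologous_rel_set p Z B (chain_map p f c') = homologous_rel_set p Z B c"
      by (simp add: hom_induced_chain_map[OF f fL'])
    then show "\<exists>c'. singular_relcycle p Y L c' \<and> homologous_rel p Z B c (chain_map p f c')"
      using c' by (metis homologous_rel_set_eq)
  }
  assume c': "singular_relcycle p Y L c'" and bd: "singular_relboundary p Z B (chain_map p f c')"
  have "hom_induced (int p) Y L Z B f (homologous_rel_set p Y L c') = \<one>\<^bsub>relative_homology_group (int p) Z B\<^esub>"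
    using bd c' by (simp add: hom_induced_chain_map[OF f fL'] homologous_rel_set_eq_relboundary)
  moreover have "hom_induced (int p) Y L Z B f \<one>\<^bsub>relative_homology_group (int p) Y L\<^esub>
      = \<one>\<^bsub>relative_homology_group (int p) Z B\<^esub>"
    using hom_one[OF hom_induced_hom] by fastforce
  moreover have "homologous_rel_set p Y L c' \<in> carrier (relative_homology_group (int p) Y L)"
    using c' by (auto simp: carrier_relative_homology_group)
  moreover have "\<one>\<^bsub>relative_homology_group (int p) Y L\<^esub> \<in> carrier (relative_homology_group (int p) Y L)"
    by (meson group.is_monoid group_relative_homology_group monoid.one_closed)
  ultimately have "homologous_rel_set p Y L c' = \<one>\<^bsub>relative_homology_group (int p) Y L\<^esub>"
    by (metis bij bij_betw_imp_inj_on inj_onD)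
  then show "singular_relboundary p Y L c'"
    by (simp add: homologous_rel_set_eq_relboundary)
qed

section \<open>Points of the standard simplex and their supports\<close>

abbreviation simplex_space :: "nat \<Rightarrow> (nat \<Rightarrow> real) topology" where
  "simplex_space n \<equiv> subtopology (powertop_real UNIV) (standard_simplex n)"

definition support :: "(nat \<Rightarrow> real) \<Rightarrow> nat set" where
  "support t = {k. t k \<noteq> 0}"

definition barycenter :: "nat set \<Rightarrow> nat \<Rightarrow> real" where
  "barycenter C = (\<lambda>k. if k \<in> C then 1 / real (card C) else 0)"

lemma support_simplex: "t \<in> standard_simplex n \<Longrightarrow> support t \<subseteq> {..n}"
  by (auto simp: support_def standard_simplex_def not_le[symmetric])

lemma support_nonempty: "t \<in> standard_simplex n \<Longrightarrow> support t \<noteq> {}"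
proof
  assume t: "t \<in> standard_simplex n" and "support t = {}"
  then have "sum t {..n} = 0" by (simp add: support_def)
  with t show False by (simp add: standard_simplex_def)
qed

lemma sum_support_simplex:
  assumes "t \<in> standard_simplex n" "support t \<subseteq> C" "C \<subseteq> {..n}"
  shows "sum t C = 1"
proof -
  have "sum t {..n} = sum t C"
    using assms by (intro sum.mono_neutral_right) (auto simp: support_def)
  then show ?thesis using assms(1) by (simp add: standard_simplex_def)
qed

lemma simplexI:
  assumes "\<And>k. 0 \<le> t k" "support t \<subseteq> C" "C \<subseteq> {..n}" "sum t C = 1"
  shows "t \<in> standard_simplex n"
proof -
  have "sum t {..n} = sum t C"
    using assms by (intro sum.mono_neutral_right) (auto simp: support_def)
  then have s: "sum t {..n} = 1" using assms by simp
  have "t k \<le> 1" for k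
  proof (cases "k \<le> n")
    case True
    then have "t k \<le> sum t {..n}" using assms(1) by (intro member_le_sum) auto
    then show ?thesis using s by simp
  next
    case False
    then have "t k = 0" using assms(2,3) by (auto simp: support_def)
    then show ?thesis by simp
  qed
  moreover have "\<forall>i>n. t i = 0" using assms(2,3) by (fastforce simp: support_def)
  ultimately show ?thesis using assms(1) s by (simp add: standard_simplex_def)
qed

lemma support_barycenter: "finite C \<Longrightarrow> C \<noteq> {} \<Longrightarrow> support (barycenter C) = C"
  by (auto simp: support_def barycenter_def)

lemma barycenter_in_simplex: "C \<noteq> {} \<Longrightarrow> C \<subseteq> {..n} \<Longrightarrow> barycenter C \<in> standard_simplex n"
  using finite_subset[of C "{..n}"]
  by (intro simplexI[where C=C]) (auto simp: support_def barycenter_def card_gt_0_iff)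

lemma continuous_map_coordinate: "continuous_map (simplex_space n) euclideanreal (\<lambda>t. t k)"
  by (intro continuous_map_from_subtopology continuous_map_product_projection) auto

lemma continuous_map_Min:
  assumes "finite C" "C \<noteq> {}" "\<And>k. k \<in> C \<Longrightarrow> continuous_map X euclideanreal (\<lambda>x. f x k)"
  shows "continuous_map X euclideanreal (\<lambda>x. Min (f x ` C))"
  using assms
proof (induction C rule: finite_ne_induct)
  case (insert k C)
  then have "continuous_map X euclideanreal (\<lambda>x. min (f x k) (Min (f x ` C)))"
    by (intro continuous_map_real_min) auto
  with insert show ?case by simp
qed simp

text \<open>The minimum is at most the average, with equality only for constant values. This will
  make the barycenter the unique deepest point of its cell.\<close>

lemma Min_le_inverse_card:
  fixes t :: "nat \<Rightarrow> real"
  assumes "finite C" "C \<noteq> {}" "sum t C = 1"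
  shows "Min (t ` C) \<le> 1 / real (card C)"
    and "Min (t ` C) = 1 / real (card C) \<Longrightarrow> k \<in> C \<Longrightarrow> t k = 1 / real (card C)"
proof -
  have c: "real (card C) > 0" using assms by (simp add: card_gt_0_iff)
  have "real (card C) * Min (t ` C) = (\<Sum>k\<in>C. Min (t ` C))" by simp
  also have "\<dots> \<le> sum t C" using assms by (intro sum_mono) auto
  finally show "Min (t ` C) \<le> 1 / real (card C)" using c assms(3) by (simp add: field_simps)
  assume eq: "Min (t ` C) = 1 / real (card C)" and k: "k \<in> C"
  have "(\<Sum>j\<in>C. t j - 1 / real (card C)) = 0"
    using c assms(3) by (simp add: sum_subtractf)
  moreover have "\<forall>j\<in>C. 0 \<le> t j - 1 / real (card C)"
    using eq assms(1) by (metis Min_le diff_ge_0_iff_ge finite_imageI imageI)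
  ultimately show "t k = 1 / real (card C)"
    using sum_nonneg_eq_0_iff[OF assms(1), of "\<lambda>j. t j - 1 / real (card C)"] k by auto
qed

lemma openin_from_quotient_map:
  "\<lbrakk>quotient_map X Y f; openin X {x \<in> topspace X. f x \<in> U}; U \<subseteq> topspace Y\<rbrakk> \<Longrightarrow> openin Y U"
  by (simp add: quotient_map_def)

section \<open>Spaces glued from simplices\<close>

text \<open>
  \<open>R C i j\<close> says that the simplices \<open>i\<close> and \<open>j\<close> share the face spanned by \<open>C\<close>. The gluing preserves
  barycentric coordinates, so no simplex is glued to itself.
\<close>

locale simplex_gluing =
  fixes n :: nat and X :: "'a topology" and I :: "'b set"
    and R :: "nat set \<Rightarrow> 'b \<Rightarrow> 'b \<Rightarrow> bool" and q :: "'b \<Rightarrow> (nat \<Rightarrow> real) \<Rightarrow> 'a"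
  assumes finite_I: "finite I"
    and quot: "quotient_map (prod_topology (discrete_topology I) (simplex_space n)) X (\<lambda>(i, t). q i t)"
    and q_eq: "\<lbrakk>i \<in> I; j \<in> I; t \<in> standard_simplex n; u \<in> standard_simplex n\<rbrakk>
      \<Longrightarrow> q i t = q j u \<longleftrightarrow> t = u \<and> R (support t) i j"
    and R_anti: "\<lbrakk>i \<in> I; j \<in> I; C \<noteq> {}; C \<subseteq> D; D \<subseteq> {..n}; R D i j\<rbrakk> \<Longrightarrow> R C i j"
begin

abbreviation simplices :: "('b \<times> (nat \<Rightarrow> real)) topology" where
  "simplices \<equiv> prod_topology (discrete_topology I) (simplex_space n)"

lemma topspace_gluing: "topspace X = {q i t | i t. i \<in> I \<and> t \<in> standard_simplex n}"
  unfolding quotient_imp_surjective_map[OF quot, symmetric] by force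

lemma continuous_map_q: "i \<in> I \<Longrightarrow> continuous_map (simplex_space n) X (q i)"
proof -
  assume i: "i \<in> I"
  have "continuous_map (simplex_space n) simplices (\<lambda>t. (i, t))"
    using i by (intro continuous_map_pairedI) auto
  from continuous_map_compose[OF this quotient_imp_continuous_map[OF quot]]
  show ?thesis by (simp add: comp_def)
qed

lemma q_eq_same: "\<lbrakk>i \<in> I; j \<in> I; t \<in> standard_simplex n\<rbrakk> \<Longrightarrow> q i t = q j t \<longleftrightarrow> R (support t) i j"
  by (simp add: q_eq)

text \<open>Gluing never changes barycentric coordinates, so the second projection is constant on
  the fibres of the quotient map and descends. The result supplies the continuous inverses of the
  characteristic maps.\<close>

lemma coordinates:
  obtains co where "continuous_map X (simplex_space n) co"
    "\<And>i t. i \<in> I \<Longrightarrow> t \<in> standard_simplex n \<Longrightarrow> co (q i t) = t"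
proof (rule quotient_map_lift_exists[OF quot continuous_map_snd])
  fix x y assume "x \<in> topspace simplices" "y \<in> topspace simplices"
    "(case x of (i, t) \<Rightarrow> q i t) = (case y of (i, t) \<Rightarrow> q i t)"
  then show "snd x = snd y" by (auto simp: q_eq)
next
  fix g assume "continuous_map X (simplex_space n) g"
    "\<And>x. x \<in> topspace simplices \<Longrightarrow> g (case x of (i, t) \<Rightarrow> q i t) = snd x"
  then show thesis by (intro that[of g]) auto
qed

text \<open>Points \<open>u\<close> with the same support as \<open>t\<close> make this a union of
  open cells; points with smaller support add the faces of these cells.\<close>

definition subcomplex :: "'a set \<Rightarrow> bool" where
  "subcomplex A \<longleftrightarrow> A \<subseteq> topspace X \<and>
     (\<forall>i\<in>I. \<forall>t\<in>standard_simplex n. \<forall>u\<in>standard_simplex n.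
        q i t \<in> A \<longrightarrow> support u \<subseteq> support t \<longrightarrow> q i u \<in> A)"

lemma subcomplexD:
  "\<lbrakk>subcomplex A; q i t \<in> A; i \<in> I; t \<in> standard_simplex n; u \<in> standard_simplex n; support u \<subseteq> support t\<rbrakk>
    \<Longrightarrow> q i u \<in> A"
  unfolding subcomplex_def by blast

text \<open>The preimage in the disjoint union of the simplices is a union of closed faces, and
  there are only finitely many faces.\<close>

lemma closedin_subcomplex:
  assumes "subcomplex A"
  shows "closedin X A"
proof -
  let ?F = "\<lambda>(i, C). {i} \<times> {u \<in> standard_simplex n. support u \<subseteq> C}"
  let ?J = "{(i, C). i \<in> I \<and> C \<subseteq> {..n} \<and> (\<exists>t\<in>standard_simplex n. q i t \<in> A \<and> support t = C)}"
  have eq: "{z \<in> topspace simplices. (case z of (i, t) \<Rightarrow> q i t) \<in> A} = (\<Union>z\<in>?J. ?F z)"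
  proof (intro equalityI subsetI)
    fix z assume z: "z \<in> {z \<in> topspace simplices. (case z of (i, t) \<Rightarrow> q i t) \<in> A}"
    obtain i t where it: "z = (i, t)" by (cases z)
    then have "(i, support t) \<in> ?J" using z support_simplex[of t n] by auto
    moreover have "z \<in> ?F (i, support t)" using z it by simp
    ultimately show "z \<in> (\<Union>z\<in>?J. ?F z)" by blast
  next
    fix z assume "z \<in> (\<Union>z\<in>?J. ?F z)"
    then obtain i C t u where *: "z = (i, u)" "i \<in> I" "t \<in> standard_simplex n" "q i t \<in> A"
        "support t = C" "u \<in> standard_simplex n" "support u \<subseteq> C" by auto
    then have "q i u \<in> A" using subcomplexD[OF assms *(4,2,3,6)] by simp
    then show "z \<in> {z \<in> topspace simplices. (case z of (i, t) \<Rightarrow> q i t) \<in> A}" using * by simp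
  qed
  have "finite ?J"
    by (rule finite_subset[of _ "I \<times> Pow {..n}"]) (auto simp: finite_I)
  moreover have "closedin simplices (?F z)" if zJ: "z \<in> ?J" for z
  proof -
    obtain i C where z: "z = (i, C)" "i \<in> I" using zJ by auto
    \<comment> \<open>The index \<open>0\<close> imposes no condition if it lies in
      \<open>C\<close>; it is inserted only to make the family visibly non-empty, as an intersection
      of closed sets requires.\<close>
    have "{u \<in> standard_simplex n. support u \<subseteq> C}
        = (\<Inter>k\<in>insert 0 {k. k \<notin> C}. {u \<in> topspace (simplex_space n). u k \<in> (if k \<notin> C then {0} else UNIV)})"
      by (auto simp: support_def)
    moreover have "closedin (simplex_space n) \<dots>"
      by (intro closedin_INT closedin_continuous_map_preimage[OF continuous_map_coordinate]) auto
    ultimately show ?thesis using z by (simp add: closedin_prod_Times_iff)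
  qed
  ultimately have "closedin simplices (\<Union>z\<in>?J. ?F z)"
    by (intro closedin_Union) auto
  moreover have "A \<subseteq> topspace X" using assms by (simp add: subcomplex_def)
  ultimately show ?thesis
    using quot unfolding quotient_map_closedin by (metis (no_types, lifting) eq)
qed

end

text \<open>Singles out the open cell spanned by \<open>C\<close> in the simplex \<open>i0\<close>.
  The simplices \<open>j\<close> with \<open>R C j i0\<close> are those that contain this same cell,
  and maximality says that no larger cell of \<open>A\<close> has it as a face.\<close>

locale simplex_gluing_cell = simplex_gluing +
  fixes A i0 C
  assumes A: "subcomplex A" and i0: "i0 \<in> I" and C: "C \<noteq> {}" "C \<subseteq> {..n}"
    and bary_A: "q i0 (barycenter C) \<in> A"
    and maximal: "\<lbrakk>j \<in> I; R C j i0; t \<in> standard_simplex n; q j t \<in> A; C \<subseteq> support t\<rbrakk> \<Longrightarrow> support t = C"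
begin

definition cell where "cell = {q i0 t | t. t \<in> standard_simplex n \<and> support t = C}"
text \<open>On \<open>A\<close> this is positive exactly on the open cell and attains its maximum at
  the barycenter alone. The test on \<open>R\<close> makes it vanish on simplices that use the
  colors \<open>C\<close> for a different cell.\<close>

definition depth where "depth j t = (if R C j i0 then Min (t ` C) else 0 :: real)"
text \<open>Solves \<open>t = (1 - card C * a) t' + card C * a * barycenter C\<close> for
  \<open>t'\<close> on \<open>C\<close>, so the point moves along the ray from the barycenter. If
  \<open>a\<close> is the least coordinate, it reaches the boundary of the face.\<close>

definition shrink where
  "shrink a t = (\<lambda>k. if k \<in> C then (t k - a) / (1 - real (card C) * a) else t k :: real)"
definition punctured where "punctured = A - {q i0 (barycenter C)}"

lemma shrink_0: "shrink 0 t = t"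
  by (rule ext) (simp add: shrink_def)

lemma finite_C: "finite C" using C finite_subset by blast

lemma card_C: "real (card C) > 0" using C finite_C by (simp add: card_gt_0_iff)

lemma bary_simplex: "barycenter C \<in> standard_simplex n"
  using C by (rule barycenter_in_simplex)

lemma depth_nonneg: "t \<in> standard_simplex n \<Longrightarrow> 0 \<le> depth j t"
  using C finite_C by (auto simp: depth_def standard_simplex_def)

lemma depth_pos:
  assumes "j \<in> I" "t \<in> standard_simplex n" "q j t \<in> A" "0 < depth j t"
  shows "R C j i0" "support t = C"
proof -
  show r: "R C j i0" using assms(4) by (auto simp: depth_def split: if_splits)
  then have "\<forall>k\<in>C. 0 < t k" using assms(4) finite_C C by (simp add: depth_def)
  then have "C \<subseteq> support t" by (force simp: support_def)
  then show "support t = C" using maximal r assms by blast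
qed

lemma q_in_cell_iff:
  assumes "j \<in> I" "t \<in> standard_simplex n" "q j t \<in> A"
  shows "q j t \<in> cell \<longleftrightarrow> 0 < depth j t"
proof
  assume "q j t \<in> cell"
  then obtain u where u: "u \<in> standard_simplex n" "support u = C" "q j t = q i0 u"
    by (auto simp: cell_def)
  then have "t = u" "R C j i0" using q_eq[of j i0 t u] assms i0 by auto
  moreover have "\<forall>k\<in>C. 0 < u k"
    using u by (force simp: support_def standard_simplex_def order.strict_iff_order)
  ultimately show "0 < depth j t" using finite_C C by (simp add: depth_def)
next
  assume "0 < depth j t"
  from depth_pos[OF assms this] have "q j t = q i0 t"
    using assms i0 by (simp add: q_eq)
  then show "q j t \<in> cell"
    using assms depth_pos[OF assms \<open>0 < depth j t\<close>] unfolding cell_def by auto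
qed

text \<open>Positivity of the depth is membership in the cell and so depends on the point only;
  where the depth is positive, its value is a minimum that does not involve
  \<open>j\<close>.\<close>

lemma depth_cong:
  assumes "j \<in> I" "j' \<in> I" "t \<in> standard_simplex n" "q j t \<in> A" "q j t = q j' t"
  shows "depth j t = depth j' t"
proof -
  have "0 \<le> depth j t" "0 \<le> depth j' t" using depth_nonneg assms(3) by blast+
  moreover have "0 < depth j t \<longleftrightarrow> 0 < depth j' t"
    using q_in_cell_iff[OF assms(1,3,4)] q_in_cell_iff[OF assms(2,3)] assms(4,5) by metis
  moreover have "R C j i0 \<and> R C j' i0" if "0 < depth j t" "0 < depth j' t"
    using that unfolding depth_def by (metis less_irrefl)
  ultimately show ?thesis unfolding depth_def by (metis order.order_iff_strict)
qed

lemma depth_bound: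
  assumes "j \<in> I" "t \<in> standard_simplex n" "q j t \<in> A"
  shows "depth j t \<le> 1 / real (card C)"
    and "q j t = q i0 (barycenter C) \<longleftrightarrow> depth j t = 1 / real (card C)"
proof -
  have *: "depth j t \<le> 1 / real (card C) \<and> (depth j t = 1 / real (card C) \<longrightarrow> t = barycenter C)"
    if pos: "0 < depth j t"
  proof -
    note d = depth_pos[OF assms pos]
    have s: "sum t C = 1" using sum_support_simplex assms(2) d(2) C by blast
    have "depth j t = Min (t ` C)" using d by (simp add: depth_def)
    moreover have "t = barycenter C" if "Min (t ` C) = 1 / real (card C)"
      using Min_le_inverse_card(2)[OF finite_C C(1) s that] d(2)
      by (auto simp: barycenter_def fun_eq_iff support_def)
    ultimately show ?thesis using Min_le_inverse_card(1)[OF finite_C C(1) s] by auto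
  qed
  show "depth j t \<le> 1 / real (card C)"
    using * card_C by (cases "0 < depth j t") (auto simp: not_less intro: order_trans)
  show "q j t = q i0 (barycenter C) \<longleftrightarrow> depth j t = 1 / real (card C)"
  proof
    assume "q j t = q i0 (barycenter C)"
    then have "t = barycenter C" "R (support t) j i0"
      using q_eq[OF assms(1) i0 assms(2) bary_simplex] by blast+
    then have "t = barycenter C" "R C j i0"
      using support_barycenter[OF finite_C C(1)] by simp_all
    then show "depth j t = 1 / real (card C)"
    proof -
      have "barycenter C ` C = {1 / real (card C)}" using C(1) by (auto simp: barycenter_def)
      then show ?thesis using \<open>t = barycenter C\<close> \<open>R C j i0\<close> by (simp add: depth_def)
    qed
  next
    assume eq: "depth j t = 1 / real (card C)"
    then have pos: "0 < depth j t" using card_C by simp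
    then have t: "t = barycenter C" and "R (support t) j i0"
      using * eq depth_pos[OF assms pos] by auto
    then show "q j t = q i0 (barycenter C)"
      using q_eq[OF assms(1) i0 assms(2) bary_simplex] by blast
  qed
qed

text \<open>By maximality, a point of \<open>A\<close> that has the cell as a face has support
  \<open>C\<close>, and then lies in the cell itself.\<close>

lemma subcomplex_diff_cell: "subcomplex (A - cell)"
  unfolding subcomplex_def
proof (intro conjI ballI impI)
  show "A - cell \<subseteq> topspace X" using A by (auto simp: subcomplex_def)
  fix i t u assume i: "i \<in> I" and t: "t \<in> standard_simplex n" and u: "u \<in> standard_simplex n"
    and q: "q i t \<in> A - cell" and s: "support u \<subseteq> support t"
  have uA: "q i u \<in> A" using subcomplexD[OF A _ i t u s] q by blast
  have "q i u \<notin> cell"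
  proof
    assume "q i u \<in> cell"
    then have "0 < depth i u" using q_in_cell_iff[OF i u uA] by blast
    note d = depth_pos[OF i u uA this]
    then have "support t = C" using maximal[OF i d(1) t] q s by blast
    then have "\<forall>k\<in>C. 0 < t k"
      using t by (force simp: support_def standard_simplex_def order.strict_iff_order)
    then have "0 < depth i t" using finite_C C d(1) by (simp add: depth_def)
    then show False using q q_in_cell_iff[OF i t] by blast
  qed
  with uA show "q i u \<in> A - cell" by blast
qed

lemma cell_subset: "cell \<subseteq> A"
  using subcomplexD[OF A bary_A i0 bary_simplex] support_barycenter[OF finite_C C(1)]
  by (auto simp: cell_def)

lemma punctured_superset: "A - cell \<subseteq> punctured"
  using bary_simplex support_barycenter[OF finite_C C(1)] by (auto simp: punctured_def cell_def)

text \<open>The parameter \<open>u\<close> is the time of the retraction: at time one the full depth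
  has been subtracted. The last conclusion keeps the denominator of \<open>shrink\<close> positive
  throughout.\<close>

lemma shrink_simplex:
  assumes j: "j \<in> I" and t: "t \<in> standard_simplex n" and q: "q j t \<in> punctured"
    and u: "0 \<le> u" "u \<le> 1"
  defines "t' \<equiv> shrink (u * depth j t) t"
  shows "t' \<in> standard_simplex n" "support t' \<subseteq> support t" "q j t' \<in> punctured"
    "u = 1 \<Longrightarrow> q j t' \<in> A - cell" "depth j t = 0 \<Longrightarrow> t' = t"
    "real (card C) * (u * depth j t) < 1"
proof -
  let ?c = "real (card C)" and ?a = "u * depth j t"
  have qA: "q j t \<in> A" using q by (simp add: punctured_def)
  have "depth j t < 1 / ?c"
    using depth_bound[OF j t qA] q by (auto simp: punctured_def)
  then have cd: "?c * depth j t < 1" using card_C by (simp add: field_simps)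
  have "?a \<le> depth j t" using u depth_nonneg[OF t] by (simp add: mult_left_le_one_le)
  then have "?c * ?a \<le> ?c * depth j t" using card_C by simp
  then show ca: "?c * ?a < 1" using cd by linarith
  show z: "depth j t = 0 \<Longrightarrow> t' = t"
    by (auto simp: t'_def shrink_def)
  have *: "t' \<in> standard_simplex n \<and> support t' \<subseteq> support t \<and> q j t' \<in> punctured \<and>
      (u = 1 \<longrightarrow> q j t' \<in> A - cell)"
  proof (cases "0 < depth j t")
    case False
    then have "depth j t = 0" using depth_nonneg[OF t, of j] by simp
    moreover have "q j t \<notin> cell" using q_in_cell_iff[OF j t qA] False by blast
    ultimately show ?thesis using z t q qA by simp
  next
    case True
    note d = depth_pos[OF j t qA True]
    have s: "sum t C = 1" using sum_support_simplex t d(2) C by blast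
    have dm: "depth j t = Min (t ` C)" using d by (simp add: depth_def)
    have le: "?a \<le> t k" if "k \<in> C" for k
    proof -
      have "Min (t ` C) \<le> t k" using that finite_C by simp
      then show ?thesis using dm \<open>?a \<le> depth j t\<close> by linarith
    qed
    have tC: "t k = 0" if "k \<notin> C" for k using that d(2) by (auto simp: support_def)
    have t'C: "t' k = 0" if "k \<notin> C" for k using that tC by (simp add: t'_def shrink_def)
    have nonneg: "0 \<le> t' k" for k
      using le[of k] tC[of k] ca by (auto simp: t'_def shrink_def)
    have supp: "support t' \<subseteq> C" using t'C by (auto simp: support_def)
    have "sum t' C = (\<Sum>k\<in>C. (t k - ?a) / (1 - ?c * ?a))"
      by (simp add: t'_def shrink_def)
    also have "\<dots> = (sum t C - ?c * ?a) / (1 - ?c * ?a)"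
      by (simp add: sum_divide_distrib[symmetric] sum_subtractf)
    also have "\<dots> = 1" using ca s by simp
    finally have sum': "sum t' C = 1" .
    have ts: "t' \<in> standard_simplex n" by (rule simplexI[OF nonneg supp C(2) sum'])
    have t'A: "q j t' \<in> A" using subcomplexD[OF A qA j t ts] supp d(2) by blast
    \<comment> \<open>The motion runs along rays from the barycenter, so only the barycenter could
      arrive there, and it has been removed.\<close>
    have ne: "q j t' \<noteq> q i0 (barycenter C)"
    proof
      assume "q j t' = q i0 (barycenter C)"
      then have t'b: "t' = barycenter C" using q_eq[OF j i0 ts bary_simplex] by blast
      have "t k = 1 / ?c" if k: "k \<in> C" for k
      proof -
        have "(t k - ?a) / (1 - ?c * ?a) = t' k" using k by (simp add: t'_def shrink_def)
        also have "\<dots> = 1 / ?c" using k by (simp add: t'b barycenter_def)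
        finally have "(t k - ?a) / (1 - ?c * ?a) = 1 / ?c" .
        then have "(t k - ?a) * ?c = 1 - ?c * ?a" using ca card_C by (simp add: field_simps)
        then show ?thesis using card_C by (simp add: field_simps)
      qed
      then have "t ` C = {1 / ?c}" using C by auto
      then have "depth j t = 1 / ?c" using dm by simp
      then show False using cd card_C by simp
    qed
    have "q j t' \<notin> cell" if "u = 1"
    proof
      assume "q j t' \<in> cell"
      then have pos: "0 < depth j t'" using q_in_cell_iff[OF j ts t'A] by blast
      \<comment> \<open>At time one the coordinate that attains the minimum becomes zero, so the
        point has left the open cell.\<close>
      have "Min (t ` C) \<in> t ` C" using finite_C C by (intro Min_in) auto
      then obtain k where k: "k \<in> C" "t k = Min (t ` C)" by (metis imageE)
      then have "t' k = 0" using that dm by (simp add: t'_def shrink_def)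
      moreover have "Min (t' ` C) \<le> t' k" using k finite_C by simp
      ultimately show False using pos d(1) by (simp add: depth_def)
    qed
    then show ?thesis using ts supp d(2) t'A ne by (simp add: punctured_def)
  qed
  then show "t' \<in> standard_simplex n" "support t' \<subseteq> support t" "q j t' \<in> punctured"
    "u = 1 \<Longrightarrow> q j t' \<in> A - cell" by blast+
qed

abbreviation "punctured_simplices \<equiv>
  subtopology simplices {z \<in> topspace simplices. (case z of (j, t) \<Rightarrow> q j t) \<in> punctured}"

lemma continuous_map_depth: "continuous_map simplices euclideanreal (\<lambda>(j, t). depth j t)"
proof -
  have "continuous_map simplices euclideanreal (\<lambda>z. (if R C (fst z) i0 then 1 else 0) * Min (snd z ` C))"
  proof (intro continuous_map_real_mult continuous_map_Min finite_C C)
    have "continuous_map simplices euclideanreal ((\<lambda>j. if R C j i0 then 1 else 0) \<circ> fst)"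
      by (rule continuous_map_compose[OF continuous_map_fst]) simp
    then show "continuous_map simplices euclideanreal (\<lambda>z. if R C (fst z) i0 then 1 else 0)"
      by (simp add: comp_def)
    show "continuous_map simplices euclideanreal (\<lambda>z. snd z k)" for k
      using continuous_map_compose[OF continuous_map_snd continuous_map_coordinate, of "discrete_topology I" n k]
      by (simp add: comp_def)
  qed
  then show ?thesis
    by (rule continuous_map_eq) (auto simp: depth_def)
qed

lemma openin_punctured: "openin (subtopology X A) punctured"
  and quotient_punctured: "quotient_map punctured_simplices (subtopology X punctured) (\<lambda>(j, t). q j t)"
proof -
  let ?P = "{z \<in> topspace simplices. (case z of (j, t) \<Rightarrow> q j t) \<in> A}"
  \<comment> \<open>Quotient maps restrict to closed and to open sets, but \<open>punctured\<close>
    is open only relative to the closed set \<open>A\<close>; hence the restriction in two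
    stages.\<close>
  have qA: "quotient_map (subtopology simplices ?P) (subtopology X A) (\<lambda>(j, t). q j t)"
    by (rule quotient_map_restriction[OF quot refl]) (simp add: closedin_subcomplex[OF A])
  have AX: "A \<subseteq> topspace X" using A by (simp add: subcomplex_def)
  \<comment> \<open>By \<open>depth_bound\<close>, avoiding the barycenter is the open condition
    that the depth stays below its maximum.\<close>
  have eq: "{z \<in> topspace (subtopology simplices ?P). (case z of (j, t) \<Rightarrow> q j t) \<in> punctured}
      = {z \<in> topspace (subtopology simplices ?P). (case z of (j, t) \<Rightarrow> depth j t) \<in> {..<1 / real (card C)}}"
    using depth_bound by (auto simp: punctured_def order.strict_iff_order)
  have "openin (subtopology simplices ?P) {z \<in> topspace (subtopology simplices ?P). (case z of (j, t) \<Rightarrow> q j t) \<in> punctured}"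
    unfolding eq
    by (rule openin_continuous_map_preimage[OF continuous_map_from_subtopology[OF continuous_map_depth]]) simp
  then show open_p: "openin (subtopology X A) punctured"
    by (rule openin_from_quotient_map[OF qA]) (use AX in \<open>auto simp: punctured_def\<close>)
  have sub: "{z \<in> topspace (subtopology simplices ?P). (case z of (j, t) \<Rightarrow> q j t) \<in> punctured}
      = ?P \<inter> {z \<in> topspace simplices. (case z of (j, t) \<Rightarrow> q j t) \<in> punctured}"
    by auto
  have "quotient_map (subtopology (subtopology simplices ?P) {z \<in> topspace (subtopology simplices ?P). (case z of (j, t) \<Rightarrow> q j t) \<in> punctured})
      (subtopology (subtopology X A) punctured) (\<lambda>(j, t). q j t)"
    by (rule quotient_map_restriction[OF qA refl]) (simp add: open_p)
  moreover have "?P \<inter> {z \<in> topspace simplices. (case z of (j, t) \<Rightarrow> q j t) \<in> punctured}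
      = {z \<in> topspace simplices. (case z of (j, t) \<Rightarrow> q j t) \<in> punctured}"
    "A \<inter> punctured = punctured"
    by (auto simp: punctured_def)
  ultimately show "quotient_map punctured_simplices (subtopology X punctured) (\<lambda>(j, t). q j t)"
    by (simp only: sub subtopology_subtopology Int_left_absorb)
qed

text \<open>Pushing away from the barycenter: subtract the depth from all coordinates in \<open>C\<close> and renormalise.\<close>

lemma deformation:
  obtains h where
    "continuous_map (prod_topology (top_of_set {0..1 :: real}) (subtopology X punctured)) (subtopology X punctured) h"
    "\<And>x. x \<in> punctured \<Longrightarrow> h (0, x) = x" "\<And>x. x \<in> punctured \<Longrightarrow> h (1, x) \<in> A - cell"
    "\<And>x. x \<in> A - cell \<Longrightarrow> h (1, x) = x"
proof -
  let ?I = "top_of_set {0..1 :: real}"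
  let ?T = "prod_topology ?I punctured_simplices"
  let ?Q = "\<lambda>(u :: real, z). (u, case z of (j, t) \<Rightarrow> q j t)"
  let ?H = "\<lambda>(u, z). case z of (j, t) \<Rightarrow> q j (shrink (u * depth j t) t)"
  \<comment> \<open>The homotopy is to descend to the quotient. The product of the quotient map with
    the interval is again a quotient map because the interval is locally compact.\<close>
  have quotI: "quotient_map ?T (prod_topology ?I (subtopology X punctured)) ?Q"
  proof (rule quotient_map_prod_right[OF _ _ quotient_punctured])
    show "locally_compact_space ?I"
      by (simp add: compact_space_subtopology compact_imp_locally_compact_space)
    show "Hausdorff_space ?I \<or> regular_space ?I" by (simp add: Hausdorff_space_subtopology)
  qed
  have contH: "continuous_map ?T (subtopology X punctured) ?H"
    unfolding continuous_map_in_subtopology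
  proof
    have mem: "fst (snd w) \<in> I" "snd (snd w) \<in> standard_simplex n"
        "q (fst (snd w)) (snd (snd w)) \<in> punctured" "0 \<le> fst w" "fst w \<le> 1" if "w \<in> topspace ?T" for w
      using that by (simp_all add: mem_Times_iff case_prod_unfold)
    let ?a = "\<lambda>w. fst w * depth (fst (snd w)) (snd (snd w))"
    have "continuous_map ?T simplices (\<lambda>w. (fst (snd w), shrink (?a w) (snd (snd w))))"
    proof -
      have c2: "continuous_map ?T simplices snd"
        by (rule continuous_map_into_fulltopology[OF continuous_map_snd])
      have c3: "continuous_map ?T (discrete_topology I) (fst \<circ> snd)"
        by (rule continuous_map_compose[OF c2 continuous_map_fst])
      have c4': "continuous_map ?T (simplex_space n) (snd \<circ> snd)"
        by (rule continuous_map_compose[OF c2 continuous_map_snd])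
      have c4: "continuous_map ?T euclideanreal (\<lambda>w. snd (snd w) k)" for k
        using continuous_map_compose[OF c4' continuous_map_coordinate[of n k]] by (simp add: comp_def)
      have c5: "continuous_map ?T euclideanreal (\<lambda>w. depth (fst (snd w)) (snd (snd w)))"
        using continuous_map_compose[OF c2 continuous_map_depth] by (simp add: comp_def case_prod_unfold)
      have c6: "continuous_map ?T euclideanreal fst"
        by (rule continuous_map_into_fulltopology[OF continuous_map_fst])
      have pos: "1 - real (card C) * ?a w \<noteq> 0" if "w \<in> topspace ?T" for w
        using shrink_simplex(6)[OF mem[OF that]] by simp
      have c7: "continuous_map ?T euclideanreal (\<lambda>w. shrink (?a w) (snd (snd w)) k)" for k
      proof (cases "k \<in> C")
        case True
        have "continuous_map ?T euclideanreal
            (\<lambda>w. (snd (snd w) k - ?a w) / (1 - real (card C) * ?a w))"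
          by (intro continuous_map_real_divide continuous_map_diff continuous_map_real_mult
              continuous_map_const[THEN iffD2] c4 c5 c6 pos) simp_all
        then show ?thesis using True by (simp add: shrink_def)
      next
        case False
        then show ?thesis using c4 by (simp add: shrink_def)
      qed
      have "continuous_map ?T (powertop_real UNIV) (\<lambda>w. shrink (?a w) (snd (snd w)))"
        using c7 by (simp add: continuous_map_componentwise_UNIV)
      moreover have "shrink (?a w) (snd (snd w)) \<in> standard_simplex n" if "w \<in> topspace ?T" for w
        by (rule shrink_simplex(1)[OF mem[OF that]])
      ultimately have "continuous_map ?T (simplex_space n) (\<lambda>w. shrink (?a w) (snd (snd w)))"
        unfolding continuous_map_in_subtopology by blast
      with c3 show ?thesis
        unfolding comp_def by (rule continuous_map_pairedI)
    qed
    from continuous_map_compose[OF this quotient_imp_continuous_map[OF quot]]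
    show "continuous_map ?T X ?H" by (simp add: comp_def case_prod_unfold)
    show "?H \<in> topspace ?T \<rightarrow> punctured"
    proof
      fix w assume w: "w \<in> topspace ?T"
      show "?H w \<in> punctured"
        using shrink_simplex(3)[OF mem[OF w]] by (simp add: case_prod_unfold)
    qed
  qed
  have resp: "?H x = ?H y" if xy: "x \<in> topspace ?T" "y \<in> topspace ?T" "?Q x = ?Q y" for x y
  proof -
    obtain u j t j' t' where x: "x = (u, j, t)" and y: "y = (u, j', t')"
      using xy(3) by (cases x; cases y) auto
    have m: "j \<in> I" "j' \<in> I" "t \<in> standard_simplex n" "t' \<in> standard_simplex n" "q j t \<in> punctured"
        "0 \<le> u" "u \<le> 1" and eq: "q j t = q j' t'"
      using xy x y by auto
    have t': "t' = t" and R: "R (support t) j j'" using q_eq[OF m(1-4)] eq by auto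
    have d: "depth j t = depth j' t"
      using depth_cong[OF m(1-3)] m(5) eq t' by (simp add: punctured_def)
    let ?s = "shrink (u * depth j t) t"
    note s = shrink_simplex[OF m(1,3,5,6,7)]
    \<comment> \<open>Shrinking never enlarges the support, so points that are identified at time
      zero stay identified, by \<open>R_anti\<close>.\<close>
    have "R (support ?s) j j'"
      using R_anti[OF m(1,2) support_nonempty[OF s(1)] s(2) support_simplex[OF m(3)] R] .
    then have "q j ?s = q j' ?s" using q_eq_same[OF m(1,2) s(1)] by blast
    then show ?thesis by (simp add: x y t' d)
  qed
  obtain h where h: "continuous_map (prod_topology ?I (subtopology X punctured)) (subtopology X punctured) h"
    "h ` topspace (prod_topology ?I (subtopology X punctured)) = ?H ` topspace ?T"
    "\<And>x. x \<in> topspace ?T \<Longrightarrow> h (?Q x) = ?H x"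
    using resp by (rule quotient_map_lift_exists[OF quotI contH]) blast+
  have AX: "A \<subseteq> topspace X" using A by (simp add: subcomplex_def)
  have hq: "h (u, q j t) = q j (shrink (u * depth j t) t)"
    if "j \<in> I" "t \<in> standard_simplex n" "q j t \<in> punctured" "u \<in> {0..1}" for u j t
    using h(3)[of "(u, j, t)"] that by simp
  have rep: "\<exists>j t. j \<in> I \<and> t \<in> standard_simplex n \<and> x = q j t" if "x \<in> A" for x
    using that AX unfolding topspace_gluing by blast
  show thesis
  proof (rule that[OF h(1)])
    fix x assume x: "x \<in> punctured"
    then obtain j t where jt: "j \<in> I" "t \<in> standard_simplex n" "x = q j t"
      using rep[of x] x by (auto simp: punctured_def)
    show "h (0, x) = x" using hq[of j t 0] jt x by (simp add: shrink_0)
    show "h (1, x) \<in> A - cell"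
      using hq[of j t 1] jt x shrink_simplex(4)[of j t 1] by simp
  next
    fix x assume x: "x \<in> A - cell"
    then obtain j t where jt: "j \<in> I" "t \<in> standard_simplex n" "x = q j t"
      using rep[of x] x by auto
    have "depth j t = 0"
      using q_in_cell_iff[OF jt(1,2)] x jt(3) depth_nonneg[OF jt(2), of j] by (simp add: not_less antisym)
    then show "h (1, x) = x"
      using hq[of j t 1] jt x punctured_superset by (auto simp: shrink_0)
  qed
qed

lemma trivial_relative_homology_punctured:
  "trivial_group (relative_homology_group p (subtopology X punctured) (A - cell))"
proof -
  let ?I = "top_of_set {0..1 :: real}"
  obtain h where h:
    "continuous_map (prod_topology ?I (subtopology X punctured)) (subtopology X punctured) h"
    "\<And>x. x \<in> punctured \<Longrightarrow> h (0, x) = x" "\<And>x. x \<in> punctured \<Longrightarrow> h (1, x) \<in> A - cell"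
    "\<And>x. x \<in> A - cell \<Longrightarrow> h (1, x) = x"
    using deformation by metis
  have AX: "A \<subseteq> topspace X" using A by (simp add: subcomplex_def)
  have pX: "topspace (subtopology X punctured) = punctured"
    using AX by (auto simp: punctured_def)
  let ?f = "\<lambda>x. h (1, x)"
  have cf: "continuous_map (subtopology X punctured) (subtopology X punctured) ?f"
  proof -
    have "continuous_map (subtopology X punctured) (prod_topology ?I (subtopology X punctured)) (\<lambda>x. (1, x))"
      by (intro continuous_map_pairedI) auto
    from continuous_map_compose[OF this h(1)] show ?thesis by (simp add: comp_def)
  qed
  show ?thesis
  proof (rule trivial_relative_homology_group_gen[where f = ?f])
    show "continuous_map (subtopology X punctured) (subtopology (subtopology X punctured) (A - cell)) ?f"
      using cf h(3) pX by (auto simp: continuous_map_in_subtopology)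
    show "homotopic_with (\<lambda>h. True) (subtopology (subtopology X punctured) (A - cell))
        (subtopology (subtopology X punctured) (A - cell)) ?f id"
    proof (rule homotopic_with_equal)
      have "continuous_map (subtopology (subtopology X punctured) (A - cell)) (subtopology X punctured) ?f"
        by (rule continuous_map_from_subtopology[OF cf])
      then show "continuous_map (subtopology (subtopology X punctured) (A - cell))
          (subtopology (subtopology X punctured) (A - cell)) ?f"
        using h(3) punctured_superset by (auto simp: continuous_map_in_subtopology)
    qed (use h(4) in auto)
    have "homotopic_with (\<lambda>h. True) (subtopology X punctured) (subtopology X punctured) id ?f"
      using h(1,2) pX by (subst homotopic_with) (auto intro!: exI[of _ h])
    then show "homotopic_with (\<lambda>k. True) (subtopology X punctured) (subtopology X punctured) ?f id"
      by (simp add: homotopic_with_sym)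
  qed
qed

end

section \<open>Relative homology of a cell in terms of chains\<close>

definition simplex_boundary :: "nat \<Rightarrow> (nat \<Rightarrow> real) set" where
  "simplex_boundary k = {t \<in> standard_simplex k. \<exists>i\<le>k. t i = 0}"

text \<open>The pair looks like a \<open>k\<close>-simplex modulo its boundary in degrees from
  \<open>k\<close> upward: zero above \<open>k\<close>, and infinite cyclic in degree
  \<open>k\<close> with the class of \<open>\<sigma>\<close> as generator. Naming the generator as a
  singular simplex allows coefficients of chains to be compared later.\<close>

definition cell_homology ::
    "nat \<Rightarrow> 'a topology \<Rightarrow> 'a set \<Rightarrow> ((nat \<Rightarrow> real) \<Rightarrow> 'a) \<Rightarrow> bool" where
  "cell_homology k Y L \<sigma> \<longleftrightarrow>
     singular_relcycle k Y L (frag_of \<sigma>) \<and>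
     (\<forall>p c. k < p \<longrightarrow> singular_relcycle p Y L c \<longrightarrow> singular_relboundary p Y L c) \<and>
     (\<forall>c. singular_relcycle k Y L c \<longrightarrow> (\<exists>a. homologous_rel k Y L c (frag_cmul a (frag_of \<sigma>)))) \<and>
     (\<forall>a. singular_relboundary k Y L (frag_cmul a (frag_of \<sigma>)) \<longrightarrow> a = 0)"

lemma cell_homology_transfer:
  assumes ch: "cell_homology k Y L \<sigma>"
    and f: "continuous_map Y Z f" and fL: "f ` L \<subseteq> B"
    and iso: "\<And>p. hom_induced p Y L Z B f \<in> iso (relative_homology_group p Y L) (relative_homology_group p Z B)"
  shows "cell_homology k Z B (simplex_map k f \<sigma>)"
proof -
  have fL': "f \<in> L \<rightarrow> B" using fL by blast
  have \<sigma>: "chain_map k f (frag_of \<sigma>) = frag_of (simplex_map k f \<sigma>)" by simp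
  have rc: "singular_relcycle k Y L (frag_of \<sigma>)" using ch by (simp add: cell_homology_def)
  show ?thesis
    unfolding cell_homology_def
  proof (intro conjI allI impI)
    show "singular_relcycle k Z B (frag_of (simplex_map k f \<sigma>))"
      using singular_relcycle_chain_map[OF rc f fL'] by simp
  next
    fix p c assume "k < p" and c: "singular_relcycle p Z B c"
    then obtain c' where c': "singular_relcycle p Y L c'" "homologous_rel p Z B c (chain_map p f c')"
      using relcycle_from_iso[OF f fL iso c] by blast
    then have "singular_relboundary p Y L c'" using ch \<open>k < p\<close> by (simp add: cell_homology_def)
    then have "singular_relboundary p Z B (chain_map p f c')"
      by (rule singular_relboundary_chain_map[OF _ f fL'])
    then have "singular_relboundary p Z B ((c - chain_map p f c') + chain_map p f c')"
      using c'(2) unfolding homologous_rel_def by (intro singular_relboundary_add)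
    then show "singular_relboundary p Z B c" by simp
  next
    fix c assume c: "singular_relcycle k Z B c"
    then obtain c' where c': "singular_relcycle k Y L c'" "homologous_rel k Z B c (chain_map k f c')"
      using relcycle_from_iso[OF f fL iso c] by blast
    then obtain a where "homologous_rel k Y L c' (frag_cmul a (frag_of \<sigma>))"
      using ch by (auto simp: cell_homology_def)
    then have "singular_relboundary k Z B (chain_map k f (c' - frag_cmul a (frag_of \<sigma>)))"
      unfolding homologous_rel_def by (rule singular_relboundary_chain_map[OF _ f fL'])
    then have "homologous_rel k Z B (chain_map k f c') (frag_cmul a (frag_of (simplex_map k f \<sigma>)))"
      by (simp add: homologous_rel_def chain_map_diff)
    then show "\<exists>a. homologous_rel k Z B c (frag_cmul a (frag_of (simplex_map k f \<sigma>)))"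
      using homologous_rel_trans c'(2) by blast
  next
    fix a assume "singular_relboundary k Z B (frag_cmul a (frag_of (simplex_map k f \<sigma>)))"
    then have "singular_relboundary k Z B (chain_map k f (frag_cmul a (frag_of \<sigma>)))" by simp
    then have "singular_relboundary k Y L (frag_cmul a (frag_of \<sigma>))"
      by (rule relboundary_from_iso[OF f fL iso singular_relcycle_cmul[OF rc]])
    then show "a = 0" using ch by (simp add: cell_homology_def)
  qed
qed

text \<open>One simplex is a gluing with a single piece, so the results on cells apply to the
  standard simplex itself and to its faces.\<close>

lemma simplex_gluing_simplex: "simplex_gluing n (simplex_space n) {()} (\<lambda>_ _ _. True) (\<lambda>_ t. t)"
proof
  show "quotient_map (prod_topology (discrete_topology {()}) (simplex_space n)) (simplex_space n) (\<lambda>(i, t). t)"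
  proof -
    have "retraction_map (prod_topology (discrete_topology {()}) (simplex_space n)) (simplex_space n) snd"
      unfolding retraction_map_def retraction_maps_def
      by (rule exI[of _ "\<lambda>t. ((), t)"]) (auto intro: continuous_map_snd continuous_map_pairedI)
    then have "quotient_map (prod_topology (discrete_topology {()}) (simplex_space n)) (simplex_space n) snd"
      by (rule retraction_imp_quotient_map)
    moreover have "(\<lambda>(i :: unit, t :: nat \<Rightarrow> real). t) = snd" by auto
    ultimately show ?thesis by (simp only:)
  qed
qed auto

lemma simplex_support_interior:
  "t \<in> standard_simplex k \<Longrightarrow> t \<in> simplex_boundary k \<longleftrightarrow> support t \<noteq> {..k}"
  using support_simplex[of t k] by (fastforce simp: simplex_boundary_def support_def)

text \<open>The cell locale for the interior of the simplex as the removed cell. These facts provide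
  the source side of \<open>iso_relative_homeomorphism\<close>.\<close>

lemma
  shows closedin_simplex_boundary: "closedin (simplex_space k) (simplex_boundary k)"
    and openin_punctured_simplex: "openin (simplex_space k) (standard_simplex k - {barycenter {..k}})"
    and simplex_boundary_subset_punctured: "simplex_boundary k \<subseteq> standard_simplex k - {barycenter {..k}}"
    and trivial_homology_punctured_simplex: "trivial_group (relative_homology_group p
        (subtopology (simplex_space k) (standard_simplex k - {barycenter {..k}})) (simplex_boundary k))"
proof -
  interpret S: simplex_gluing k "simplex_space k" "{()}" "\<lambda>_ _ _. True" "\<lambda>_ t. t"
    by (rule simplex_gluing_simplex)
  interpret S: simplex_gluing_cell k "simplex_space k" "{()}" "\<lambda>_ _ _. True" "\<lambda>_ t. t"
      "standard_simplex k" "()" "{..k}"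
  proof
    show "S.subcomplex (standard_simplex k)" by (auto simp: S.subcomplex_def)
    show "barycenter {..k} \<in> standard_simplex k" by (rule barycenter_in_simplex) auto
    show "support t = {..k}" if "t \<in> standard_simplex k" "{..k} \<subseteq> support t" for t
      using that support_simplex by blast
  qed auto
  have cell: "standard_simplex k - S.cell = simplex_boundary k"
    using simplex_support_interior[of _ k] unfolding S.cell_def by (auto simp: simplex_boundary_def)
  have p: "S.punctured = standard_simplex k - {barycenter {..k}}"
    by (simp add: S.punctured_def)
  show "closedin (simplex_space k) (simplex_boundary k)"
    using S.closedin_subcomplex[OF S.subcomplex_diff_cell] by (simp add: cell)
  show "openin (simplex_space k) (standard_simplex k - {barycenter {..k}})"
    using S.openin_punctured by (simp add: p subtopology_subtopology)
  show "simplex_boundary k \<subseteq> standard_simplex k - {barycenter {..k}}"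
    using S.punctured_superset by (simp only: cell p)
  show "trivial_group (relative_homology_group p
        (subtopology (simplex_space k) (standard_simplex k - {barycenter {..k}})) (simplex_boundary k))"
    using S.trivial_relative_homology_punctured[of p] by (simp only: cell p)
qed

definition face_embedding :: "nat set \<Rightarrow> (nat \<Rightarrow> nat) \<Rightarrow> (nat \<Rightarrow> real) \<Rightarrow> nat \<Rightarrow> real" where
  "face_embedding C e t = (\<lambda>i. if i \<in> C then t (e i) else 0)"

lemma continuous_map_face_embedding:
  assumes e: "bij_betw e C {..k}" and C: "C \<subseteq> {..n}"
  shows face_embedding_in_simplex: "t \<in> standard_simplex k \<Longrightarrow> face_embedding C e t \<in> standard_simplex n"
    and "continuous_map (simplex_space k) (simplex_space n) (face_embedding C e)"
proof -
  show *: "face_embedding C e t \<in> standard_simplex n" if t: "t \<in> standard_simplex k" for t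
  proof (rule simplexI[where C = C])
    show "0 \<le> face_embedding C e t i" for i
      using t by (simp add: face_embedding_def standard_simplex_def)
    show "support (face_embedding C e t) \<subseteq> C"
      by (auto simp: support_def face_embedding_def)
    have "sum (face_embedding C e t) C = (\<Sum>i\<in>C. t (e i))"
      by (simp add: face_embedding_def)
    also have "\<dots> = sum t {..k}" by (rule sum.reindex_bij_betw[OF e])
    finally show "sum (face_embedding C e t) C = 1" using t by (simp add: standard_simplex_def)
  qed (rule C)
  have "continuous_map (simplex_space k) euclideanreal (\<lambda>t. face_embedding C e t i)" for i
    using continuous_map_coordinate[of k "e i"] by (cases "i \<in> C") (simp_all add: face_embedding_def)
  then show "continuous_map (simplex_space k) (simplex_space n) (face_embedding C e)"
    using * by (simp add: continuous_map_in_subtopology continuous_map_componentwise_UNIV)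
qed

lemma support_face_embedding:
  assumes "bij_betw e C {..k}" and t: "t \<in> standard_simplex k"
  shows "support (face_embedding C e t) = C \<longleftrightarrow> support t = {..k}"
proof -
  have "support (face_embedding C e t) = C \<longleftrightarrow> (\<forall>i\<in>C. t (e i) \<noteq> 0)"
    by (auto simp: support_def face_embedding_def)
  also have "\<dots> \<longleftrightarrow> (\<forall>l\<in>{..k}. t l \<noteq> 0)"
    unfolding bij_betw_imp_surj_on[OF assms(1), symmetric] by simp
  also have "\<dots> \<longleftrightarrow> support t = {..k}"
    using support_simplex[OF t] unfolding support_def by auto
  finally show ?thesis .
qed

context simplex_gluing_cell
begin

text \<open>\<open>\<Phi>\<close> is the characteristic map of the cell, with \<open>e\<close>
  numbering its vertices. It is a homeomorphism from the open simplex onto the open cell and takes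
  barycenter to barycenter, so the two punctured neighbourhoods correspond.\<close>

lemma
  assumes e: "bij_betw e C {..k}"
  defines "\<Phi> \<equiv> (\<lambda>t. q i0 (face_embedding C e t))"
  shows continuous_map_cell: "continuous_map (simplex_space k) (subtopology X A) \<Phi>"
    and boundary_cell: "\<Phi> ` simplex_boundary k \<subseteq> A - cell"
    and iso_cell: "hom_induced p (simplex_space k) (simplex_boundary k) (subtopology X A) (A - cell) \<Phi>
      \<in> iso (relative_homology_group p (simplex_space k) (simplex_boundary k))
            (relative_homology_group p (subtopology X A) (A - cell))"
proof -
  note emb = continuous_map_face_embedding[OF e C(2)]
  have AX: "A \<subseteq> topspace X" using A by (simp add: subcomplex_def)
  have bC: "support (barycenter C) = C" using support_barycenter finite_C C(1) by blast
  have supp: "support (face_embedding C e t) \<subseteq> support (barycenter C)" for t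
    unfolding bC by (auto simp: support_def face_embedding_def)
  have \<Phi>A: "\<Phi> t \<in> A" if "t \<in> standard_simplex k" for t
    unfolding \<Phi>_def
    by (rule subcomplexD[OF A bary_A i0 bary_simplex emb(1)[OF that] supp])
  have "continuous_map (simplex_space k) X \<Phi>"
    using continuous_map_compose[OF emb(2) continuous_map_q[OF i0]] by (simp add: \<Phi>_def comp_def)
  then show cont: "continuous_map (simplex_space k) (subtopology X A) \<Phi>"
    using \<Phi>A by (simp add: continuous_map_in_subtopology)
  have inj: "t = u" if "t \<in> standard_simplex k" "u \<in> standard_simplex k" "\<Phi> t = \<Phi> u" for t u
  proof
    fix l
    have eq: "face_embedding C e t = face_embedding C e u"
      using that q_eq[OF i0 i0 emb(1) emb(1)] by (simp add: \<Phi>_def)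
    show "t l = u l"
    proof (cases "l \<le> k")
      case True
      then obtain i where i: "i \<in> C" "l = e i" using bij_betw_imp_surj_on[OF e] by blast
      then show ?thesis using fun_cong[OF eq, of i] by (simp add: face_embedding_def)
    next
      case False
      then show ?thesis using that by (simp add: standard_simplex_def)
    qed
  qed
  have \<Phi>cell: "\<Phi> t \<in> cell \<longleftrightarrow> t \<notin> simplex_boundary k" if t: "t \<in> standard_simplex k" for t
  proof -
    have "\<Phi> t \<in> cell \<longleftrightarrow> support (face_embedding C e t) = C"
    proof
      assume "\<Phi> t \<in> cell"
      then obtain u where u: "u \<in> standard_simplex n" "support u = C" "q i0 (face_embedding C e t) = q i0 u"
        unfolding \<Phi>_def cell_def mem_Collect_eq by metis
      then have "face_embedding C e t = u" using q_eq[OF i0 i0 emb(1)[OF t] u(1)] by (simp only:)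
      then show "support (face_embedding C e t) = C" using u(2) by (simp only:)
    next
      assume "support (face_embedding C e t) = C"
      then show "\<Phi> t \<in> cell" unfolding \<Phi>_def cell_def mem_Collect_eq using emb(1)[OF t] by metis
    qed
    then show ?thesis
      using support_face_embedding[OF e t] simplex_support_interior[OF t] by blast
  qed
  have bs: "simplex_boundary k \<subseteq> standard_simplex k" by (auto simp: simplex_boundary_def)
  show bd: "\<Phi> ` simplex_boundary k \<subseteq> A - cell"
    using \<Phi>A \<Phi>cell bs by blast
  have bary: "\<Phi> (barycenter {..k}) = q i0 (barycenter C)"
  proof -
    have "card C = Suc k" using bij_betw_same_card[OF e] by simp
    moreover have "e i \<le> k" if "i \<in> C" for i using bij_betw_imp_surj_on[OF e] that by blast
    ultimately have "face_embedding C e (barycenter {..k}) = barycenter C"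
      by (simp add: face_embedding_def barycenter_def fun_eq_iff)
    then show ?thesis by (simp add: \<Phi>_def)
  qed
  have sb: "barycenter {..k} \<in> standard_simplex k" by (rule barycenter_in_simplex) auto
  have surj: "\<exists>t\<in>standard_simplex k. x = \<Phi> t \<and> t = (\<lambda>l. if l \<le> k then u (inv_into C e l) else 0)"
    if u: "u \<in> standard_simplex n" "support u = C" "x = q i0 u" for x u
  proof -
    let ?t = "\<lambda>l. if l \<le> k then u (inv_into C e l) else 0"
    have "sum ?t {..k} = sum ?t (e ` C)" using bij_betw_imp_surj_on[OF e] by simp
    also have "\<dots> = (\<Sum>i\<in>C. ?t (e i))"
      using sum.reindex_bij_betw[OF e, of ?t] bij_betw_imp_surj_on[OF e] by simp
    also have "\<dots> = sum u C"
    proof (rule sum.cong)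
      fix i assume i: "i \<in> C"
      then have "e i \<le> k" using bij_betw_imp_surj_on[OF e] by blast
      then show "?t (e i) = u i" using i bij_betw_inv_into_left[OF e] by simp
    qed simp
    also have "\<dots> = 1" using sum_support_simplex[OF u(1)] u(2) C(2) by simp
    finally have s: "sum ?t {..k} = 1" .
    have t: "?t \<in> standard_simplex k"
    proof (rule simplexI[where C = "{..k}"])
      show "0 \<le> ?t l" for l using u(1) by (simp add: standard_simplex_def)
      show "support ?t \<subseteq> {..k}" by (auto simp: support_def)
    qed (use s in auto)
    have "face_embedding C e ?t = u"
    proof
      fix i show "face_embedding C e ?t i = u i"
      proof (cases "i \<in> C")
        case True
        then have "e i \<le> k" using bij_betw_imp_surj_on[OF e] by blast
        then show ?thesis using True bij_betw_inv_into_left[OF e] by (simp add: face_embedding_def)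
      next
        case False
        then have "u i = 0" using u(2) by (auto simp: support_def)
        then show ?thesis using False by (simp add: face_embedding_def)
      qed
    qed
    then have "x = \<Phi> ?t" using u(3) by (simp add: \<Phi>_def)
    then show ?thesis using t by blast
  qed
  have cellA: "A - (A - cell) = cell" using cell_subset by blast
  have sXA: "topspace (subtopology X A) = A" using AX by auto
  have sp: "subtopology (subtopology X A) punctured = subtopology X punctured"
    using punctured_def by (simp add: subtopology_subtopology Int_absorb1)
  show "hom_induced p (simplex_space k) (simplex_boundary k) (subtopology X A) (A - cell) \<Phi>
      \<in> iso (relative_homology_group p (simplex_space k) (simplex_boundary k))
            (relative_homology_group p (subtopology X A) (A - cell))"
  proof (rule iso_relative_homeomorphism[OF closedin_simplex_boundary openin_punctured_simplex
        simplex_boundary_subset_punctured _ openin_punctured punctured_superset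
        trivial_homology_punctured_simplex _ cont bd])
    show "closedin (subtopology X A) (A - cell)"
      using closedin_subcomplex[OF subcomplex_diff_cell] by (simp add: closedin_subset_topspace)
    show "trivial_group (relative_homology_group p (subtopology (subtopology X A) punctured) (A - cell))" for p
      unfolding sp by (rule trivial_relative_homology_punctured)
    show "\<Phi> ` (standard_simplex k - {barycenter {..k}} - simplex_boundary k) = punctured - (A - cell)"
    proof (intro equalityI subsetI)
      fix x assume "x \<in> \<Phi> ` (standard_simplex k - {barycenter {..k}} - simplex_boundary k)"
      then obtain t where t: "t \<in> standard_simplex k" "t \<noteq> barycenter {..k}" "t \<notin> simplex_boundary k" "x = \<Phi> t"
        by blast
      have "x \<noteq> q i0 (barycenter C)" using inj[OF t(1) sb] t(2,4) bary by metis
      then show "x \<in> punctured - (A - cell)"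
        using \<Phi>A[OF t(1)] \<Phi>cell[OF t(1)] t(3,4) by (simp add: punctured_def)
    next
      fix x assume x: "x \<in> punctured - (A - cell)"
      then have xc: "x \<in> cell" and xb: "x \<noteq> q i0 (barycenter C)" by (auto simp: punctured_def)
      then obtain t where t: "t \<in> standard_simplex k" "x = \<Phi> t"
        using surj unfolding cell_def by blast
      have "t \<noteq> barycenter {..k}" using xb t(2) bary by metis
      then show "x \<in> \<Phi> ` (standard_simplex k - {barycenter {..k}} - simplex_boundary k)"
        using t \<Phi>cell[OF t(1)] xc by blast
    qed
    \<comment> \<open>The inverse of \<open>\<Phi>\<close> reads off the barycentric coordinates,
      which are continuous on all of \<open>X\<close>, and renumbers them.\<close>
    obtain co where co: "continuous_map X (simplex_space n) co"
      "\<And>i t. i \<in> I \<Longrightarrow> t \<in> standard_simplex n \<Longrightarrow> co (q i t) = t"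
      using coordinates by blast
    let ?g = "\<lambda>x l. if l \<le> k then co x (inv_into C e l) else 0"
    let ?Y = "subtopology (simplex_space k) (standard_simplex k - simplex_boundary k)"
    let ?Z = "subtopology (subtopology X A) cell"
    have gx: "?g x \<in> standard_simplex k \<and> x = \<Phi> (?g x)" if xcell: "x \<in> cell" for x
    proof -
      obtain u where u: "u \<in> standard_simplex n" "support u = C" "x = q i0 u"
        using xcell unfolding cell_def mem_Collect_eq by metis
      then have "co x = u" using co(2)[OF i0] by simp
      then show ?thesis using surj[OF u] by metis
    qed
    have "homeomorphic_maps ?Y ?Z \<Phi> ?g"
      unfolding homeomorphic_maps_def
    proof (intro conjI ballI)
      have "continuous_map ?Y (subtopology X A) \<Phi>"
        by (rule continuous_map_from_subtopology[OF cont])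
      then show "continuous_map ?Y ?Z \<Phi>"
        using \<Phi>cell by (subst continuous_map_in_subtopology) auto
      have "continuous_map ?Z euclideanreal (\<lambda>x. ?g x l)" for l
      proof (cases "l \<le> k")
        case True
        have "continuous_map X euclideanreal (\<lambda>x. co x (inv_into C e l))"
          using continuous_map_compose[OF co(1) continuous_map_coordinate] by (simp add: comp_def)
        then show ?thesis using True by (simp add: continuous_map_from_subtopology)
      qed simp
      then have "continuous_map ?Z (powertop_real UNIV) ?g"
        by (simp add: continuous_map_componentwise_UNIV)
      moreover have "?g x \<in> standard_simplex k - simplex_boundary k" if "x \<in> cell" for x
        using gx[OF that] \<Phi>cell[of "?g x"] that by simp
      ultimately show "continuous_map ?Z ?Y ?g"
        by (simp add: continuous_map_in_subtopology)
      show "?g (\<Phi> t) = t" if "t \<in> topspace ?Y" for t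
      proof -
        have t: "t \<in> standard_simplex k" "t \<notin> simplex_boundary k" using that by auto
        then have "\<Phi> t \<in> cell" using \<Phi>cell by blast
        from gx[OF this] show ?thesis using inj[OF _ t(1), of "?g (\<Phi> t)"] by simp
      qed
      show "\<Phi> (?g x) = x" if "x \<in> topspace ?Z" for x
        using gx[of x] that by auto
    qed
    then show "homeomorphic_map (subtopology (simplex_space k) (topspace (simplex_space k) - simplex_boundary k))
        (subtopology (subtopology X A) (topspace (subtopology X A) - (A - cell))) \<Phi>"
      unfolding topspace_standard_simplex sXA cellA using homeomorphic_map_maps by blast
  qed
qed

end

section \<open>The simplex relative to its boundary\<close>

lemma contractible_space_starlike:
  fixes v :: "nat \<Rightarrow> real"
  assumes "v \<in> S" "\<And>x u. \<lbrakk>x \<in> S; 0 \<le> u; u \<le> 1\<rbrakk> \<Longrightarrow> (\<lambda>i. (1 - u) * x i + u * v i) \<in> S"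
  shows "contractible_space (subtopology (powertop_real UNIV) S)"
  unfolding contractible_space_def
proof (rule exI[of _ v])
  let ?X = "subtopology (powertop_real UNIV) S"
  let ?T = "prod_topology (top_of_set {0..1 :: real}) ?X"
  let ?h = "\<lambda>w i. (1 - fst w) * snd w i + fst w * v i"
  have c1: "continuous_map ?T euclideanreal fst"
    by (rule continuous_map_into_fulltopology[OF continuous_map_fst])
  have c2: "continuous_map ?T euclideanreal (\<lambda>w. snd w i)" for i
  proof -
    have "continuous_map ?X euclideanreal (\<lambda>t. t i)"
      by (intro continuous_map_from_subtopology continuous_map_product_projection) auto
    then show ?thesis using continuous_map_compose[OF continuous_map_snd] by (simp add: comp_def)
  qed
  have "continuous_map ?T euclideanreal (\<lambda>w. ?h w i)" for i
    by (intro continuous_map_add continuous_map_diff continuous_map_real_mult c1 c2) simp_all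
  then have "continuous_map ?T (powertop_real UNIV) ?h"
    by (simp add: continuous_map_componentwise_UNIV)
  moreover have "?h w \<in> S" if "w \<in> topspace ?T" for w
    using assms(2)[of "snd w" "fst w"] that by auto
  ultimately have "continuous_map ?T ?X ?h"
    by (simp add: continuous_map_in_subtopology)
  then show "homotopic_with (\<lambda>x. True) ?X ?X id (\<lambda>x. v)"
    by (subst homotopic_with) (auto intro!: exI[of _ ?h])
qed

lemma cycle_is_boundary_contractible:
  assumes "contractible_space X" "0 < p" "singular_relcycle p X {} c"
  shows "singular_relboundary p X {} c"
proof -
  have "trivial_group (homology_group (int p) X)"
    using trivial_reduced_homology_group_contractible_space[OF assms(1), of "int p"]
      un_reduced_homology_group[of "int p" X] assms(2) by simp
  moreover have "homologous_rel_set p X {} c \<in> carrier (homology_group (int p) X)"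
    using assms(3) by (auto simp: carrier_relative_homology_group)
  ultimately have "homologous_rel_set p X {} c = singular_relboundary_set p X {}"
    by (simp add: trivial_group_def)
  then show ?thesis by (simp add: homologous_rel_set_eq_relboundary)
qed

abbreviation fundamental_simplex :: "nat \<Rightarrow> (nat \<Rightarrow> real) \<Rightarrow> nat \<Rightarrow> real" where
  "fundamental_simplex k \<equiv> restrict id (standard_simplex k)"

lemma singular_simplex_fundamental: "singular_simplex k (simplex_space k) (fundamental_simplex k)"
proof -
  have "continuous_map (simplex_space k) (simplex_space k) (fundamental_simplex k)"
    by (rule continuous_map_eq[OF continuous_map_id]) simp
  then show ?thesis by (simp add: singular_simplex_def)
qed

lemma singular_face_fundamental:
  "singular_face (Suc k) j (fundamental_simplex (Suc k)) = restrict (simplical_face j) (standard_simplex k)"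
  if "j \<le> Suc k"
proof
  fix x
  show "singular_face (Suc k) j (fundamental_simplex (Suc k)) x = restrict (simplical_face j) (standard_simplex k) x"
    using simplical_face_in_standard_simplex[of "Suc k" j x] that
    by (simp add: singular_face_def)
qed

lemma relcycle_fundamental:
  "singular_relcycle k (simplex_space k) (simplex_boundary k) (frag_of (fundamental_simplex k))"
proof (cases k)
  case 0
  then show ?thesis
    using singular_simplex_fundamental[of 0]
    by (simp add: singular_relcycle singular_chain_of chain_boundary_of)
next
  case (Suc n)
  have "singular_chain n (subtopology (simplex_space k) (simplex_boundary k))
      (frag_of (singular_face k j (fundamental_simplex k)))" if j: "j \<le> k" for j
  proof -
    have "singular_simplex (k - Suc 0) (simplex_space k) (singular_face k j (fundamental_simplex k))"
      using j Suc by (intro singular_simplex_singular_face[OF singular_simplex_fundamental]) auto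
    moreover have "singular_face k j (fundamental_simplex k) ` standard_simplex n \<subseteq> simplex_boundary k"
    proof
      fix y assume "y \<in> singular_face k j (fundamental_simplex k) ` standard_simplex n"
      then obtain x where x: "x \<in> standard_simplex n" "y = simplical_face j x"
        using singular_face_fundamental[of j n] j Suc by auto
      then have "y \<in> standard_simplex k"
        using simplical_face_in_standard_simplex[of k j x] j Suc by simp
      moreover have "y j = 0" using x by (simp add: simplical_face_def)
      ultimately show "y \<in> simplex_boundary k" using j by (auto simp: simplex_boundary_def)
    qed
    ultimately show ?thesis using Suc by (simp add: singular_chain_of singular_simplex_subtopology)
  qed
  then have "singular_chain n (subtopology (simplex_space k) (simplex_boundary k))
      (\<Sum>j\<le>k. frag_cmul ((-1) ^ j) (frag_of (singular_face k j (fundamental_simplex k))))"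
    by (intro singular_chain_sum singular_chain_cmul) simp
  moreover have "chain_boundary k (frag_of (fundamental_simplex k))
      = (\<Sum>j\<le>k. frag_cmul ((-1) ^ j) (frag_of (singular_face k j (fundamental_simplex k))))"
    using Suc by (simp only: chain_boundary_of) simp
  ultimately have "singular_chain n (subtopology (simplex_space k) (simplex_boundary k))
      (chain_boundary k (frag_of (fundamental_simplex k)))"
    by (simp only:)
  then show ?thesis
    using singular_simplex_fundamental[of k] Suc by (simp add: singular_relcycle singular_chain_of)
qed

lemma cell_homology_simplex_0:
  "cell_homology 0 (simplex_space 0) (simplex_boundary 0) (fundamental_simplex 0)"
proof -
  let ?v = "\<lambda>j::nat. if j = 0 then 1 else 0 :: real"
  have top: "topspace (simplex_space 0) = {?v}"
    using standard_simplex_0 by simp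
  have bd: "simplex_boundary 0 = {}"
    by (auto simp: simplex_boundary_def standard_simplex_0)
  have f: "fundamental_simplex 0 = restrict (\<lambda>x. ?v) (standard_simplex 0)"
    by (rule ext) (simp add: standard_simplex_0 restrict_def)
  show ?thesis
    unfolding cell_homology_def
  proof (intro conjI allI impI)
    show "singular_relcycle 0 (simplex_space 0) (simplex_boundary 0) (frag_of (fundamental_simplex 0))"
      by (rule relcycle_fundamental)
    show "singular_relboundary p (simplex_space 0) (simplex_boundary 0) c"
      if "0 < p" "singular_relcycle p (simplex_space 0) (simplex_boundary 0) c" for p c
      using singular_boundary_eq_cycle_singleton[OF top, of p c] that unfolding bd by simp
    show "\<exists>a. homologous_rel 0 (simplex_space 0) (simplex_boundary 0) c (frag_cmul a (frag_of (fundamental_simplex 0)))"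
      if "singular_relcycle 0 (simplex_space 0) (simplex_boundary 0) c" for c
    proof -
      have "singular_chain 0 (simplex_space 0) c" using that by (simp add: singular_relcycle)
      then obtain b where "c = frag_cmul b (frag_of (fundamental_simplex 0))"
        using singular_chain_singleton[OF top] unfolding f by blast
      then show ?thesis by (intro exI[of _ b]) simp
    qed
    show "a = 0" if "singular_relboundary 0 (simplex_space 0) (simplex_boundary 0)
        (frag_cmul a (frag_of (fundamental_simplex 0)))" for a
    proof -
      have "frag_cmul a (frag_of (fundamental_simplex 0)) = 0"
        using singular_boundary_singleton[OF top, of 0] that unfolding bd by simp
      then show ?thesis by (simp add: frag_cmul_eq_0_iff)
    qed
  qed
qed

lemma (in simplex_gluing_cell) cell_homology_cell:
  assumes e: "bij_betw e C {..k}"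
    and simplex: "cell_homology k (simplex_space k) (simplex_boundary k) (fundamental_simplex k)"
  shows "cell_homology k (subtopology X A) (A - cell)
    (restrict (\<lambda>t. q i0 (face_embedding C e t)) (standard_simplex k))"
proof -
  have "simplex_map k (\<lambda>t. q i0 (face_embedding C e t)) (fundamental_simplex k)
      = restrict (\<lambda>t. q i0 (face_embedding C e t)) (standard_simplex k)"
    by (rule ext) (simp add: simplex_map_def restrict_def)
  then show ?thesis
    using cell_homology_transfer[OF simplex continuous_map_cell[OF e] boundary_cell[OF e] iso_cell[OF e]]
    by (simp only:)
qed

lemma boundary_of_cycle_in_contractible:
  assumes "contractible_space X" "0 < p" "singular_chain p X c" "chain_boundary p c = 0"
  obtains g where "singular_chain (Suc p) X g" "chain_boundary (Suc p) g = c"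
  using cycle_is_boundary_contractible[OF assms(1,2), of c] assms(3,4)
  by (auto simp: singular_cycle singular_boundary)

text \<open>Collapsing \<open>Y\<close> to \<open>v\<close> kills the boundary of every 1-chain but
  fixes chains that already live at \<open>v\<close>.\<close>

lemma zero_boundary_in_singleton:
  assumes c: "singular_chain 1 Y c" and e: "singular_chain 0 (subtopology Y {v}) (chain_boundary 1 c)"
    and v: "v \<in> topspace Y"
  shows "chain_boundary 1 c = 0"
proof -
  let ?V = "subtopology Y {v}" and ?f = "\<lambda>x. v"
  have V: "topspace ?V = {v}" using v by auto
  have f: "continuous_map Y ?V ?f" using v by (simp add: continuous_map_in_subtopology)
  have "singular_chain 1 ?V (chain_map 1 ?f c)" by (rule singular_chain_chain_map[OF c f])
  then have "chain_boundary 1 (chain_map 1 ?f c) = 0"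
    using chain_boundary_of_singleton[OF V, of 1] by simp
  then have "chain_map 0 ?f (chain_boundary 1 c) = 0"
    using chain_boundary_chain_map[OF c, of ?f] by simp
  moreover have "chain_map 0 ?f (chain_boundary 1 c) = chain_boundary 1 c"
    using V by (intro chain_map_id_gen[OF e]) auto
  ultimately show ?thesis by simp
qed

text \<open>
  \<open>\<Delta>\<close> and the horn \<open>\<Lambda>\<close> (the boundary without the open last facet) are contractible, so the
  homology of \<open>(\<Delta>, \<partial>\<Delta>)\<close> is that of \<open>(\<partial>\<Delta>, \<Lambda>)\<close> shifted by one, and the latter
  is the homology of the last facet relative to its boundary.
\<close>

lemma cell_homology_simplex_Suc:
  assumes IH: "cell_homology k (simplex_space k) (simplex_boundary k) (fundamental_simplex k)"
  shows "cell_homology (Suc k) (simplex_space (Suc k)) (simplex_boundary (Suc k)) (fundamental_simplex (Suc k))"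
proof -
  let ?n = "Suc k"
  let ?Y = "simplex_space ?n" and ?L = "simplex_boundary ?n" and ?\<iota> = "fundamental_simplex ?n"
  interpret S: simplex_gluing ?n ?Y "{()}" "\<lambda>_ _ _. True" "\<lambda>_ t. t"
    by (rule simplex_gluing_simplex)
  interpret S: simplex_gluing_cell ?n ?Y "{()}" "\<lambda>_ _ _. True" "\<lambda>_ t. t" ?L "()" "{..k}"
  proof
    show "S.subcomplex ?L"
      unfolding S.subcomplex_def
    proof (intro conjI ballI impI)
      show "?L \<subseteq> topspace ?Y" by (auto simp: simplex_boundary_def)
      fix t u assume "u \<in> standard_simplex ?n" "t \<in> ?L" "support u \<subseteq> support t"
      then show "u \<in> ?L" by (auto simp: simplex_boundary_def support_def)
    qed
    have "barycenter {..k} \<in> standard_simplex ?n" by (rule barycenter_in_simplex) auto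
    moreover have "barycenter {..k} ?n = 0" by (simp add: barycenter_def)
    ultimately show "barycenter {..k} \<in> ?L" by (auto simp: simplex_boundary_def)
    show "support t = {..k}" if "t \<in> standard_simplex ?n" "t \<in> ?L" "{..k} \<subseteq> support t" for t
    proof -
      have "support t \<noteq> {..?n}" using simplex_support_interior[OF that(1)] that(2) by blast
      moreover have "support t \<subseteq> {..?n}" by (rule support_simplex[OF that(1)])
      ultimately show ?thesis using that(3) by (auto simp: atMost_Suc)
    qed
  qed auto
  define \<Lambda> where "\<Lambda> = ?L - S.cell"
  have \<Lambda>_iff: "t \<in> \<Lambda> \<longleftrightarrow> t \<in> standard_simplex ?n \<and> (\<exists>i\<le>k. t i = 0)" for t
  proof -
    have "t \<in> \<Lambda> \<longleftrightarrow> t \<in> standard_simplex ?n \<and> support t \<noteq> {..?n} \<and> support t \<noteq> {..k}"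
      using simplex_support_interior[of t ?n] unfolding \<Lambda>_def S.cell_def simplex_boundary_def by blast
    moreover have "support t \<noteq> {..?n} \<and> support t \<noteq> {..k} \<longleftrightarrow> (\<exists>i\<le>k. t i = 0)" if "t \<in> standard_simplex ?n"
      using support_simplex[OF that] by (auto simp: support_def atMost_Suc)
    ultimately show ?thesis by blast
  qed
  have \<Lambda>L: "\<Lambda> \<subseteq> ?L" by (simp add: \<Lambda>_def)
  have Ls: "?L \<subseteq> standard_simplex ?n" by (auto simp: simplex_boundary_def)
  define \<tau> where "\<tau> = singular_face ?n ?n ?\<iota>"
  have \<tau>: "cell_homology k (subtopology ?Y ?L) \<Lambda> \<tau>"
  proof -
    have "restrict (\<lambda>t. face_embedding {..k} id t) (standard_simplex k) = \<tau>"
    proof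
      fix x
      show "restrict (\<lambda>t. face_embedding {..k} id t) (standard_simplex k) x = \<tau> x"
        unfolding \<tau>_def singular_face_fundamental[OF order_refl]
        by (auto simp: restrict_def face_embedding_def simplical_face_def fun_eq_iff standard_simplex_def)
    qed
    then show ?thesis
      using S.cell_homology_cell[of id k, OF bij_betw_id IH] unfolding \<Lambda>_def by (simp only:)
  qed
  \<comment> \<open>The vertex opposite the last facet lies on every other facet, so the horn is
    star-shaped about it.\<close>
  let ?v = "\<lambda>j. if j = ?n then 1 else 0 :: real"
  have v: "?v \<in> \<Lambda>" unfolding \<Lambda>_iff by (auto intro: exI[of _ 0])
  have v_simplex: "?v \<in> standard_simplex ?n" by (simp only: basis_in_standard_simplex)
  have contr_\<Lambda>: "contractible_space (subtopology ?Y \<Lambda>)"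
  proof -
    have "contractible_space (subtopology (powertop_real UNIV) \<Lambda>)"
    proof (rule contractible_space_starlike[OF v])
      fix x and u :: real assume x: "x \<in> \<Lambda>" and u: "0 \<le> u" "u \<le> 1"
      have "x \<in> standard_simplex ?n" using x unfolding \<Lambda>_iff by (rule conjunct1)
      then have y: "(\<lambda>i. (1 - u) * x i + u * ?v i) \<in> standard_simplex ?n"
        using v_simplex u by (rule convex_standard_simplex)
      obtain i where i: "i \<le> k" "x i = 0" using x unfolding \<Lambda>_iff by (elim conjE exE)
      then have "(1 - u) * x i + u * ?v i = 0" by simp
      with y i(1) show "(\<lambda>i. (1 - u) * x i + u * ?v i) \<in> \<Lambda>"
        unfolding \<Lambda>_iff by (intro conjI exI[of _ i])
    qed
    moreover have "subtopology ?Y \<Lambda> = subtopology (powertop_real UNIV) \<Lambda>"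
      using \<Lambda>L Ls by (simp add: subtopology_subtopology Int_absorb1)
    ultimately show ?thesis by simp
  qed
  have contr_Y: "contractible_space ?Y"
    by (rule contractible_space_starlike[OF v_simplex convex_standard_simplex[OF _ v_simplex]])
  have mono_L: "singular_chain p ?Y c" if "singular_chain p (subtopology ?Y ?L) c" for p c
    using that by (simp add: singular_chain_subtopology)
  have mono_\<Lambda>: "singular_chain p (subtopology ?Y ?L) c" if "singular_chain p (subtopology ?Y \<Lambda>) c" for p c
    using singular_chain_mono[OF that \<Lambda>L] .
  have sub: "subtopology (subtopology ?Y ?L) \<Lambda> = subtopology ?Y \<Lambda>"
    using subtopology_subtopology[of ?Y ?L \<Lambda>] Int_absorb1[OF \<Lambda>L] by (simp only:)
  have \<iota>: "singular_relcycle ?n ?Y ?L (frag_of ?\<iota>)" by (rule relcycle_fundamental)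
  have bd_relcycle: "singular_relcycle p (subtopology ?Y ?L) \<Lambda> (chain_boundary (Suc p) c)"
    if "singular_relcycle (Suc p) ?Y ?L c" for p c
    using that chain_boundary_boundary_alt[of p ?Y c] by (simp add: singular_relcycle)
  \<comment> \<open>All faces of the fundamental simplex but the last one lie in the horn. So modulo
    the horn its boundary is the last face up to sign, which carries generator to generator.\<close>
  have horn: "\<exists>e. singular_chain k (subtopology ?Y \<Lambda>) e \<and>
      chain_boundary ?n (frag_of ?\<iota>) = frag_cmul ((-1) ^ ?n) (frag_of \<tau>) + e"
  proof (intro exI conjI)
    let ?e = "\<Sum>j\<le>k. frag_cmul ((-1) ^ j) (frag_of (singular_face ?n j ?\<iota>))"
    have "singular_simplex k (subtopology ?Y \<Lambda>) (singular_face ?n j ?\<iota>)" if j: "j \<le> k" for j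
    proof -
      have "singular_simplex (?n - Suc 0) ?Y (singular_face ?n j ?\<iota>)"
        using j by (intro singular_simplex_singular_face[OF singular_simplex_fundamental]) auto
      moreover have "singular_face ?n j ?\<iota> ` standard_simplex k \<subseteq> \<Lambda>"
      proof
        fix y assume "y \<in> singular_face ?n j ?\<iota> ` standard_simplex k"
        then obtain x where x: "x \<in> standard_simplex k" "y = simplical_face j x"
          using singular_face_fundamental[of j k] j by auto
        then have "y \<in> standard_simplex ?n"
          using simplical_face_in_standard_simplex[of ?n j x] j by simp
        moreover have "y j = 0" using x by (simp add: simplical_face_def)
        ultimately show "y \<in> \<Lambda>" using j by (auto simp: \<Lambda>_iff)
      qed
      ultimately show ?thesis by (simp add: singular_simplex_subtopology)
    qed
    then show "singular_chain k (subtopology ?Y \<Lambda>) ?e"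
      by (intro singular_chain_sum singular_chain_cmul) (simp add: singular_chain_of)
    have "chain_boundary ?n (frag_of ?\<iota>) = (\<Sum>j\<le>Suc k. frag_cmul ((-1) ^ j) (frag_of (singular_face ?n j ?\<iota>)))"
      by (simp only: chain_boundary_of) simp
    also have "\<dots> = frag_cmul ((-1) ^ ?n) (frag_of \<tau>) + ?e"
      unfolding \<tau>_def by (subst sum.atMost_Suc) (rule add.commute)
    finally show "chain_boundary ?n (frag_of ?\<iota>) = frag_cmul ((-1) ^ ?n) (frag_of \<tau>) + ?e" .
  qed
  show ?thesis
    unfolding cell_homology_def
  proof (intro conjI allI impI)
    show "singular_relcycle ?n ?Y ?L (frag_of ?\<iota>)" by (rule \<iota>)
  next
    fix p c assume p: "?n < p" and c: "singular_relcycle p ?Y ?L c"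
    obtain p' where p': "p = Suc p'" "k < p'" "0 < p'" using p by (cases p) auto
    have cY: "singular_chain p ?Y c" using c by (simp add: singular_relcycle)
    \<comment> \<open>The boundary of \<open>c\<close> bounds up to an error \<open>e\<close> in the
      horn. The error is a cycle there, so \<open>g\<close> fills it; then \<open>c - d - g\<close>
      is an absolute cycle of the contractible simplex.\<close>
    have "singular_relboundary p' (subtopology ?Y ?L) \<Lambda> (chain_boundary p c)"
      using \<tau> bd_relcycle c p' by (simp add: cell_homology_def)
    then obtain d e where d: "singular_chain p (subtopology ?Y ?L) d" and
      e: "singular_chain p' (subtopology ?Y \<Lambda>) e" and eq: "chain_boundary p d + e = chain_boundary p c"
      unfolding singular_relboundary sub p' by blast
    have "e = chain_boundary p (c - d)" using eq by (simp add: chain_boundary_diff algebra_simps)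
    moreover have "singular_chain p ?Y (c - d)" using cY mono_L[OF d] by (rule singular_chain_diff)
    ultimately have "chain_boundary p' e = 0"
      using chain_boundary_boundary_alt[of p' ?Y "c - d"] p' by simp
    then obtain g where g: "singular_chain p (subtopology ?Y \<Lambda>) g" "chain_boundary p g = e"
      using boundary_of_cycle_in_contractible[OF contr_\<Lambda> p'(3) e] p' by metis
    have "singular_chain p ?Y (c - d - g)"
      using cY mono_L[OF d] mono_L[OF mono_\<Lambda>[OF g(1)]] by (intro singular_chain_diff)
    moreover have "chain_boundary p (c - d - g) = 0"
      unfolding chain_boundary_diff g(2) eq[symmetric] by simp
    ultimately obtain h where h: "singular_chain (Suc p) ?Y h" "chain_boundary (Suc p) h = c - d - g"
      using boundary_of_cycle_in_contractible[OF contr_Y, of p "c - d - g"] p by auto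
    have "singular_chain p (subtopology ?Y ?L) (d + g)"
      using d mono_\<Lambda>[OF g(1)] by (rule singular_chain_add)
    moreover have "chain_boundary (Suc p) h + (d + g) = c" using h by simp
    ultimately show "singular_relboundary p ?Y ?L c"
      unfolding singular_relboundary using h(1) by blast
  next
    fix c assume c: "singular_relcycle ?n ?Y ?L c"
    have cY: "singular_chain ?n ?Y c" using c by (simp add: singular_relcycle)
    obtain a where "homologous_rel k (subtopology ?Y ?L) \<Lambda> (chain_boundary ?n c) (frag_cmul a (frag_of \<tau>))"
      using \<tau> bd_relcycle[OF c] by (auto simp: cell_homology_def)
    then obtain d e where d: "singular_chain ?n (subtopology ?Y ?L) d" and
      e: "singular_chain k (subtopology ?Y \<Lambda>) e" and
      eq: "chain_boundary ?n d + e = chain_boundary ?n c - frag_cmul a (frag_of \<tau>)"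
      unfolding homologous_rel_def singular_relboundary sub by blast
    obtain e0 where e0: "singular_chain k (subtopology ?Y \<Lambda>) e0"
      "chain_boundary ?n (frag_of ?\<iota>) = frag_cmul ((-1) ^ ?n) (frag_of \<tau>) + e0"
      using horn by blast
    \<comment> \<open>The last face occurs with sign \<open>(-1) ^ ?n\<close>, which is its own
      inverse; so \<open>b\<close> times the fundamental simplex has the wanted multiple
      \<open>a\<close> of \<open>\<tau>\<close> in its boundary.\<close>
    define b :: int where "b = (-1) ^ ?n * a"
    have ba: "b * (-1) ^ ?n = a" unfolding b_def by (simp add: mult.commute mult.left_commute power_add[symmetric] flip: power_mult_distrib)
    define e' where "e' = e - frag_cmul b e0"
    let ?w = "c - frag_cmul b (frag_of ?\<iota>) - d"
    have e': "singular_chain k (subtopology ?Y \<Lambda>) e'"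
      unfolding e'_def using e e0(1) by (intro singular_chain_diff singular_chain_cmul)
    have wY: "singular_chain ?n ?Y ?w"
      using cY mono_L[OF d] \<iota> by (intro singular_chain_diff singular_chain_cmul) (auto simp: singular_relcycle)
    have bw: "chain_boundary ?n ?w = e'"
    proof -
      have "chain_boundary ?n ?w = chain_boundary ?n c - frag_cmul b (chain_boundary ?n (frag_of ?\<iota>)) - chain_boundary ?n d"
        by (simp only: chain_boundary_diff chain_boundary_cmul)
      also have "frag_cmul b (chain_boundary ?n (frag_of ?\<iota>)) = frag_cmul a (frag_of \<tau>) + frag_cmul b e0"
        unfolding e0(2) frag_cmul_distrib2 frag_cmul_cmul ba ..
      also have "chain_boundary ?n c = chain_boundary ?n d + e + frag_cmul a (frag_of \<tau>)"
        using eq by (simp add: algebra_simps)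
      finally have F: "chain_boundary ?n ?w = chain_boundary ?n d + e + frag_cmul a (frag_of \<tau>)
          - (frag_cmul a (frag_of \<tau>) + frag_cmul b e0) - chain_boundary ?n d" .
      show ?thesis unfolding F e'_def by (simp add: algebra_simps)
    qed
    \<comment> \<open>For \<open>k = 0\<close> the error \<open>e'\<close> has degree zero, where
      contractibility does not yield a filling. But then the horn is a single point and the error is
      the boundary of a 1-chain, hence zero.\<close>
    have "\<exists>g. singular_chain ?n (subtopology ?Y \<Lambda>) g \<and> chain_boundary ?n g = e'"
    proof (cases "k = 0")
      case True
      have "\<Lambda> \<subseteq> {?v}"
      proof
        fix t assume t: "t \<in> \<Lambda>"
        then have t0: "t 0 = 0" and "t \<in> standard_simplex 1" using True by (auto simp: \<Lambda>_iff)
        then have "t 1 = 1" "\<forall>i>1. t i = 0" by (auto simp: standard_simplex_def)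
        then have "t = ?v" using t0 True
          by (auto simp: fun_eq_iff) (metis One_nat_def Suc_lessI neq0_conv)
        then show "t \<in> {?v}" by simp
      qed
      then have "\<Lambda> = {?v}" using v by blast
      moreover have "?v \<in> topspace ?Y" using v by (simp add: \<Lambda>_iff)
      ultimately have "chain_boundary 1 ?w = 0"
        using zero_boundary_in_singleton[of ?Y ?w ?v] wY e' bw True by simp
      then show ?thesis using bw True by (intro exI[of _ 0]) simp
    next
      case False
      have "chain_boundary k e' = 0"
        using chain_boundary_boundary_alt[OF wY] bw by simp
      then show ?thesis
        using boundary_of_cycle_in_contractible[OF contr_\<Lambda> _ e'] False by blast
    qed
    then obtain g where g: "singular_chain ?n (subtopology ?Y \<Lambda>) g" "chain_boundary ?n g = e'" by blast
    have "singular_chain ?n ?Y (?w - g)"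
      using wY mono_L[OF mono_\<Lambda>[OF g(1)]] by (rule singular_chain_diff)
    moreover have "chain_boundary ?n (?w - g) = 0"
      using bw g(2) by (simp add: chain_boundary_diff)
    ultimately obtain h where h: "singular_chain (Suc ?n) ?Y h" "chain_boundary (Suc ?n) h = ?w - g"
      using boundary_of_cycle_in_contractible[OF contr_Y, of ?n "?w - g"] by blast
    have "singular_chain ?n (subtopology ?Y ?L) (d + g)"
      using d mono_\<Lambda>[OF g(1)] by (rule singular_chain_add)
    moreover have "chain_boundary (Suc ?n) h + (d + g) = c - frag_cmul b (frag_of ?\<iota>)"
      using h(2) by (simp add: algebra_simps)
    ultimately show "\<exists>a. homologous_rel ?n ?Y ?L c (frag_cmul a (frag_of ?\<iota>))"
      unfolding homologous_rel_def singular_relboundary using h(1) by blast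
  next
    fix a assume "singular_relboundary ?n ?Y ?L (frag_cmul a (frag_of ?\<iota>))"
    then obtain d f where d: "singular_chain (Suc ?n) ?Y d" and f: "singular_chain ?n (subtopology ?Y ?L) f"
      and eq: "chain_boundary (Suc ?n) d + f = frag_cmul a (frag_of ?\<iota>)"
      unfolding singular_relboundary by blast
    obtain e0 where e0: "singular_chain k (subtopology ?Y \<Lambda>) e0"
      "chain_boundary ?n (frag_of ?\<iota>) = frag_cmul ((-1) ^ ?n) (frag_of \<tau>) + e0"
      using horn by blast
    \<comment> \<open>Taking boundaries turns the relation into one for \<open>a\<close> times the
      last face, up to sign, where the induction hypothesis applies.\<close>
    have "chain_boundary ?n (chain_boundary (Suc ?n) d + f) = chain_boundary ?n f"
      using chain_boundary_boundary_alt[OF d] by (simp only: chain_boundary_add) simp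
    then have "chain_boundary ?n f = frag_cmul (a * (-1) ^ ?n) (frag_of \<tau>) + frag_cmul a e0"
      unfolding eq chain_boundary_cmul e0(2) frag_cmul_distrib2 frag_cmul_cmul by simp
    then have "chain_boundary ?n f + frag_cmul (- a) e0 = frag_cmul (a * (-1) ^ ?n) (frag_of \<tau>)"
      by (simp add: minus_frag_cmul[symmetric] del: minus_frag_cmul)
    moreover have "singular_chain k (subtopology ?Y \<Lambda>) (frag_cmul (- a) e0)"
      using e0(1) by (rule singular_chain_cmul)
    ultimately have "singular_relboundary k (subtopology ?Y ?L) \<Lambda> (frag_cmul (a * (-1) ^ ?n) (frag_of \<tau>))"
      unfolding singular_relboundary sub using f by blast
    then have "a * (-1) ^ ?n = 0" using \<tau> unfolding cell_homology_def by blast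
    then show "a = 0" by simp
  qed
qed

lemma cell_homology_simplex:
  "cell_homology k (simplex_space k) (simplex_boundary k) (fundamental_simplex k)"
  by (induction k) (rule cell_homology_simplex_0, rule cell_homology_simplex_Suc)

section \<open>Vanishing of homology above the dimension of a subcomplex\<close>

context simplex_gluing
begin

text \<open>Cells are recorded by their barycenters as points of \<open>X\<close>, so cells that are
  glued together count once.\<close>

definition cells :: "'a set \<Rightarrow> 'a set" where
  "cells A = {q i (barycenter C) | i C. i \<in> I \<and> C \<noteq> {} \<and> C \<subseteq> {..n} \<and> q i (barycenter C) \<in> A}"

lemma cells_subset: "cells A \<subseteq> A"
  by (auto simp: cells_def)

lemma cells_mono: "A \<subseteq> B \<Longrightarrow> cells A \<subseteq> cells B"
  unfolding cells_def
  by (intro Collect_mono impI) (elim exE conjE, intro exI conjI, assumption+, erule (1) subsetD)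

lemma finite_cells: "finite (cells A)"
  by (rule finite_subset[of _ "(\<lambda>(i, C). q i (barycenter C)) ` (I \<times> Pow {..n})"])
    (auto simp: cells_def finite_I)

lemma barycenter_in_subcomplex:
  assumes "subcomplex A" "i \<in> I" "t \<in> standard_simplex n" "q i t \<in> A"
  shows "q i (barycenter (support t)) \<in> A"
proof -
  have C: "support t \<noteq> {}" "support t \<subseteq> {..n}"
    using support_nonempty support_simplex assms(3) by blast+
  then have "support (barycenter (support t)) = support t"
    using support_barycenter finite_subset[OF C(2)] by blast
  then show ?thesis
    using subcomplexD[OF assms(1,4,2,3) barycenter_in_simplex[OF C]] by blast
qed

text \<open>Induction on the number of cells. A cell with the most vertices is maximal, and its
  dimension \<open>card C - 1\<close> is below \<open>p\<close>; so relative to the rest the cycle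
  bounds, and it may be moved into the smaller subcomplex.\<close>

lemma cycle_is_boundary_low_dimension:
  assumes "subcomplex A"
    and "\<And>i C. \<lbrakk>i \<in> I; C \<noteq> {}; C \<subseteq> {..n}; q i (barycenter C) \<in> A\<rbrakk> \<Longrightarrow> card C \<le> p"
    and "singular_relcycle p (subtopology X A) {} c"
  shows "singular_relboundary p (subtopology X A) {} c"
  using assms
proof (induction "card (cells A)" arbitrary: A c rule: less_induct)
  case less
  have AX: "A \<subseteq> topspace X" using less.prems(1) by (simp add: subcomplex_def)
  let ?P = "\<lambda>(i, C). i \<in> I \<and> C \<noteq> {} \<and> C \<subseteq> {..n} \<and> q i (barycenter C) \<in> A"
  show ?case
  proof (cases "\<exists>z. ?P z")
    case False
    have "A = {}"
    proof (rule ccontr)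
      assume "A \<noteq> {}"
      then obtain x where "x \<in> A" by blast
      then obtain i t where "i \<in> I" "t \<in> standard_simplex n" "q i t \<in> A"
        using AX unfolding topspace_gluing by blast
      then have "?P (i, support t)"
        using barycenter_in_subcomplex[OF less.prems(1)] support_nonempty support_simplex by simp
      then show False using False by blast
    qed
    then have "c = 0"
      using less.prems(3) by (simp add: singular_relcycle singular_chain_empty)
    then show ?thesis by simp
  next
    case True
    then obtain z0 where z0: "?P z0" ..
    have "\<forall>z. ?P z \<longrightarrow> card (snd z) < Suc p" using less.prems(2) by (auto simp: less_Suc_eq_le)
    from ex_has_greatest_nat[of ?P, OF z0 this]
    obtain z where z: "?P z" "\<forall>y. ?P y \<longrightarrow> card (snd y) \<le> card (snd z)" by (elim exE conjE)
    obtain i0 C where iC: "z = (i0, C)" by (cases z)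
    have i0: "i0 \<in> I" and C: "C \<noteq> {}" "C \<subseteq> {..n}" and bA: "q i0 (barycenter C) \<in> A"
      using z(1) unfolding iC by simp_all
    have max: "card D \<le> card C" if "j \<in> I" "D \<noteq> {}" "D \<subseteq> {..n}" "q j (barycenter D) \<in> A" for j D
      using z(2)[THEN spec, of "(j, D)"] that unfolding iC by simp
    interpret cell: simplex_gluing_cell n X I R q A i0 C
    proof
      show "support t = C"
        if "j \<in> I" "R C j i0" "t \<in> standard_simplex n" "q j t \<in> A" "C \<subseteq> support t" for j t
      proof -
        have "card (support t) \<le> card C"
          by (rule max[OF that(1) support_nonempty[OF that(3)] support_simplex[OF that(3)]
                barycenter_in_subcomplex[OF less.prems(1) that(1,3,4)]])
        moreover have "finite (support t)"
          using support_simplex[OF that(3)] finite_subset by blast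
        ultimately show ?thesis using card_seteq[OF _ that(5)] by blast
      qed
    qed (fact less.prems(1) i0 C bA)+
    define k where "k = card C - 1"
    have cC: "card C = card {..k}" using cell.card_C by (simp add: k_def)
    obtain e where e: "bij_betw e C {..k}"
      using finite_same_card_bij[OF cell.finite_C _ cC] by blast
    have "card C \<le> p" using less.prems(2) i0 C bA by blast
    then have kp: "k < p" using cell.card_C by (simp add: k_def)
    have cA: "singular_chain p (subtopology X A) c" and bc: "chain_boundary p c = 0"
      using less.prems(3) by (auto simp: singular_cycle)
    have "singular_relcycle p (subtopology X A) (A - cell.cell) c"
      using cA bc by (simp add: singular_relcycle)
    then have "singular_relboundary p (subtopology X A) (A - cell.cell) c"
      using cell.cell_homology_cell[OF e cell_homology_simplex] kp by (simp add: cell_homology_def)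
    moreover have "A \<inter> (A - cell.cell) = A - cell.cell" by blast
    ultimately obtain d f where d: "singular_chain (Suc p) (subtopology X A) d"
      and f: "singular_chain p (subtopology X (A - cell.cell)) f" and eq: "chain_boundary (Suc p) d + f = c"
      unfolding singular_relboundary subtopology_subtopology by metis
    have "chain_boundary p (chain_boundary (Suc p) d + f) = chain_boundary p f"
      using chain_boundary_boundary_alt[OF d] by (simp only: chain_boundary_add) simp
    then have "chain_boundary p f = 0" using eq bc by simp
    then have cyc: "singular_relcycle p (subtopology X (A - cell.cell)) {} f"
      using f by (simp add: singular_cycle)
    have "singular_relboundary p (subtopology X (A - cell.cell)) {} f"
    proof (rule less.hyps)
      have "q i0 (barycenter C) \<in> cell.cell"
        using cell.bary_simplex support_barycenter[OF cell.finite_C C(1)] unfolding cell.cell_def by blast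
      then have "q i0 (barycenter C) \<notin> cells (A - cell.cell)"
        using cells_subset[of "A - cell.cell"] by (meson DiffD2 subsetD)
      moreover have "q i0 (barycenter C) \<in> cells A"
        unfolding cells_def mem_Collect_eq using i0 C bA by (intro exI conjI) (rule refl)
      moreover have "cells (A - cell.cell) \<subseteq> cells A" by (rule cells_mono) (rule Diff_subset)
      ultimately show "card (cells (A - cell.cell)) < card (cells A)"
        by (intro psubset_card_mono finite_cells) blast
      show "card D \<le> p" if "i \<in> I" "D \<noteq> {}" "D \<subseteq> {..n}" "q i (barycenter D) \<in> A - cell.cell" for i D
        using less.prems(2) that by blast
    qed (fact cell.subcomplex_diff_cell cyc)+
    then obtain g where g: "singular_chain (Suc p) (subtopology X (A - cell.cell)) g" "chain_boundary (Suc p) g = f"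
      unfolding singular_boundary by blast
    have "singular_chain (Suc p) (subtopology X A) g"
      using singular_chain_mono[OF g(1)] by blast
    then have "singular_chain (Suc p) (subtopology X A) (d + g)"
      using d by (intro singular_chain_add)
    moreover have "chain_boundary (Suc p) (d + g) = c"
      using eq g(2) by (simp add: chain_boundary_add)
    ultimately show ?thesis unfolding singular_boundary by blast
  qed
qed

end

section \<open>Top-dimensional homology of a gluing\<close>

locale simplex_gluing_top = simplex_gluing +
  assumes n_pos: "0 < n" and R_top: "i \<in> I \<Longrightarrow> j \<in> I \<Longrightarrow> R {..n} i j \<Longrightarrow> i = j"
begin

definition skeleton where
  "skeleton = {q i t | i t. i \<in> I \<and> t \<in> standard_simplex n \<and> support t \<noteq> {..n}}"

definition top_cell where
  "top_cell i = {q i t | t. t \<in> standard_simplex n \<and> support t = {..n}}"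

text \<open>A filtration from the skeleton to \<open>X\<close> that admits top cells one at a time,
  in any order.\<close>

definition partial_complex where "partial_complex S = skeleton \<union> (\<Union>i\<in>S. top_cell i)"

definition top_simplex where "top_simplex i = restrict (q i) (standard_simplex n)"

lemma q_in_skeleton:
  assumes "i \<in> I" "t \<in> standard_simplex n"
  shows "q i t \<in> skeleton \<longleftrightarrow> support t \<noteq> {..n}"
proof
  assume "q i t \<in> skeleton"
  then obtain j u where "j \<in> I" "u \<in> standard_simplex n" "support u \<noteq> {..n}" "q i t = q j u"
    unfolding skeleton_def by blast
  then show "support t \<noteq> {..n}" using q_eq[of i j t u] assms by blast
next
  assume "support t \<noteq> {..n}"
  then show "q i t \<in> skeleton" unfolding skeleton_def using assms by blast
qed

lemma q_in_top_cell:
  assumes "i \<in> I" "j \<in> I" "t \<in> standard_simplex n"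
  shows "q i t \<in> top_cell j \<longleftrightarrow> i = j \<and> support t = {..n}"
proof
  assume "q i t \<in> top_cell j"
  then obtain u where "u \<in> standard_simplex n" "support u = {..n}" "q i t = q j u"
    unfolding top_cell_def by blast
  then show "i = j \<and> support t = {..n}" using q_eq[of i j t u] assms R_top by metis
next
  assume "i = j \<and> support t = {..n}"
  then show "q i t \<in> top_cell j" unfolding top_cell_def using assms by blast
qed

lemma q_in_partial_complex:
  assumes "i \<in> I" "S \<subseteq> I" "t \<in> standard_simplex n"
  shows "q i t \<in> partial_complex S \<longleftrightarrow> i \<in> S \<or> support t \<noteq> {..n}"
  using q_in_skeleton[OF assms(1,3)] q_in_top_cell[OF assms(1) _ assms(3)] assms(2)
  unfolding partial_complex_def by blast

lemma skeleton_subset: "skeleton \<subseteq> partial_complex S"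
  by (simp add: partial_complex_def)

lemma partial_complex_empty: "partial_complex {} = skeleton"
  by (simp add: partial_complex_def)

lemma partial_complex_subset: "S \<subseteq> I \<Longrightarrow> partial_complex S \<subseteq> topspace X"
  unfolding partial_complex_def skeleton_def top_cell_def topspace_gluing by blast

lemma partial_complex_I: "partial_complex I = topspace X"
proof
  show "topspace X \<subseteq> partial_complex I"
    using q_in_partial_complex[OF _ order_refl] unfolding topspace_gluing by blast
qed (rule partial_complex_subset[OF order_refl])

lemma subcomplex_partial_complex:
  assumes S: "S \<subseteq> I"
  shows "subcomplex (partial_complex S)"
  unfolding subcomplex_def
proof (intro conjI ballI impI)
  show "partial_complex S \<subseteq> topspace X" by (rule partial_complex_subset[OF S])
  fix i t u assume i: "i \<in> I" and t: "t \<in> standard_simplex n" and u: "u \<in> standard_simplex n"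
    and q: "q i t \<in> partial_complex S" and s: "support u \<subseteq> support t"
  have "i \<in> S \<or> support t \<noteq> {..n}" using q q_in_partial_complex[OF i S t] by blast
  then have "i \<in> S \<or> support u \<noteq> {..n}" using s support_simplex[OF t] by blast
  then show "q i u \<in> partial_complex S" using q_in_partial_complex[OF i S u] by blast
qed

lemma cell_homology_top:
  assumes S: "S \<subseteq> I" and i: "i \<in> S"
  shows "cell_homology n (subtopology X (partial_complex S)) (partial_complex (S - {i})) (top_simplex i)"
proof -
  have iI: "i \<in> I" using S i by blast
  have full: "{..n} \<noteq> {}" "{..n} \<subseteq> {..n}" by auto
  interpret cell: simplex_gluing_cell n X I R q "partial_complex S" i "{..n}"
  proof
    show "q i (barycenter {..n}) \<in> partial_complex S"
      using q_in_partial_complex[OF iI S barycenter_in_simplex[OF full]] i by blast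
    show "support t = {..n}" if "t \<in> standard_simplex n" "{..n} \<subseteq> support t" for t
      using that support_simplex by blast
  qed (fact subcomplex_partial_complex[OF S] iI full)+
  have cell: "cell.cell = top_cell i" unfolding cell.cell_def top_cell_def ..
  have "partial_complex S - cell.cell = partial_complex (S - {i})"
  proof (intro equalityI subsetI)
    fix x assume x: "x \<in> partial_complex S - cell.cell"
    then obtain j t where jt: "j \<in> I" "t \<in> standard_simplex n" "x = q j t"
      using partial_complex_subset[OF S] unfolding topspace_gluing by blast
    then show "x \<in> partial_complex (S - {i})"
      using x q_in_partial_complex[OF jt(1) S jt(2)] q_in_partial_complex[OF jt(1) _ jt(2), of "S - {i}"]
        q_in_top_cell[OF jt(1) iI jt(2)] S unfolding cell by blast
  next
    fix x assume x: "x \<in> partial_complex (S - {i})"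
    then obtain j t where jt: "j \<in> I" "t \<in> standard_simplex n" "x = q j t"
      using partial_complex_subset[of "S - {i}"] S unfolding topspace_gluing by blast
    then show "x \<in> partial_complex S - cell.cell"
      using x q_in_partial_complex[OF jt(1) S jt(2)] q_in_partial_complex[OF jt(1) _ jt(2), of "S - {i}"]
        q_in_top_cell[OF jt(1) iI jt(2)] S unfolding cell by blast
  qed
  moreover have "restrict (\<lambda>t. q i (face_embedding {..n} id t)) (standard_simplex n) = top_simplex i"
  proof
    fix t
    have "face_embedding {..n} id t = t" if "t \<in> standard_simplex n"
      using that by (auto simp: face_embedding_def standard_simplex_def fun_eq_iff)
    then show "restrict (\<lambda>t. q i (face_embedding {..n} id t)) (standard_simplex n) t = top_simplex i t"
      by (simp add: top_simplex_def)
  qed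
  ultimately show ?thesis
    using cell.cell_homology_cell[OF bij_betw_id cell_homology_simplex] by (simp only:)
qed

lemma singular_simplex_top: "i \<in> I \<Longrightarrow> singular_simplex n X (top_simplex i)"
  unfolding singular_simplex_def top_simplex_def
  by (auto intro: continuous_map_eq[OF continuous_map_q])

lemma singular_face_top:
  assumes "j \<le> n"
  shows "singular_face n j (top_simplex i) = restrict (\<lambda>t. q i (simplical_face j t)) (standard_simplex (n - Suc 0))"
proof
  fix t
  show "singular_face n j (top_simplex i) t = restrict (\<lambda>t. q i (simplical_face j t)) (standard_simplex (n - Suc 0)) t"
    using simplical_face_in_standard_simplex[of n j t] assms n_pos
    by (simp add: singular_face_def top_simplex_def)
qed

lemma face_point:
  assumes "j \<le> n" "t \<in> standard_simplex (n - Suc 0)"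
  shows "simplical_face j t \<in> standard_simplex n" "support (simplical_face j t) \<subseteq> {..n} - {j}"
proof -
  show s: "simplical_face j t \<in> standard_simplex n"
    using simplical_face_in_standard_simplex[of n j t] assms n_pos by simp
  have "simplical_face j t j = 0" by (simp add: simplical_face_def)
  then have "j \<notin> support (simplical_face j t)" by (simp add: support_def)
  then show "support (simplical_face j t) \<subseteq> {..n} - {j}" using support_simplex[OF s] by blast
qed

lemma singular_face_in_skeleton:
  assumes "i \<in> I" "j \<le> n"
  shows "singular_simplex (n - Suc 0) (subtopology X skeleton) (singular_face n j (top_simplex i))"
proof -
  have "singular_simplex (n - Suc 0) X (singular_face n j (top_simplex i))"
    using assms n_pos by (intro singular_simplex_singular_face[OF singular_simplex_top]) auto
  moreover have "singular_face n j (top_simplex i) t \<in> skeleton" if "t \<in> standard_simplex (n - Suc 0)" for t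
  proof -
    have "support (simplical_face j t) \<noteq> {..n}" using face_point[OF assms(2) that] assms(2) by blast
    then show ?thesis
      using q_in_skeleton[OF assms(1) face_point(1)[OF assms(2) that]] that
      by (simp add: singular_face_top[OF assms(2)])
  qed
  ultimately show ?thesis by (auto simp: singular_simplex_subtopology)
qed

lemma top_relcycle: "i \<in> I \<Longrightarrow> singular_chain (n - Suc 0) (subtopology X skeleton) (chain_boundary n (frag_of (top_simplex i)))"
  using n_pos unfolding chain_boundary_of
  by (auto intro!: singular_chain_sum singular_chain_cmul simp: singular_chain_of singular_face_in_skeleton)

definition top_chain where "top_chain S a = (\<Sum>i\<in>S. frag_cmul (a i) (frag_of (top_simplex i)))"

text \<open>Induction over the top cells: relative to the complex without cell \<open>i\<close>, the
  chain is a multiple \<open>b\<close> of that cell, and what remains is a relative cycle of the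
  smaller complex.\<close>

lemma relcycle_homologous_top_chain:
  assumes "S \<subseteq> I" "singular_relcycle n (subtopology X (partial_complex S)) skeleton c"
  shows "\<exists>a. homologous_rel n (subtopology X (partial_complex S)) skeleton c (top_chain S a)"
proof -
  have "finite S" using assms(1) finite_I finite_subset by blast
  then show ?thesis using assms
  proof (induction S arbitrary: c rule: finite_induct)
    case empty
    have "singular_chain n (subtopology (subtopology X (partial_complex {})) skeleton) c"
      using empty.prems by (simp add: singular_relcycle partial_complex_empty subtopology_subtopology)
    then show ?case
      by (simp add: homologous_rel_def top_chain_def singular_chain_imp_relboundary)
  next
    case (insert i S)
    let ?A = "partial_complex (insert i S)"
    have S: "S \<subseteq> I" "i \<in> I" using insert.prems by auto
    have Si: "insert i S - {i} = S" using insert.hyps by blast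
    have AA: "partial_complex S \<subseteq> ?A" unfolding partial_complex_def by blast
    have subA: "subtopology (subtopology X ?A) skeleton = subtopology X skeleton"
      "subtopology (subtopology X ?A) (partial_complex S) = subtopology X (partial_complex S)"
      "subtopology (subtopology X (partial_complex S)) skeleton = subtopology X skeleton"
      using skeleton_subset AA by (simp_all add: subtopology_subtopology Int_absorb1)
    have ch: "cell_homology n (subtopology X ?A) (partial_complex S) (top_simplex i)"
      using cell_homology_top[of "insert i S" i] insert.prems(1) Si by simp
    have cA: "singular_chain n (subtopology X ?A) c"
      and bc: "singular_chain (n - 1) (subtopology X skeleton) (chain_boundary n c)"
      using insert.prems(2) subA by (auto simp: singular_relcycle)
    have "singular_relcycle n (subtopology X ?A) (partial_complex S) c"
      using cA singular_chain_mono[OF bc skeleton_subset] subA by (simp add: singular_relcycle)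
    then obtain b where "homologous_rel n (subtopology X ?A) (partial_complex S) c (frag_cmul b (frag_of (top_simplex i)))"
      using ch unfolding cell_homology_def by blast
    then obtain d e where d: "singular_chain (Suc n) (subtopology X ?A) d"
      and e: "singular_chain n (subtopology X (partial_complex S)) e"
      and eq: "chain_boundary (Suc n) d + e = c - frag_cmul b (frag_of (top_simplex i))"
      unfolding homologous_rel_def singular_relboundary subA by blast
    have "chain_boundary n (chain_boundary (Suc n) d + e) = chain_boundary n e"
      using chain_boundary_boundary_alt[OF d] by (simp only: chain_boundary_add) simp
    then have "chain_boundary n e = chain_boundary n c - frag_cmul b (chain_boundary n (frag_of (top_simplex i)))"
      unfolding eq chain_boundary_diff chain_boundary_cmul by simp
    moreover have "singular_chain (n - 1) (subtopology X skeleton)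
        (chain_boundary n c - frag_cmul b (chain_boundary n (frag_of (top_simplex i))))"
      using bc top_relcycle[OF S(2)] by (intro singular_chain_diff singular_chain_cmul) simp_all
    ultimately have "singular_relcycle n (subtopology X (partial_complex S)) skeleton e"
      using e subA by (simp add: singular_relcycle)
    then obtain a where a: "homologous_rel n (subtopology X (partial_complex S)) skeleton e (top_chain S a)"
      using insert.IH[OF S(1)] by blast
    then obtain d' e' where d': "singular_chain (Suc n) (subtopology X (partial_complex S)) d'"
      and e': "singular_chain n (subtopology X skeleton) e'"
      and eq': "chain_boundary (Suc n) d' + e' = e - top_chain S a"
      unfolding homologous_rel_def singular_relboundary subA by blast
    have "top_chain (insert i S) (a(i := b)) = frag_cmul b (frag_of (top_simplex i)) + top_chain S a"
    proof -
      have "top_chain S (a(i := b)) = top_chain S a"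
        unfolding top_chain_def using insert.hyps by (intro sum.cong) auto
      then show ?thesis using insert.hyps by (simp add: top_chain_def)
    qed
    then have "chain_boundary (Suc n) (d + d') + e' = c - top_chain (insert i S) (a(i := b))"
    proof -
      assume *: "top_chain (insert i S) (a(i := b)) = frag_cmul b (frag_of (top_simplex i)) + top_chain S a"
      have "c = chain_boundary (Suc n) d + e + frag_cmul b (frag_of (top_simplex i))"
        using eq by simp
      moreover have "e = chain_boundary (Suc n) d' + e' + top_chain S a" using eq' by simp
      ultimately show ?thesis unfolding * chain_boundary_add by (simp add: algebra_simps)
    qed
    moreover have "singular_chain (Suc n) (subtopology X ?A) (d + d')"
      using d singular_chain_mono[OF d' AA] by (rule singular_chain_add)
    ultimately have "homologous_rel n (subtopology X ?A) skeleton c (top_chain (insert i S) (a(i := b)))"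
      unfolding homologous_rel_def singular_relboundary subA using e' by blast
    then show ?case by blast
  qed
qed

abbreviation face_support :: "nat \<Rightarrow> nat set" where
  "face_support j \<equiv> {..n} - {j}"

lemma face_support_nonempty: "face_support j \<noteq> {}"
proof
  assume "face_support j = {}"
  then have "0 = j" "n = j" by auto
  with n_pos show False by simp
qed

text \<open>The barycenter of the facet has the whole facet as support, so agreement at this one
  point already gives the gluing relation; \<open>R_anti\<close> covers the other points.\<close>

lemma singular_face_top_eq_iff:
  assumes "j \<le> n" "i \<in> I" "i' \<in> I"
  shows "singular_face n j (top_simplex i) = singular_face n j (top_simplex i') \<longleftrightarrow> R (face_support j) i i'"
proof
  assume R: "R (face_support j) i i'"
  show "singular_face n j (top_simplex i) = singular_face n j (top_simplex i')"
    unfolding singular_face_top[OF assms(1)]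
  proof (rule restrict_ext)
    fix t assume t: "t \<in> standard_simplex (n - Suc 0)"
    note f = face_point[OF assms(1) t]
    have "R (support (simplical_face j t)) i i'"
      by (rule R_anti[OF assms(2,3) support_nonempty[OF f(1)] f(2) _ R]) blast
    then show "q i (simplical_face j t) = q i' (simplical_face j t)"
      using q_eq_same[OF assms(2,3) f(1)] by blast
  qed
next
  assume eq: "singular_face n j (top_simplex i) = singular_face n j (top_simplex i')"
  let ?b = "barycenter {..n - Suc 0}"
  have b: "?b \<in> standard_simplex (n - Suc 0)" by (rule barycenter_in_simplex) auto
  have bk: "?b k = 0 \<longleftrightarrow> n \<le> k" for k
    using n_pos by (auto simp: barycenter_def)
  have "support (simplical_face j ?b) = face_support j"
    using assms(1) n_pos by (auto simp: support_def simplical_face_def bk not_le split: if_splits)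
  moreover have "q i (simplical_face j ?b) = q i' (simplical_face j ?b)"
    using fun_cong[OF eq, of ?b] b unfolding singular_face_top[OF assms(1)] by simp
  ultimately show "R (face_support j) i i'"
    using q_eq_same[OF assms(2,3) face_point(1)[OF assms(1) b]] by metis
qed

lemma bij_betw_face_index:
  assumes "j \<le> n"
  shows "bij_betw (\<lambda>i. if i < j then i else i - 1) (face_support j) {..n - Suc 0}"
  using assms n_pos
  by (intro bij_betwI[where g = "\<lambda>i. if i < j then i else Suc i"]) (auto split: if_splits)

definition face_cell where
  "face_cell j i = {q i t | t. t \<in> standard_simplex n \<and> support t = face_support j}"

lemma cell_homology_face:
  assumes j: "j \<le> n" and i: "i \<in> I"
  shows "cell_homology (n - Suc 0) (subtopology X skeleton) (skeleton - face_cell j i) (singular_face n j (top_simplex i))"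
proof -
  let ?C = "face_support j"
  have C: "?C \<noteq> {}" "?C \<subseteq> {..n}" by (rule face_support_nonempty) blast
  have sub: "subcomplex skeleton"
    using subcomplex_partial_complex[of "{}"] by (simp add: partial_complex_empty)
  interpret cell: simplex_gluing_cell n X I R q skeleton i ?C
  proof
    have "barycenter ?C \<in> standard_simplex n" by (rule barycenter_in_simplex[OF C])
    moreover have "support (barycenter ?C) = ?C" using support_barycenter C(1) by simp
    ultimately show "q i (barycenter ?C) \<in> skeleton" using q_in_skeleton[OF i] j by fastforce
    show "support t = ?C"
      if "j' \<in> I" "t \<in> standard_simplex n" "q j' t \<in> skeleton" "?C \<subseteq> support t" for j' t
    proof -
      have "support t \<noteq> {..n}" using q_in_skeleton[OF that(1,2)] that(3) by blast
      then show ?thesis using support_simplex[OF that(2)] that(4) by blast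
    qed
  qed (fact sub i C)+
  have cell: "cell.cell = face_cell j i" unfolding cell.cell_def face_cell_def ..
  let ?e = "\<lambda>i. if i < j then i else i - 1"
  have "restrict (\<lambda>t. q i (face_embedding ?C ?e t)) (standard_simplex (n - Suc 0)) = singular_face n j (top_simplex i)"
    unfolding singular_face_top[OF j]
  proof (rule restrict_ext)
    fix t assume t: "t \<in> standard_simplex (n - Suc 0)"
    have "face_embedding ?C ?e t = simplical_face j t"
    proof
      fix l
      have "t l' = 0" if "n - Suc 0 < l'" for l' using t that by (simp add: standard_simplex_def)
      then show "face_embedding ?C ?e t l = simplical_face j t l"
        using j n_pos by (auto simp: face_embedding_def simplical_face_def)
    qed
    then show "q i (face_embedding ?C ?e t) = q i (simplical_face j t)" by simp
  qed
  then show ?thesis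
    using cell.cell_homology_cell[OF bij_betw_face_index[OF j] cell_homology_simplex] unfolding cell by (simp only:)
qed

lemma other_face_chain:
  assumes "j \<le> n" "l \<le> n" "i \<in> I" "i1 \<in> I" and other: "\<not> (l = j \<and> R (face_support j) i i1)"
  shows "singular_chain (n - Suc 0) (subtopology X (skeleton - face_cell j i1))
    (frag_of (singular_face n l (top_simplex i)))"
proof -
  have "singular_face n l (top_simplex i) t \<notin> face_cell j i1" if t: "t \<in> standard_simplex (n - Suc 0)" for t
  proof
    note f = face_point[OF assms(2) t]
    assume "singular_face n l (top_simplex i) t \<in> face_cell j i1"
    then have "q i (simplical_face l t) \<in> face_cell j i1"
      using t by (simp add: singular_face_top[OF assms(2)])
    then obtain u where u: "u \<in> standard_simplex n" "support u = face_support j" "q i (simplical_face l t) = q i1 u"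
      unfolding face_cell_def mem_Collect_eq by metis
    then have "simplical_face l t = u" "R (face_support j) i i1"
      using q_eq[OF assms(3,4) f(1) u(1)] by metis+
    moreover have "l = j" using f(2) u(2) \<open>simplical_face l t = u\<close> assms(2) by blast
    ultimately show False using other by blast
  qed
  then show ?thesis
    using singular_face_in_skeleton[OF assms(3,2)]
    unfolding singular_chain_of singular_simplex_subtopology by blast
qed

lemma singular_chain_top_chain: "singular_chain n X (top_chain I a)"
  unfolding top_chain_def
  by (intro singular_chain_sum singular_chain_cmul) (simp add: singular_chain_of singular_simplex_top)

lemma chain_boundary_top_chain:
  "chain_boundary n (top_chain I a)
    = (\<Sum>i\<in>I. \<Sum>l\<le>n. frag_cmul (a i * (-1) ^ l) (frag_of (singular_face n l (top_simplex i))))"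
  using n_pos
  by (simp add: top_chain_def chain_boundary_sum chain_boundary_cmul chain_boundary_of frag_cmul_sum comp_def)

text \<open>Relative to the skeleton without one open facet, the boundary of the top chain is that
  facet times the sum of the coefficients around it, up to sign. It also bounds there, and the class
  of the facet has infinite order.\<close>

lemma face_coefficients_zero:
  assumes e: "singular_chain n (subtopology X skeleton) e"
    and eq: "chain_boundary n (top_chain I a) = chain_boundary n e"
    and j: "j \<le> n" and i1: "i1 \<in> I"
  shows "(\<Sum>i\<in>{i \<in> I. R (face_support j) i i1}. a i) = 0"
proof -
  let ?F = "\<lambda>l i. frag_of (singular_face n l (top_simplex i))"
  let ?P = "\<lambda>i. R (face_support j) i i1"
  let ?Y' = "subtopology X (skeleton - face_cell j i1)"
  let ?\<tau> = "?F j i1"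
  define r where "r = (\<Sum>i\<in>I. \<Sum>l\<le>n. if l = j \<and> ?P i then 0 else frag_cmul (a i * (-1) ^ l) (?F l i))"
  have r: "singular_chain (n - Suc 0) ?Y' r"
    unfolding r_def
    by (intro singular_chain_sum) (auto intro!: singular_chain_cmul other_face_chain[OF j _ _ i1])
  have inner: "(\<Sum>l\<le>n. frag_cmul (a i * (-1) ^ l) (?F l i))
      = (\<Sum>l\<le>n. if l = j \<and> ?P i then 0 else frag_cmul (a i * (-1) ^ l) (?F l i))
        + (if ?P i then frag_cmul (a i * (-1) ^ j) ?\<tau> else 0)" if i: "i \<in> I" for i
  proof (cases "?P i")
    case True
    then have "?F j i = ?\<tau>" using singular_face_top_eq_iff[OF j i i1] by simp
    then show ?thesis
      using j True by (simp add: sum.remove[of "{..n}" j] add.commute)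
  qed simp
  have "chain_boundary n (top_chain I a) = r + (\<Sum>i\<in>I. if ?P i then frag_cmul (a i * (-1) ^ j) ?\<tau> else 0)"
    unfolding chain_boundary_top_chain r_def sum.distrib[symmetric] by (rule sum.cong[OF refl inner])
  also have "(\<Sum>i\<in>I. if ?P i then frag_cmul (a i * (-1) ^ j) ?\<tau> else 0)
      = (\<Sum>i\<in>{i \<in> I. ?P i}. frag_cmul (a i * (-1) ^ j) ?\<tau>)"
    by (simp add: sum.inter_filter finite_I)
  also have "\<dots> = frag_cmul ((\<Sum>i\<in>{i \<in> I. ?P i}. a i) * (-1) ^ j) ?\<tau>"
  proof -
    have "(\<Sum>i\<in>S. frag_cmul (a i * (-1) ^ j) ?\<tau>) = frag_cmul ((\<Sum>i\<in>S. a i) * (-1) ^ j) ?\<tau>" if "finite S" for S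
      using that by induction (simp_all add: frag_cmul_distrib distrib_right)
    then show ?thesis using finite_I by simp
  qed
  finally have "chain_boundary n e = r + frag_cmul ((\<Sum>i\<in>{i \<in> I. ?P i}. a i) * (-1) ^ j) ?\<tau>"
    using eq by simp
  then have "chain_boundary (Suc (n - Suc 0)) e + frag_cmul (-1) r
      = frag_cmul ((\<Sum>i\<in>{i \<in> I. ?P i}. a i) * (-1) ^ j) ?\<tau>"
    using n_pos by simp
  moreover have "singular_chain (Suc (n - Suc 0)) (subtopology X skeleton) e" using e n_pos by simp
  moreover have "singular_chain (n - Suc 0) (subtopology (subtopology X skeleton) (skeleton - face_cell j i1)) (frag_cmul (-1) r)"
    using singular_chain_cmul[OF r, of "-1"] by (simp add: subtopology_subtopology Int_absorb1)
  ultimately have "singular_relboundary (n - Suc 0) (subtopology X skeleton) (skeleton - face_cell j i1)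
      (frag_cmul ((\<Sum>i\<in>{i \<in> I. ?P i}. a i) * (-1) ^ j) ?\<tau>)"
    unfolding singular_relboundary by blast
  then have "(\<Sum>i\<in>{i \<in> I. ?P i}. a i) * (-1) ^ j = 0"
    using cell_homology_face[OF j i1] unfolding cell_homology_def by blast
  then show ?thesis by simp
qed

text \<open>The cellular cycles of top degree. No incidence signs occur since gluing preserves the
  numbering of the coordinates: all simplices around facet \<open>j\<close> contain it with the same
  sign \<open>(-1) ^ j\<close>.\<close>

definition balanced where
  "balanced = {a \<in> I \<rightarrow>\<^sub>E (UNIV :: int set). \<forall>j\<le>n. \<forall>i1\<in>I. (\<Sum>i\<in>{i \<in> I. R (face_support j) i i1}. a i) = 0}"

lemma balanced_cycle:
  assumes "a \<in> balanced"
  shows "chain_boundary n (top_chain I a) = 0"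
proof -
  have "(\<Sum>i\<in>I. frag_cmul (a i * (-1) ^ l) (frag_of (singular_face n l (top_simplex i)))) = 0" if l: "l \<le> n" for l
  proof -
    let ?f = "\<lambda>i. singular_face n l (top_simplex i)"
    have "(\<Sum>i\<in>I. frag_cmul (a i * (-1) ^ l) (frag_of (?f i)))
        = (\<Sum>y\<in>?f ` I. \<Sum>i\<in>{i \<in> I. ?f i = y}. frag_cmul (a i * (-1) ^ l) (frag_of (?f i)))"
      by (rule sum.image_gen[OF finite_I])
    also have "\<dots> = 0"
    proof (rule sum.neutral, rule ballI)
      fix y assume "y \<in> ?f ` I"
      then obtain i1 where i1: "i1 \<in> I" "y = ?f i1" by blast
      have S: "{i \<in> I. ?f i = y} = {i \<in> I. R (face_support l) i i1}"
        using singular_face_top_eq_iff[OF l _ i1(1)] i1(2) by blast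
      have "(\<Sum>i\<in>{i \<in> I. ?f i = y}. frag_cmul (a i * (-1) ^ l) (frag_of (?f i)))
          = (\<Sum>i\<in>{i \<in> I. ?f i = y}. frag_cmul (a i * (-1) ^ l) (frag_of y))"
        by (rule sum.cong) auto
      also have "\<dots> = frag_cmul ((\<Sum>i\<in>{i \<in> I. ?f i = y}. a i) * (-1) ^ l) (frag_of y)"
      proof -
        have "(\<Sum>i\<in>S. frag_cmul (a i * (-1) ^ l) (frag_of y)) = frag_cmul ((\<Sum>i\<in>S. a i) * (-1) ^ l) (frag_of y)"
          if "finite S" for S
          using that by induction (simp_all add: frag_cmul_distrib distrib_right)
        then show ?thesis using finite_I by simp
      qed
      also have "\<dots> = 0"
        using assms l i1(1) unfolding S balanced_def by simp
      finally show "(\<Sum>i\<in>{i \<in> I. ?f i = y}. frag_cmul (a i * (-1) ^ l) (frag_of (?f i))) = 0" .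
    qed
    finally show ?thesis .
  qed
  then show ?thesis
    unfolding chain_boundary_top_chain by (subst sum.swap) simp
qed

text \<open>Relative to the complement of the open cell \<open>i\<close>, only the summand of
  \<open>i\<close> survives, and its class has infinite order.\<close>

lemma top_chain_independent:
  assumes "singular_relboundary n X {} (top_chain I a)" and i: "i \<in> I"
  shows "a i = 0"
proof -
  have ch: "cell_homology n (subtopology X (partial_complex I)) (partial_complex (I - {i})) (top_simplex i)"
    by (rule cell_homology_top[OF order_refl i])
  have X: "subtopology X (partial_complex I) = X" by (simp add: partial_complex_I)
  have "singular_chain n (subtopology X (partial_complex (I - {i}))) (\<Sum>j\<in>I - {i}. frag_cmul (a j) (frag_of (top_simplex j)))"
  proof (intro singular_chain_sum singular_chain_cmul)
    fix j assume j: "j \<in> I - {i}"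
    have "top_simplex j t \<in> partial_complex (I - {i})" if "t \<in> standard_simplex n" for t
      using q_in_partial_complex[of j "I - {i}" t] j that by (simp add: top_simplex_def)
    then show "singular_chain n (subtopology X (partial_complex (I - {i}))) (frag_of (top_simplex j))"
      using singular_simplex_top[of j] j unfolding singular_chain_of singular_simplex_subtopology by blast
  qed
  then have rest: "singular_relboundary n X (partial_complex (I - {i})) (\<Sum>j\<in>I - {i}. frag_cmul (a j) (frag_of (top_simplex j)))"
    by (rule singular_chain_imp_relboundary)
  obtain d where "singular_chain (Suc n) X d" "chain_boundary (Suc n) d = top_chain I a"
    using assms(1) unfolding singular_boundary by blast
  then have "singular_relboundary n X (partial_complex (I - {i})) (top_chain I a)"
    unfolding singular_relboundary by (intro exI[of _ d] exI[of _ 0]) simp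
  from singular_relboundary_diff[OF this rest]
  have "singular_relboundary n X (partial_complex (I - {i})) (frag_cmul (a i) (frag_of (top_simplex i)))"
    unfolding top_chain_def using i finite_I by (simp add: sum.remove)
  then show ?thesis using ch unfolding X cell_homology_def by blast
qed

lemma top_chain_add:
  assumes "\<And>i. i \<in> I \<Longrightarrow> c i = a i + b i"
  shows "top_chain I c = top_chain I a + top_chain I b"
  unfolding top_chain_def sum.distrib[symmetric]
  by (rule sum.cong) (simp_all add: assms frag_cmul_distrib)

text \<open>A cycle is a top chain up to a boundary and an error \<open>e\<close> in the skeleton.
  The coefficients must balance, which makes the top chain and therefore \<open>e\<close> a cycle;
  \<open>e\<close> bounds because the skeleton has dimension below \<open>n\<close>.\<close>

lemma cycle_homologous_balanced:
  assumes c: "singular_relcycle n X {} c"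
  obtains a where "a \<in> balanced" "homologous_rel n X {} c (top_chain I a)"
proof -
  have X: "subtopology X (partial_complex I) = X" by (simp add: partial_complex_I)
  have cX: "singular_chain n X c" and bc: "chain_boundary n c = 0"
    using c by (auto simp: singular_cycle)
  have "singular_relcycle n (subtopology X (partial_complex I)) skeleton c"
    using cX bc by (simp add: X singular_relcycle)
  then obtain a where "homologous_rel n X skeleton c (top_chain I a)"
    using relcycle_homologous_top_chain[OF order_refl] unfolding X by blast
  then obtain d e where d: "singular_chain (Suc n) X d" and e: "singular_chain n (subtopology X skeleton) e"
    and eq: "chain_boundary (Suc n) d + e = c - top_chain I a"
    unfolding homologous_rel_def singular_relboundary by blast
  have "chain_boundary n (chain_boundary (Suc n) d + e) = chain_boundary n e"
    using chain_boundary_boundary_alt[OF d] by (simp only: chain_boundary_add) simp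
  then have be: "chain_boundary n e = - chain_boundary n (top_chain I a)"
    unfolding eq chain_boundary_diff bc by simp
  then have "chain_boundary n (top_chain I a) = chain_boundary n (- e)"
    by (simp add: chain_boundary_minus)
  note zero = face_coefficients_zero[OF _ this]
  have e': "singular_chain n (subtopology X skeleton) (- e)" using e by (simp add: singular_chain_minus)
  define a' where "a' = restrict a I"
  have ta: "top_chain I a' = top_chain I a"
    unfolding top_chain_def a'_def by (rule sum.cong) simp_all
  have bal: "a' \<in> balanced"
    using zero[OF e'] unfolding balanced_def a'_def by simp
  have "chain_boundary n e = 0" using be balanced_cycle[OF bal] ta by simp
  then have cyc: "singular_relcycle n (subtopology X skeleton) {} e" using e by (simp add: singular_cycle)
  have "singular_relboundary n (subtopology X skeleton) {} e"
  proof (rule cycle_is_boundary_low_dimension[OF _ _ cyc])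
    show "subcomplex skeleton"
      using subcomplex_partial_complex[of "{}"] by (simp add: partial_complex_empty)
    fix i C assume iC: "i \<in> I" "C \<noteq> {}" "C \<subseteq> {..n}" "q i (barycenter C) \<in> skeleton"
    have "support (barycenter C) = C" using support_barycenter finite_subset[OF iC(3)] iC(2) by simp
    then have "C \<noteq> {..n}" using q_in_skeleton[OF iC(1) barycenter_in_simplex[OF iC(2,3)]] iC(4) by metis
    then have "card C < card {..n}" using iC(3) by (intro psubset_card_mono) auto
    then show "card C \<le> n" by simp
  qed
  then obtain g where g: "singular_chain (Suc n) (subtopology X skeleton) g" "chain_boundary (Suc n) g = e"
    unfolding singular_boundary by blast
  have "singular_chain (Suc n) X (d + g)"
    using d g(1) by (intro singular_chain_add) (simp_all add: singular_chain_subtopology)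
  moreover have "chain_boundary (Suc n) (d + g) = c - top_chain I a'"
    unfolding chain_boundary_add g(2) ta by (rule eq)
  ultimately have "homologous_rel n X {} c (top_chain I a')"
    unfolding homologous_rel_def singular_boundary by blast
  with bal show thesis by (rule that)
qed

text \<open>Balanced functions are extensional, so pointwise sums would have to be restricted again.
  Parametrising them by a group \<open>G\<close> avoids putting a group structure on them.\<close>

theorem top_homology_isomorphic:
  assumes G: "group G" and h: "bij_betw h (carrier G) balanced"
    and h_mult: "\<And>x y i. \<lbrakk>x \<in> carrier G; y \<in> carrier G; i \<in> I\<rbrakk> \<Longrightarrow> h (x \<otimes>\<^bsub>G\<^esub> y) i = h x i + h y i"
  shows "homology_group (int n) X \<cong> G"
proof -
  let ?H = "homology_group (int n) X"
  let ?f = "\<lambda>x. homologous_rel_set n X {} (top_chain I (h x))"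
  have hb: "h x \<in> balanced" if "x \<in> carrier G" for x using h that by (auto simp: bij_betw_def)
  have cyc: "singular_relcycle n X {} (top_chain I (h x))" if "x \<in> carrier G" for x
    using balanced_cycle[OF hb[OF that]] singular_chain_top_chain by (simp add: singular_cycle)
  have "?f \<in> iso G ?H"
    unfolding iso_def mem_Collect_eq
  proof
    show "?f \<in> hom G ?H"
    proof (rule homI)
      show "?f x \<in> carrier ?H" if "x \<in> carrier G" for x
        using cyc[OF that] by (auto simp: carrier_relative_homology_group)
      fix x y assume xy: "x \<in> carrier G" "y \<in> carrier G"
      have t: "top_chain I (h (x \<otimes>\<^bsub>G\<^esub> y)) = top_chain I (h x) + top_chain I (h y)"
        by (rule top_chain_add) (rule h_mult[OF xy])
      show "?f (x \<otimes>\<^bsub>G\<^esub> y) = ?f x \<otimes>\<^bsub>?H\<^esub> ?f y"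
        unfolding t mult_relative_homology_group
      proof (intro equalityI subsetI)
        fix z assume "z \<in> homologous_rel_set n X {} (top_chain I (h x) + top_chain I (h y))"
        then have "homologous_rel n X {} (top_chain I (h x) + top_chain I (h y) - top_chain I (h x)) (z - top_chain I (h x))"
          by (intro homologous_rel_diff) auto
        then have "z - top_chain I (h x) \<in> ?f y" by simp
        then show "z \<in> (\<Union>r\<in>?f x. \<Union>s\<in>?f y. {r + s})"
          by (intro UN_I[of "top_chain I (h x)"] UN_I[of "z - top_chain I (h x)"]) auto
      next
        fix z assume "z \<in> (\<Union>r\<in>?f x. \<Union>s\<in>?f y. {r + s})"
        then show "z \<in> homologous_rel_set n X {} (top_chain I (h x) + top_chain I (h y))"
          by (auto intro: homologous_rel_add)
      qed
    qed
    show "bij_betw ?f (carrier G) (carrier ?H)"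
    proof (rule bij_betw_imageI)
      show "inj_on ?f (carrier G)"
      proof (rule inj_onI)
        fix x y assume xy: "x \<in> carrier G" "y \<in> carrier G" and "?f x = ?f y"
        then have "singular_relboundary n X {} (top_chain I (h x) - top_chain I (h y))"
          unfolding homologous_rel_set_eq unfolding homologous_rel_def by blast
        moreover have "top_chain I (h x) = top_chain I (\<lambda>i. h x i - h y i) + top_chain I (h y)"
          by (rule top_chain_add) simp
        ultimately have "singular_relboundary n X {} (top_chain I (\<lambda>i. h x i - h y i))" by simp
        then have eq: "h x i = h y i" if "i \<in> I" for i
          using top_chain_independent[OF _ that] by fastforce
        have "h x = h y"
        proof (rule extensionalityI[of _ I])
          show "h x \<in> extensional I" "h y \<in> extensional I"
            using hb xy by (auto simp: balanced_def PiE_def)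
        qed (rule eq)
        then show "x = y" using inj_onD[OF bij_betw_imp_inj_on[OF h]] xy by blast
      qed
      show "?f ` carrier G = carrier ?H"
      proof
        show "?f ` carrier G \<subseteq> carrier ?H"
          using cyc by (auto simp: carrier_relative_homology_group)
        show "carrier ?H \<subseteq> ?f ` carrier G"
        proof
          fix z assume "z \<in> carrier ?H"
          then obtain c where c: "singular_relcycle n X {} c" "z = homologous_rel_set n X {} c"
            by (auto simp: carrier_relative_homology_group)
          obtain a where a: "a \<in> balanced" "homologous_rel n X {} c (top_chain I a)"
            by (rule cycle_homologous_balanced[OF c(1)])
          have "a \<in> h ` carrier G" using a(1) unfolding bij_betw_imp_surj_on[OF h] .
          then obtain x where x: "x \<in> carrier G" "h x = a" by (elim imageE) simp
          then have "z = ?f x" using a(2) unfolding c(2) homologous_rel_set_eq by simp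
          then show "z \<in> ?f ` carrier G" using x(1) by blast
        qed
      qed
    qed
  qed
  then have "G \<cong> ?H" by (rule is_isoI)
  then show ?thesis using G by (rule group.iso_sym[rotated])
qed

end

section \<open>Cycle graphs with one leg at each vertex\<close>

lemma joined_refl: "v \<in> verts G \<Longrightarrow> (v, v) \<in> joined G F"
  by (simp add: joined_def)

lemma sym_joined: "sym (joined G F)"
proof -
  have "sym {(u, v). \<exists>e\<in>F. ends G e = {#u, v#}}"
    by (rule symI) (auto simp: add_mset_commute)
  then show ?thesis
    unfolding joined_def by (intro sym_Int sym_rtrancl) (auto intro: symI)
qed

lemma trans_joined: "trans (joined G F)"
  unfolding joined_def by (intro trans_Int trans_rtrancl) (auto intro: transI)

lemma equiv_joined: "equiv (verts G) (joined G F)"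
  by (intro equivI sym_joined trans_joined refl_onI joined_refl) (auto simp: joined_def)

lemma joined_edge: "\<lbrakk>e \<in> F; ends G e = {#u, v#}; u \<in> verts G; v \<in> verts G\<rbrakk> \<Longrightarrow> (u, v) \<in> joined G F"
  by (auto simp: joined_def)

lemma joined_subset:
  assumes P: "\<And>e u v. \<lbrakk>e \<in> F; ends G e = {#u, v#}; u \<in> verts G; v \<in> verts G\<rbrakk> \<Longrightarrow> P u v"
    and refl: "\<And>u. u \<in> verts G \<Longrightarrow> P u u"
    and trans: "\<And>u v w. \<lbrakk>P u v; P v w\<rbrakk> \<Longrightarrow> P u w"
    and closed: "\<And>e. e \<in> F \<Longrightarrow> set_mset (ends G e) \<subseteq> verts G"
    and uv: "(u, v) \<in> joined G F"
  shows "P u v"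
proof -
  have "(u, v) \<in> {(u, v). \<exists>e\<in>F. ends G e = {#u, v#}}\<^sup>*" and u: "u \<in> verts G"
    using uv by (auto simp: joined_def)
  then have "P u v \<and> v \<in> verts G"
  proof (induction rule: rtrancl_induct)
    case base
    then show ?case using refl by simp
  next
    case (step v w)
    then obtain e where e: "e \<in> F" "ends G e = {#v, w#}" by blast
    then have "w \<in> verts G" using closed[OF e(1)] by simp
    then show ?case using step.IH[OF u] P[OF e] trans by blast
  qed
  then show ?thesis ..
qed

lemma cycle_two_edges:
  assumes cyc: "is_cycle G vs es" and k1: "1 < length es" and i: "i < length es"
  shows "\<exists>e\<in>set es. e \<noteq> es ! i \<and> vs ! i \<in># ends G e"
proof -
  let ?k = "length es" and ?j = "(i + (length es - 1)) mod length es"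
  have j: "?j < ?k" "(?j + 1) mod ?k = i" "?j \<noteq> i"
  proof -
    show "?j < ?k" using k1 by (intro mod_less_divisor) linarith
    have "(?j + 1) mod ?k = (i + (?k - 1) + 1) mod ?k" by (rule mod_add_left_eq)
    also have "i + (?k - 1) + 1 = i + ?k" using k1 by linarith
    also have "(i + ?k) mod ?k = i" using i by simp
    finally show "(?j + 1) mod ?k = i" .
    then show "?j \<noteq> i"
      using k1 i by (metis Suc_eq_plus1 mod_Suc mod_less n_not_Suc_n One_nat_def less_not_refl2 nat_neq_iff)
  qed
  have "es ! ?j \<noteq> es ! i" using cyc j i by (simp add: is_cycle_def nth_eq_iff_index_eq)
  moreover have "vs ! i \<in># ends G (es ! ?j)" using cyc j(1,2) by (simp add: is_cycle_def)
  ultimately show ?thesis using nth_mem[OF j(1)] by blast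
qed

text \<open>Cyclic successor of a position, and below it the cyclic predecessor.\<close>

definition nx :: "nat \<Rightarrow> nat \<Rightarrow> nat" where "nx n i = (if i = n then 0 else Suc i)"
definition pv :: "nat \<Rightarrow> nat \<Rightarrow> nat" where "pv n i = (if i = 0 then n else i - 1)"

lemma nx_le: "i \<le> n \<Longrightarrow> nx n i \<le> n" by (simp add: nx_def)
lemma pv_le: "i \<le> n \<Longrightarrow> pv n i \<le> n" by (auto simp: pv_def)
lemma nx_eq_iff: "i \<le> n \<Longrightarrow> j \<le> n \<Longrightarrow> nx n j = i \<longleftrightarrow> j = pv n i" by (auto simp: nx_def pv_def)
lemma nx_neq: "i \<le> n \<Longrightarrow> 0 < n \<Longrightarrow> nx n i \<noteq> i" by (simp add: nx_def)
lemma pv_neq: "i \<le> n \<Longrightarrow> 0 < n \<Longrightarrow> pv n i \<noteq> i" by (auto simp: pv_def)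

text \<open>Position \<open>i\<close> of the cycle carries leg \<open>Suc (p i)\<close>, and edge \<open>\<rho> i\<close> leads from it to the next position.\<close>

definition cyc_ends :: "nat \<Rightarrow> (nat \<Rightarrow> nat) \<Rightarrow> (nat \<Rightarrow> nat) \<Rightarrow> nat \<Rightarrow> nat multiset" where
  "cyc_ends n \<rho> p = (\<lambda>e\<in>{..n}. {#Suc (p (inv_into UNIV \<rho> e)), Suc (p (nx n (inv_into UNIV \<rho> e)))#})"

text \<open>
  With as many vertices as legs, every vertex carries exactly one leg and every color is used. So
  vertices can be named by their legs and edges by their colors, shifted to start at \<open>0\<close>.
\<close>

definition leg_graph :: "nat \<Rightarrow> (nat \<Rightarrow> nat multiset) \<Rightarrow> ngraph" where
  "leg_graph n E = \<lparr>verts = {1..Suc n}, edges = {..n}, ends = E, leg = id\<rparr>"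

lemma leg_graph_simps [simp]:
  "verts (leg_graph n E) = {1..Suc n}" "edges (leg_graph n E) = {..n}"
  "ends (leg_graph n E) = E" "leg (leg_graph n E) = id"
  by (simp_all add: leg_graph_def)

locale cycle_graph =
  fixes n :: nat and \<rho> p :: "nat \<Rightarrow> nat"
  assumes n2: "2 \<le> n" and \<rho>: "\<rho> permutes {..n}" and p: "p permutes {..n}"
begin

abbreviation "E \<equiv> cyc_ends n \<rho> p"
abbreviation "G \<equiv> leg_graph n E"
abbreviation "v i \<equiv> Suc (p i)"

lemma \<rho>_le: "i \<le> n \<Longrightarrow> \<rho> i \<le> n" using permutes_in_image[OF \<rho>, of i] by simp
lemma p_le: "i \<le> n \<Longrightarrow> p i \<le> n" using permutes_in_image[OF p, of i] by simp

lemma v_verts: "i \<le> n \<Longrightarrow> v i \<in> {1..Suc n}" using p_le by simp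

lemma p_eq: "p i = p j \<longleftrightarrow> i = j" using permutes_inj[OF p] by (auto dest: injD)
lemma v_eq: "v i = v j \<longleftrightarrow> i = j" using permutes_inj[OF p] by (auto dest: injD)
lemma \<rho>_eq: "\<rho> i = \<rho> j \<longleftrightarrow> i = j" using permutes_inj[OF \<rho>] by (auto dest: injD)

lemma E_at: "i \<le> n \<Longrightarrow> E (\<rho> i) = {#v i, v (nx n i)#}"
  using \<rho>_le permutes_inverses(2)[OF \<rho>] by (simp add: cyc_ends_def)

lemma color_at: "e \<le> n \<Longrightarrow> \<exists>i\<le>n. e = \<rho> i"
  using permutes_image[OF \<rho>] by (metis atMost_iff imageE)

lemma vertex_at: "w \<in> {1..Suc n} \<Longrightarrow> \<exists>i\<le>n. w = v i"
proof -
  assume w: "w \<in> {1..Suc n}"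
  then have "w - 1 \<in> p ` {..n}" using permutes_image[OF p] by auto
  then show ?thesis using w by force
qed

lemma count_E: "i \<le> n \<Longrightarrow> j \<le> n \<Longrightarrow>
    count (E (\<rho> j)) (v i) = (if j = i then 1 else 0) + (if j = pv n i then 1 else 0)"
  using nx_eq_iff[of i n j] by (auto simp: E_at p_eq)

lemma mem_E_iff: "i \<le> n \<Longrightarrow> j \<le> n \<Longrightarrow> v i \<in># E (\<rho> j) \<longleftrightarrow> j = i \<or> j = pv n i"
  using nx_eq_iff[of i n j] by (auto simp: E_at p_eq)

lemma E_verts: "e \<le> n \<Longrightarrow> size (E e) = 2 \<and> set_mset (E e) \<subseteq> {1..Suc n}"
  using color_at[of e] E_at v_verts nx_le by fastforce

lemma E_extensional: "E \<in> extensional {..n}"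
  by (simp add: cyc_ends_def)

lemma wf_cycle_graph: "wf_graph (Suc n) G"
  using E_verts by (simp add: wf_graph_def)

text \<open>Without the edge \<open>\<rho> m\<close> the cycle is a path. Positions up to
  \<open>m\<close> are reached upward from \<open>0\<close>; those above \<open>m\<close> are joined
  upward to \<open>n\<close> and through the closing edge to \<open>0\<close>.\<close>

lemma joined_removed:
  assumes m: "m \<le> n" and F: "{..n} - {\<rho> m} \<subseteq> F"
  shows "joined G F = {1..Suc n} \<times> {1..Suc n}"
proof -
  have edge: "(v i, v (nx n i)) \<in> joined G F" if "i \<le> n" "i \<noteq> m" for i
  proof (rule joined_edge[where e = "\<rho> i"])
    show "\<rho> i \<in> F" using F that \<rho>_le \<rho>_eq by auto
    show "ends G (\<rho> i) = {#v i, v (nx n i)#}" using that E_at by simp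
    show "v i \<in> verts G" "v (nx n i) \<in> verts G" using v_verts nx_le that by simp_all
  qed
  have low: "(v 0, v j) \<in> joined G F" if "j \<le> m" for j
    using that
  proof (induction j)
    case 0
    then show ?case using v_verts[of 0] by (simp add: joined_refl)
  next
    case (Suc j)
    then have "(v j, v (Suc j)) \<in> joined G F" using edge[of j] m by (simp add: nx_def)
    then show ?case using Suc trans_joined by (meson Suc_leD transD)
  qed
  have high: "(v j, v n) \<in> joined G F" if "m < j" "j \<le> n" for j
    using that(2,1)
  proof (induction j rule: inc_induct)
    case base
    then show ?case using v_verts[of n] by (simp add: joined_refl)
  next
    case (step j)
    then have "(v j, v (Suc j)) \<in> joined G F" using edge[of j] by (simp add: nx_def)
    then show ?case using step trans_joined by (meson less_SucI transD)
  qed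
  have "(v 0, v j) \<in> joined G F" if "j \<le> n" for j
  proof (cases "j \<le> m")
    case False
    then have "m < n" "(v j, v n) \<in> joined G F" using that high by auto
    moreover have "(v n, v 0) \<in> joined G F" using edge[of n] \<open>m < n\<close> by (simp add: nx_def)
    ultimately show ?thesis using trans_joined sym_joined by (meson symD transD)
  qed (rule low)
  then have "(v i, v j) \<in> joined G F" if "i \<le> n" "j \<le> n" for i j
    using that trans_joined sym_joined by (meson symD transD)
  then have "{1..Suc n} \<times> {1..Suc n} \<subseteq> joined G F"
    by (intro subsetI) (elim SigmaE, drule vertex_at, drule vertex_at, elim exE conjE, simp only:)
  then show ?thesis by (auto simp: joined_def)
qed

lemma joined_all: "joined G {..n} = {1..Suc n} \<times> {1..Suc n}"
  by (rule joined_removed[of 0]) auto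

lemma admissible_cycle_graph: "admissible (Suc n) G"
  unfolding admissible_def
proof (intro conjI ballI)
  show "wf_graph (Suc n) G" by (rule wf_cycle_graph)
  show "connected_by G (edges G)" using joined_all by (simp add: connected_by_def)
  show "connected_by G (edges G - {e})" if "e \<in> edges G" for e
    using color_at[of e] that joined_removed[of _ "{..n} - {e}"] by (auto simp: connected_by_def)
  fix w assume "w \<in> verts G"
  then obtain i where i: "i \<le> n" "w = v i" using vertex_at by auto
  have "(\<Sum>e\<in>{..n}. count (E e) w) = (\<Sum>j\<in>{..n}. count (E (\<rho> j)) w)"
    using sum.reindex_bij_betw[OF permutes_imp_bij[OF \<rho>], of "\<lambda>e. count (E e) w"] by simp
  also have "\<dots> = (\<Sum>j\<in>{..n}. (if j = i then 1 else 0) + (if j = pv n i then 1 else 0))"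
    using i by (intro sum.cong) (simp_all add: count_E)
  also have "\<dots> = 2"
    using i pv_le[OF i(1)] by (simp add: sum.distrib)
  finally have "(\<Sum>e\<in>{..n}. count (E e) w) = 2" .
  moreover have "{a \<in> {1..Suc n}. id a = w} = {w}" using i v_verts by auto
  ultimately show "3 \<le> valency (Suc n) G w" by (simp add: valency_def)
qed

lemma first_betti_cycle_graph: "first_betti G = 1"
proof -
  have "comps G (edges G) = {{1..Suc n}}"
    using joined_all by (auto simp: comps_def quotient_def)
  then show ?thesis by (simp add: first_betti_def)
qed

text \<open>Each vertex meets just two edges, and a cycle needs two edges at each of its vertices.
  So the edges of a cycle are closed under passing to the next position and exhaust
  \<open>{..n}\<close>.\<close>

lemma forest_cycle_graph:
  assumes F: "F \<subset> {..n}"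
  shows "forest G F"
  unfolding forest_def
proof (rule notI, elim exE conjE)
  fix vs es assume es: "set es \<subseteq> F" and cyc: "is_cycle G vs es"
  let ?k = "length es"
  have k: "0 < ?k" "length vs = ?k"
    and ends: "\<And>i. i < ?k \<Longrightarrow> E (es ! i) = {#vs ! i, vs ! ((i + 1) mod ?k)#}"
    using cyc by (auto simp: is_cycle_def)
  have es_n: "es ! i \<le> n" if "i < ?k" for i using es F nth_mem[OF that] by auto
  have no_loop: "E e \<noteq> {#x, x#}" if en: "e \<le> n" for e x
  proof -
    obtain i where i: "i \<le> n" "e = \<rho> i" using color_at[OF en] by (elim exE conjE)
    have "nx n i \<noteq> i" using nx_neq[OF i(1)] n2 by simp
    then have "v i \<noteq> v (nx n i)" using v_eq by metis
    moreover have "v i = x" "v (nx n i) = x" if "{#v i, v (nx n i)#} = {#x, x#}"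
      using arg_cong[OF that, of set_mset] by auto
    ultimately show ?thesis unfolding i(2) E_at[OF i(1)] by metis
  qed
  have k1: "1 < ?k"
  proof (rule ccontr)
    assume "\<not> 1 < ?k"
    then have "?k = 1" using k(1) by linarith
    then show False using ends[of 0] no_loop es_n[of 0] by simp
  qed
  have two: "\<exists>e'\<in>set es. e' \<noteq> es ! i \<and> vs ! i \<in># E e'" if i: "i < ?k" for i
    using cycle_two_edges[OF cyc k1 i] by simp
  have vtx: "x \<in> set vs \<longleftrightarrow> (\<exists>e\<in>set es. x \<in># E e)" for x
  proof
    assume "x \<in> set vs"
    then obtain i where "i < ?k" "x = vs ! i" using k(2) by (auto simp: in_set_conv_nth)
    then show "\<exists>e\<in>set es. x \<in># E e" using two by blast
  next
    assume "\<exists>e\<in>set es. x \<in># E e"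
    then obtain i where "i < ?k" "x \<in># E (es ! i)" by (auto simp: in_set_conv_nth)
    then have "x = vs ! i \<or> x = vs ! ((i + 1) mod ?k)" using ends[of i] by auto
    moreover have "i < length vs" "(i + 1) mod ?k < length vs" using \<open>i < ?k\<close> k by simp_all
    ultimately show "x \<in> set vs" using nth_mem by blast
  qed
  have closed: "\<rho> i \<in> set es \<longrightarrow> \<rho> (nx n i) \<in> set es" if i: "i \<le> n" for i
  proof
    assume "\<rho> i \<in> set es"
    let ?x = "v (nx n i)"
    have nxi: "nx n i \<le> n" "pv n (nx n i) = i" using i nx_le nx_eq_iff[of "nx n i" n i] by auto
    have "?x \<in># E (\<rho> i)" using E_at[OF i] by simp
    then have "?x \<in> set vs" using vtx \<open>\<rho> i \<in> set es\<close> by blast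
    then obtain l where l: "l < ?k" "?x = vs ! l" using k(2) by (auto simp: in_set_conv_nth)
    obtain e' where e': "e' \<in> set es" "e' \<noteq> es ! l" "?x \<in># E e'" using two[OF l(1)] l(2) by auto
    have "?x \<in># E (es ! l)" using ends[OF l(1)] l(2) by simp
    obtain a b where ab: "a \<le> n" "es ! l = \<rho> a" "b \<le> n" "e' = \<rho> b"
      using color_at es_n[OF l(1)] e'(1) es F by (metis in_set_conv_nth es_n)
    have "a = nx n i \<or> a = i" "b = nx n i \<or> b = i" "a \<noteq> b"
      using mem_E_iff[OF nxi(1)] ab e' \<open>?x \<in># E (es ! l)\<close> nxi(2) by auto
    then show "\<rho> (nx n i) \<in> set es" using ab e'(1) nth_mem[OF l(1)] by metis
  qed
  obtain i0 where i0: "i0 \<le> n" "\<rho> i0 \<in> set es"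
    using color_at[OF es_n[OF k(1)]] nth_mem[OF k(1)] by metis
  have up: "\<rho> j \<in> set es" if "i0 \<le> j" "j \<le> n" for j
    using that
  proof (induction j rule: dec_induct)
    case base
    then show ?case using i0 by simp
  next
    case (step j)
    then show ?case using closed[of j] by (simp add: nx_def)
  qed
  have "\<rho> 0 \<in> set es" using closed[of n] up[of n] i0 by (simp add: nx_def)
  then have "\<rho> j \<in> set es" if "j \<le> n" for j
    using that
  proof (induction j)
    case (Suc j)
    then show ?case using closed[of j] by (simp add: nx_def)
  qed simp
  then have "{..n} \<subseteq> set es" using color_at by fastforce
  then show False using es F by blast
qed

end

section \<open>Contraction and comparison of collapsed graphs\<close>

lemma pair_mset_eq_iff: "{#a, b#} = {#c, d#} \<longleftrightarrow> a = c \<and> b = d \<or> a = d \<and> b = c"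
  by (auto simp: add_eq_conv_diff)

lemma joined_mono: "F \<subseteq> F' \<Longrightarrow> joined G F \<subseteq> joined G F'"
  unfolding joined_def by (intro Int_mono rtrancl_mono) auto

lemma joined_class_eq_iff:
  "u \<in> verts G \<Longrightarrow> v \<in> verts G \<Longrightarrow> joined G F `` {u} = joined G F `` {v} \<longleftrightarrow> (u, v) \<in> joined G F"
  using eq_equiv_class_iff[OF equiv_joined] .

lemma wf_ends:
  assumes "wf_graph s G" "e \<in> edges G"
  obtains u v where "ends G e = {#u, v#}" "u \<in> verts G" "v \<in> verts G"
proof -
  have size: "size (ends G e) = Suc 1" and V: "set_mset (ends G e) \<subseteq> verts G"
    using assms by (auto simp: wf_graph_def)
  obtain u N where N: "ends G e = add_mset u N"
    using size_eq_Suc_imp_eq_union[OF size] by (elim exE)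
  then have "size N = 1" using size by simp
  then obtain v where "N = {#v#}" using size_1_singleton_mset[of N] by blast
  then show thesis using that[of u v] N V by simp
qed

text \<open>
  Collapsing commutes with contraction: if \<open>F\<close> exhibits \<open>G\<close> as \<open>H\<close> with \<open>Z\<close> contracted, then
  taking preimages under \<open>F\<close> identifies \<open>G/W\<close> with the collapse of \<open>H\<close> along \<open>Z\<close> and the copy of \<open>W\<close>.
\<close>

lemma graph_iso_contraction:
  assumes H: "wf_graph s H" and G: "wf_graph s G" and Z: "Z \<subseteq> edges H"
    and F: "F ` verts H = verts G"
    and ker: "\<And>u w. \<lbrakk>u \<in> verts H; w \<in> verts H\<rbrakk> \<Longrightarrow> F u = F w \<longleftrightarrow> (u, w) \<in> joined H Z"
    and \<psi>: "bij_betw \<psi> (edges G) (edges H - Z)"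
    and ends: "\<And>e. e \<in> edges G \<Longrightarrow> ends G e = image_mset F (ends H (\<psi> e))"
    and leg: "\<And>i. i \<in> {1..s} \<Longrightarrow> leg G i = F (leg H i)"
    and W: "W \<subseteq> edges G"
  shows "graph_iso s (collapse G W) (collapse H (Z \<union> \<psi> ` W)) (\<lambda>A. {u \<in> verts H. F u \<in> A}) \<psi>"
proof -
  let ?J = "joined H (Z \<union> \<psi> ` W)" and ?K = "joined G W" and ?f = "\<lambda>A. {u \<in> verts H. F u \<in> A}"
  have \<psi>W: "\<psi> e \<in> edges H" if "e \<in> edges G" for e using \<psi> that by (auto simp: bij_betw_def)
  have FV: "F u \<in> verts G" if "u \<in> verts H" for u using F that by blast
  have down: "(F u, F w) \<in> ?K" if uw: "(u, w) \<in> ?J" for u w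
  proof -
    have "(F u, F w) \<in> ?K \<and> u \<in> verts H \<and> w \<in> verts H"
    proof (rule joined_subset[OF _ _ _ _ uw])
      fix e u w assume e: "e \<in> Z \<union> \<psi> ` W" "ends H e = {#u, w#}" and uw: "u \<in> verts H" "w \<in> verts H"
      have "(F u, F w) \<in> ?K"
      proof (cases "e \<in> Z")
        case True
        then have "F u = F w" using ker[OF uw] joined_edge[OF True e(2) uw] by blast
        then show ?thesis using FV uw by (simp add: joined_refl)
      next
        case False
        then obtain d where d: "d \<in> W" "e = \<psi> d" using e(1) by blast
        then have "ends G d = {#F u, F w#}" using ends[of d] e(2) W by auto
        then show ?thesis using joined_edge[OF d(1)] FV uw by metis
      qed
      then show "(F u, F w) \<in> ?K \<and> u \<in> verts H \<and> w \<in> verts H" using uw by blast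
    next
      show "set_mset (ends H e) \<subseteq> verts H" if "e \<in> Z \<union> \<psi> ` W" for e
        using that Z W \<psi>W H unfolding wf_graph_def by blast
    next
      show "(F u, F u) \<in> ?K \<and> u \<in> verts H \<and> u \<in> verts H" if "u \<in> verts H" for u
        using that FV by (simp add: joined_refl)
    next
      show "(F u, F x) \<in> ?K \<and> u \<in> verts H \<and> x \<in> verts H"
        if "(F u, F w) \<in> ?K \<and> u \<in> verts H \<and> w \<in> verts H" "(F w, F x) \<in> ?K \<and> w \<in> verts H \<and> x \<in> verts H" for u w x
        using that transD[OF trans_joined] by metis
    qed
    then show ?thesis ..
  qed
  have fib: "(u, w) \<in> ?J" if "u \<in> verts H" "w \<in> verts H" "F u = F w" for u w
    using ker[OF that(1,2)] that(3) joined_mono[of Z "Z \<union> \<psi> ` W" H] by blast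
  \<comment> \<open>A path in \<open>W\<close> lifts edge by edge. Consecutive lifts need not meet,
    but they end in the same fibre of \<open>F\<close>, and fibres are joined through
    \<open>Z\<close>.\<close>
  have up: "\<forall>u\<in>verts H. \<forall>w\<in>verts H. F u = x \<longrightarrow> F w = y \<longrightarrow> (u, w) \<in> ?J" if xy: "(x, y) \<in> ?K" for x y
  proof -
    have "x \<in> verts G \<and> y \<in> verts G \<and> (\<forall>u\<in>verts H. \<forall>w\<in>verts H. F u = x \<longrightarrow> F w = y \<longrightarrow> (u, w) \<in> ?J)"
    proof (rule joined_subset[OF _ _ _ _ xy])
      fix e x y assume e: "e \<in> W" "ends G e = {#x, y#}" and V: "x \<in> verts G" "y \<in> verts G"
      have eG: "e \<in> edges G" using e W by blast
      obtain a b where ab: "ends H (\<psi> e) = {#a, b#}" "a \<in> verts H" "b \<in> verts H"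
        by (rule wf_ends[OF H \<psi>W[OF eG]])
      have "{#x, y#} = {#F a, F b#}" using ends[OF eG] ab(1) e(2) by simp
      then have "x = F a \<and> y = F b \<or> x = F b \<and> y = F a" by (simp only: pair_mset_eq_iff)
      moreover have "(a, b) \<in> ?J" using e(1) ab by (intro joined_edge[where e = "\<psi> e"]) auto
      then have "(a, b) \<in> ?J" "(b, a) \<in> ?J" using symD[OF sym_joined] by metis+
      ultimately have "(u, w) \<in> ?J" if "u \<in> verts H" "w \<in> verts H" "F u = x" "F w = y" for u w
        using fib that ab(2,3) transD[OF trans_joined] by metis
      then show "x \<in> verts G \<and> y \<in> verts G \<and> (\<forall>u\<in>verts H. \<forall>w\<in>verts H. F u = x \<longrightarrow> F w = y \<longrightarrow> (u, w) \<in> ?J)"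
        using V by blast
    next
      show "set_mset (ends G e) \<subseteq> verts G" if "e \<in> W" for e
        using that W G unfolding wf_graph_def by blast
    next
      show "x \<in> verts G \<and> x \<in> verts G \<and> (\<forall>u\<in>verts H. \<forall>w\<in>verts H. F u = x \<longrightarrow> F w = x \<longrightarrow> (u, w) \<in> ?J)"
        if "x \<in> verts G" for x using that fib by simp
    next
      fix x y z
      assume xy: "x \<in> verts G \<and> y \<in> verts G \<and> (\<forall>u\<in>verts H. \<forall>w\<in>verts H. F u = x \<longrightarrow> F w = y \<longrightarrow> (u, w) \<in> ?J)"
        and yz: "y \<in> verts G \<and> z \<in> verts G \<and> (\<forall>u\<in>verts H. \<forall>w\<in>verts H. F u = y \<longrightarrow> F w = z \<longrightarrow> (u, w) \<in> ?J)"
      obtain m where "m \<in> verts H" "F m = y" using xy F by (metis imageE)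
      then have "(u, w) \<in> ?J" if "u \<in> verts H" "w \<in> verts H" "F u = x" "F w = z" for u w
        using xy yz that transD[OF trans_joined] by metis
      then show "x \<in> verts G \<and> z \<in> verts G \<and> (\<forall>u\<in>verts H. \<forall>w\<in>verts H. F u = x \<longrightarrow> F w = z \<longrightarrow> (u, w) \<in> ?J)"
        using xy yz by blast
    qed
    then show ?thesis by blast
  qed
  have cls: "?J `` {u} = ?f (?K `` {F u})" if u: "u \<in> verts H" for u
  proof (intro equalityI subsetI)
    fix w assume "w \<in> ?J `` {u}"
    then have "(u, w) \<in> ?J" by blast
    moreover then have "w \<in> verts H" by (simp add: joined_def)
    ultimately show "w \<in> ?f (?K `` {F u})" using down by blast
  next
    fix w assume "w \<in> ?f (?K `` {F u})"
    then have "w \<in> verts H" "(F u, F w) \<in> ?K" by auto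
    then show "w \<in> ?J `` {u}" using up u by blast
  qed
  show ?thesis
    unfolding graph_iso_def
  proof (intro conjI ballI)
    show "bij_betw ?f (verts (collapse G W)) (verts (collapse H (Z \<union> \<psi> ` W)))"
      unfolding bij_betw_def
    proof
      show "inj_on ?f (verts (collapse G W))"
      proof (rule inj_onI)
        fix A B assume AB: "A \<in> verts (collapse G W)" "B \<in> verts (collapse G W)" "?f A = ?f B"
        have "A \<subseteq> verts G" "B \<subseteq> verts G"
          using AB(1,2) by (auto simp: collapse_def comps_def quotient_def joined_def)
        have "C = F ` ?f C" if "C \<subseteq> verts G" for C
          using that unfolding F[symmetric] by auto
        then have "A = F ` ?f A" "B = F ` ?f B"
          using \<open>A \<subseteq> verts G\<close> \<open>B \<subseteq> verts G\<close> by blast+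
        then show "A = B" using AB(3) by metis
      qed
      show "?f ` verts (collapse G W) = verts (collapse H (Z \<union> \<psi> ` W))"
      proof (intro equalityI subsetI)
        fix B assume "B \<in> ?f ` verts (collapse G W)"
        then obtain x where x: "x \<in> verts G" "B = ?f (?K `` {x})"
          by (auto simp: collapse_def comps_def quotient_def)
        obtain u where u: "u \<in> verts H" "x = F u" using x(1) F by blast
        then have "B = ?J `` {u}" using cls x(2) by simp
        then show "B \<in> verts (collapse H (Z \<union> \<psi> ` W))"
          using u(1) by (auto simp: collapse_def comps_def intro: quotientI)
      next
        fix B assume "B \<in> verts (collapse H (Z \<union> \<psi> ` W))"
        then obtain u where u: "u \<in> verts H" "B = ?J `` {u}"
          by (auto simp: collapse_def comps_def quotient_def)
        then have "B = ?f (?K `` {F u})" using cls by simp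
        moreover have "?K `` {F u} \<in> verts (collapse G W)"
          using FV[OF u(1)] by (auto simp: collapse_def comps_def intro: quotientI)
        ultimately show "B \<in> ?f ` verts (collapse G W)" by blast
      qed
    qed
    have "edges H - (Z \<union> \<psi> ` W) = (edges H - Z) - \<psi> ` W" by blast
    also have "\<dots> = \<psi> ` (edges G - W)"
      using inj_on_image_set_diff[OF bij_betw_imp_inj_on[OF \<psi>] Diff_subset W]
      unfolding bij_betw_imp_surj_on[OF \<psi>] by (rule sym)
    finally show "bij_betw \<psi> (edges (collapse G W)) (edges (collapse H (Z \<union> \<psi> ` W)))"
      using \<psi> by (auto simp: bij_betw_def intro: inj_on_subset)
  next
    fix e assume "e \<in> edges (collapse G W)"
    then have e: "e \<in> edges G" by simp
    have "set_mset (ends H (\<psi> e)) \<subseteq> verts H" using \<psi>W[OF e] H by (simp add: wf_graph_def)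
    then have "image_mset (\<lambda>v. ?J `` {v}) (ends H (\<psi> e)) = image_mset (\<lambda>v. ?f (?K `` {F v})) (ends H (\<psi> e))"
      by (intro image_mset_cong cls) blast
    then show "ends (collapse H (Z \<union> \<psi> ` W)) (\<psi> e) = image_mset ?f (ends (collapse G W) e)"
      by (simp add: collapse_def ends[OF e] multiset.map_comp comp_def)
  next
    fix i assume i: "i \<in> {1..s}"
    then have "leg H i \<in> verts H" using H by (simp add: wf_graph_def)
    then show "leg (collapse H (Z \<union> \<psi> ` W)) i = ?f (leg (collapse G W) i)"
      using cls leg[OF i] by (simp add: collapse_def)
  qed
qed

text \<open>
  Collapses of leg graphs along the edges with colors outside \<open>C\<close> are isomorphic iff the legs are
  grouped in the same way and the surviving edges join the same groups.
\<close>

definition same_collapse :: "nat \<Rightarrow> nat set \<Rightarrow> (nat \<Rightarrow> nat multiset) \<Rightarrow> (nat \<Rightarrow> nat multiset) \<Rightarrow> bool" where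
  "same_collapse n C E E' \<longleftrightarrow>
     joined (leg_graph n E) ({..n} - C) = joined (leg_graph n E') ({..n} - C) \<and>
     (\<forall>e\<in>{..n} \<inter> C. ends (collapse (leg_graph n E) ({..n} - C)) e = ends (collapse (leg_graph n E') ({..n} - C)) e)"

lemma same_collapse_sym: "same_collapse n C E E' \<Longrightarrow> same_collapse n C E' E"
  by (simp add: same_collapse_def)

lemma same_collapse_refl: "same_collapse n C E E"
  by (simp add: same_collapse_def)

text \<open>The ends of an edge are unordered, so the correspondence of ends holds only after a
  suitable ordering of those of \<open>E' e\<close>.\<close>

lemma same_collapse_ends:
  assumes wf: "wf_graph (Suc n) (leg_graph n E)" "wf_graph (Suc n) (leg_graph n E')"
    and same: "same_collapse n D E E'" and e: "e \<le> n" "e \<in> D"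
    and uv: "E e = {#u, v#}"
  obtains u' v' where "E' e = {#u', v'#}" "(u, u') \<in> joined (leg_graph n E) ({..n} - D)"
    "(v, v') \<in> joined (leg_graph n E) ({..n} - D)"
proof -
  let ?J = "joined (leg_graph n E) ({..n} - D)"
  obtain a b where ab: "E' e = {#a, b#}" "a \<in> {1..Suc n}" "b \<in> {1..Suc n}"
    using wf_ends[OF wf(2), of e] e(1) by auto
  have V: "u \<in> {1..Suc n}" "v \<in> {1..Suc n}"
  proof -
    have "set_mset (E e) \<subseteq> {1..Suc n}" using wf(1) e(1) by (simp add: wf_graph_def)
    then show "u \<in> {1..Suc n}" "v \<in> {1..Suc n}" unfolding uv by simp_all
  qed
  have "{#?J `` {u}, ?J `` {v}#} = {#?J `` {a}, ?J `` {b}#}"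
  proof -
    have J: "joined (leg_graph n E') ({..n} - D) = ?J"
      and "ends (collapse (leg_graph n E) ({..n} - D)) e = ends (collapse (leg_graph n E') ({..n} - D)) e"
      using same e unfolding same_collapse_def by auto
    then have "image_mset (\<lambda>v. ?J `` {v}) (E e) = image_mset (\<lambda>v. ?J `` {v}) (E' e)"
      by (simp add: collapse_def)
    then show ?thesis unfolding uv ab(1) by simp
  qed
  then have "?J `` {u} = ?J `` {a} \<and> ?J `` {v} = ?J `` {b} \<or> ?J `` {u} = ?J `` {b} \<and> ?J `` {v} = ?J `` {a}"
    by (simp only: pair_mset_eq_iff)
  then have "(u, a) \<in> ?J \<and> (v, b) \<in> ?J \<or> (u, b) \<in> ?J \<and> (v, a) \<in> ?J"
    using V ab(2,3) by (simp add: joined_class_eq_iff)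
  then show thesis using that[of a b] that[of b a] ab(1) by (auto simp: add_mset_commute)
qed

text \<open>This becomes \<open>R_anti\<close>. An edge with color in \<open>D\<close> but outside
  \<open>C\<close> has the same ends in both graphs up to edges outside \<open>D\<close>, which are
  collapsed anyway; so collapsing it merges the same groups of legs.\<close>

lemma same_collapse_antimono:
  assumes wf: "wf_graph (Suc n) (leg_graph n E)" "wf_graph (Suc n) (leg_graph n E')"
    and same: "same_collapse n D E E'" and CD: "C \<subseteq> D"
  shows "same_collapse n C E E'"
proof -
  have sub: "joined (leg_graph n E1) ({..n} - C) \<subseteq> joined (leg_graph n E2) ({..n} - C)"
    if wf: "wf_graph (Suc n) (leg_graph n E1)" "wf_graph (Suc n) (leg_graph n E2)"
      and same: "same_collapse n D E1 E2" for E1 E2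
  proof (rule subrelI)
    let ?J = "joined (leg_graph n E1) ({..n} - D)" and ?K = "joined (leg_graph n E2) ({..n} - C)"
    have JK: "?J \<subseteq> ?K"
      using same joined_mono[of "{..n} - D" "{..n} - C" "leg_graph n E2"] CD
      unfolding same_collapse_def by blast
    fix x y assume xy: "(x, y) \<in> joined (leg_graph n E1) ({..n} - C)"
    show "(x, y) \<in> ?K"
    proof (rule joined_subset[OF _ _ _ _ xy])
      fix e u v assume e: "e \<in> {..n} - C" "ends (leg_graph n E1) e = {#u, v#}"
        and V: "u \<in> verts (leg_graph n E1)" "v \<in> verts (leg_graph n E1)"
      show "(u, v) \<in> ?K"
      proof (cases "e \<in> D")
        case False
        then have "(u, v) \<in> ?J" using e V by (intro joined_edge[where e = e]) auto
        then show ?thesis using JK by blast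
      next
        case True
        obtain u' v' where uv': "E2 e = {#u', v'#}" "(u, u') \<in> ?J" "(v, v') \<in> ?J"
          by (rule same_collapse_ends[OF wf same _ True]) (use e in auto)
        have "u' \<in> {1..Suc n}" "v' \<in> {1..Suc n}"
          using uv'(2,3) by (auto simp: joined_def)
        then have "(u', v') \<in> ?K" using e(1) uv'(1) by (intro joined_edge[where e = e]) auto
        moreover have "(u, u') \<in> ?K" by (rule subsetD[OF JK uv'(2)])
        moreover have "(v', v) \<in> ?K" by (rule symD[OF sym_joined subsetD[OF JK uv'(3)]])
        ultimately show ?thesis using transD[OF trans_joined] by metis
      qed
    next
      show "set_mset (ends (leg_graph n E1) e) \<subseteq> verts (leg_graph n E1)" if "e \<in> {..n} - C" for e
        using that wf(1) by (simp add: wf_graph_def)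
    next
      show "(u, u) \<in> ?K" if "u \<in> verts (leg_graph n E1)" for u
        using that by (simp add: joined_refl)
    next
      show "(u, w) \<in> ?K" if "(u, v) \<in> ?K" "(v, w) \<in> ?K" for u v w
        using that transD[OF trans_joined] by metis
    qed
  qed
  let ?J = "joined (leg_graph n E) ({..n} - D)" and ?K = "joined (leg_graph n E) ({..n} - C)"
  have eq: "joined (leg_graph n E) ({..n} - C) = joined (leg_graph n E') ({..n} - C)"
    using sub[OF wf same] sub[OF wf(2,1) same_collapse_sym[OF same]] by (rule equalityI)
  have JK: "?J \<subseteq> ?K" using CD by (intro joined_mono) blast
  have "ends (collapse (leg_graph n E) ({..n} - C)) e = ends (collapse (leg_graph n E') ({..n} - C)) e"
    if e: "e \<in> {..n} \<inter> C" for e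
  proof -
    obtain u v where uv: "E e = {#u, v#}" "u \<in> {1..Suc n}" "v \<in> {1..Suc n}"
      using wf_ends[OF wf(1), of e] e by auto
    obtain u' v' where uv': "E' e = {#u', v'#}" "(u, u') \<in> ?J" "(v, v') \<in> ?J"
      by (rule same_collapse_ends[OF wf same _ _ uv(1)]) (use e CD in auto)
    have "?K `` {u} = ?K `` {u'}" "?K `` {v} = ?K `` {v'}"
      by (rule equiv_class_eq[OF equiv_joined subsetD[OF JK uv'(2)]],
          rule equiv_class_eq[OF equiv_joined subsetD[OF JK uv'(3)]])
    then show ?thesis using uv(1) uv'(1) eq by (simp add: collapse_def)
  qed
  then show ?thesis unfolding same_collapse_def using eq by blast
qed

definition leg_metric_graph :: "nat \<Rightarrow> (nat \<Rightarrow> nat multiset) \<Rightarrow> (nat \<Rightarrow> real) \<Rightarrow> metric_graph" where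
  "leg_metric_graph n E t = (leg_graph n E, restrict t {..n}, restrict Suc {..n})"

lemma zeros_leg_graph: "zeros (leg_graph n E) (restrict t {..n}) = {..n} - support t"
  by (auto simp: zeros_def support_def)

context cycle_graph
begin

lemma holocolored_cycle_graph: "(G, restrict Suc {..n}) \<in> holocolored_graphs (Suc n)"
  using admissible_cycle_graph first_betti_cycle_graph
  by (auto simp: holocolored_graphs_def holocolorings_def inj_on_def)

lemma regular_cycle_graph:
  assumes "t \<in> standard_simplex n"
  shows "restrict t {..n} \<in> regular_metrics G"
proof -
  have "{..n} - support t \<subset> {..n}"
    using support_nonempty[OF assms] support_simplex[OF assms] by blast
  then have "forest G (zeros G (restrict t {..n}))"
    unfolding zeros_leg_graph by (rule forest_cycle_graph)
  moreover have "\<forall>i. 0 \<le> t i" using assms by (simp add: standard_simplex_def)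
  ultimately show ?thesis by (auto simp: regular_metrics_def)
qed

lemma leg_metric_graph_in:
  "t \<in> standard_simplex n \<Longrightarrow> leg_metric_graph n E t \<in> holocolored_metric_graphs (Suc n)"
  using holocolored_cycle_graph regular_cycle_graph
  by (simp add: leg_metric_graph_def holocolored_metric_graphs_def)

end

text \<open>Edges are named by their colors, so an isomorphism fixes every surviving edge; total
  length one forces the scaling factor \<open>1\<close>; and since every vertex carries a leg, the
  vertex map is determined by the legs.\<close>

lemma mhg_class_eq_iff:
  assumes E: "cycle_graph n \<rho> p" and E': "cycle_graph n \<rho>' p'"
    and t: "t \<in> standard_simplex n" and u: "u \<in> standard_simplex n"
  defines "E \<equiv> cyc_ends n \<rho> p" and "E' \<equiv> cyc_ends n \<rho>' p'"
  shows "mhg_rel (Suc n) `` {leg_metric_graph n E t} = mhg_rel (Suc n) `` {leg_metric_graph n E' u}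
    \<longleftrightarrow> t = u \<and> same_collapse n (support t) E E'"
proof -
  interpret A: cycle_graph n \<rho> p by (rule E)
  interpret B: cycle_graph n \<rho>' p' by (rule E')
  have mem: "leg_metric_graph n E t \<in> holocolored_metric_graphs (Suc n)"
    "leg_metric_graph n E' u \<in> holocolored_metric_graphs (Suc n)"
    unfolding E_def E'_def by (rule A.leg_metric_graph_in[OF t] B.leg_metric_graph_in[OF u])+
  let ?H = "collapse (leg_graph n E) ({..n} - support t)" and ?H' = "collapse (leg_graph n E') ({..n} - support u)"
  have supp: "{..n} - ({..n} - support t) = support t" "{..n} - ({..n} - support u) = support u"
    using support_simplex t u by blast+
  have "mhg_rel (Suc n) `` {leg_metric_graph n E t} = mhg_rel (Suc n) `` {leg_metric_graph n E' u}
    \<longleftrightarrow> (leg_metric_graph n E t, leg_metric_graph n E' u) \<in> mhg_rel (Suc n)"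
    using eq_equiv_class_iff[OF equiv_mhg_rel mem] .
  also have "\<dots> \<longleftrightarrow> (\<exists>f \<phi> a. graph_iso (Suc n) ?H ?H' f \<phi> \<and> 0 < a \<and>
      (\<forall>e\<in>support t. restrict u {..n} (\<phi> e) = a * restrict t {..n} e \<and>
         restrict Suc {..n} (\<phi> e) = restrict Suc {..n} e))"
    using mem unfolding leg_metric_graph_def mhg_rel_def by (simp add: zeros_leg_graph supp)
  also have "\<dots> \<longleftrightarrow> t = u \<and> same_collapse n (support t) E E'"
  proof
    assume "t = u \<and> same_collapse n (support t) E E'"
    then have tu: "t = u" and same: "same_collapse n (support t) E E'" by auto
    have J: "joined (leg_graph n E) ({..n} - support t) = joined (leg_graph n E') ({..n} - support t)"
      using same by (simp add: same_collapse_def)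
    have "{..n} \<inter> support t = support t" using support_simplex[OF t] by blast
    then have "graph_iso (Suc n) ?H ?H' id id"
      using same J tu[symmetric] supp(1)
      unfolding graph_iso_def same_collapse_def by (simp add: collapse_def comps_def)
    then show "\<exists>f \<phi> a. graph_iso (Suc n) ?H ?H' f \<phi> \<and> 0 < a \<and>
      (\<forall>e\<in>support t. restrict u {..n} (\<phi> e) = a * restrict t {..n} e \<and>
         restrict Suc {..n} (\<phi> e) = restrict Suc {..n} e)"
      using tu by (intro exI[of _ id] exI[of _ "1 :: real"]) simp
  next
    assume "\<exists>f \<phi> a. graph_iso (Suc n) ?H ?H' f \<phi> \<and> 0 < a \<and>
      (\<forall>e\<in>support t. restrict u {..n} (\<phi> e) = a * restrict t {..n} e \<and>
         restrict Suc {..n} (\<phi> e) = restrict Suc {..n} e)"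
    then obtain f \<phi> a where iso: "graph_iso (Suc n) ?H ?H' f \<phi>" and a: "0 < a"
      and met: "\<And>e. e \<in> support t \<Longrightarrow> restrict u {..n} (\<phi> e) = a * restrict t {..n} e"
      and col: "\<And>e. e \<in> support t \<Longrightarrow> restrict Suc {..n} (\<phi> e) = restrict Suc {..n} e" by blast
    have bij: "bij_betw \<phi> (support t) (support u)"
      using iso by (simp add: graph_iso_def supp)
    have le: "support t \<subseteq> {..n}" "support u \<subseteq> {..n}" using support_simplex t u by blast+
    have \<phi>: "\<phi> e = e" if e: "e \<in> support t" for e
    proof -
      have "\<phi> e \<in> support u" using bij e by (auto simp: bij_betw_def)
      then have "\<phi> e \<le> n" "e \<le> n" using le e by auto
      then show ?thesis using col[OF e] by simp
    qed
    then have "\<phi> ` support t = id ` support t" by (intro image_cong) auto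
    then have su: "support u = support t" using bij by (simp add: bij_betw_def)
    have ut: "u e = a * t e" if "e \<in> support t" for e
    proof -
      have "e \<le> n" using le that by auto
      then show ?thesis using met[OF that] \<phi>[OF that] by simp
    qed
    have "sum u (support t) = a * sum t (support t)"
      by (simp add: sum_distrib_left ut)
    moreover have "sum u (support t) = 1" "sum t (support t) = 1"
      using sum_support_simplex[OF u _ le(1)] sum_support_simplex[OF t _ le(1)] su by auto
    ultimately have "a = 1" by simp
    have tu: "t = u"
    proof
      fix e show "t e = u e"
      proof (cases "e \<in> support t")
        case True
        then show ?thesis using ut[OF True] \<open>a = 1\<close> by simp
      next
        case False
        then have "e \<notin> support u" unfolding su .
        with False show ?thesis by (simp add: support_def)
      qed
    qed
    let ?Z = "{..n} - support t"
    let ?J = "joined (leg_graph n E) ?Z" and ?J' = "joined (leg_graph n E') ?Z"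
    have fleg: "f (?J `` {i}) = ?J' `` {i}" if "i \<in> {1..Suc n}" for i
      using iso that tu[symmetric] unfolding graph_iso_def by (simp add: collapse_def)
    have inj: "inj_on f (verts ?H)" using iso by (auto simp: graph_iso_def bij_betw_def)
    have vH: "?J `` {i} \<in> verts ?H" if "i \<in> {1..Suc n}" for i
      using that by (auto simp: collapse_def comps_def intro: quotientI)
    have iff: "(i, j) \<in> ?J \<longleftrightarrow> (i, j) \<in> ?J'" if "i \<in> {1..Suc n}" "j \<in> {1..Suc n}" for i j
    proof -
      have "(i, j) \<in> ?J \<longleftrightarrow> ?J `` {i} = ?J `` {j}"
        using that joined_class_eq_iff[of i "leg_graph n E" j] by simp
      also have "\<dots> \<longleftrightarrow> f (?J `` {i}) = f (?J `` {j})"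
        using inj_on_eq_iff[OF inj vH[OF that(1)] vH[OF that(2)]] by simp
      also have "\<dots> \<longleftrightarrow> ?J' `` {i} = ?J' `` {j}" using fleg that by simp
      also have "\<dots> \<longleftrightarrow> (i, j) \<in> ?J'"
        using that joined_class_eq_iff[of i "leg_graph n E'" j] by simp
      finally show ?thesis .
    qed
    have J: "?J = ?J'"
    proof (intro equalityI subsetI)
      fix z assume "z \<in> ?J"
      then show "z \<in> ?J'" using iff[of "fst z" "snd z"] by (cases z) (auto simp: joined_def)
    next
      fix z assume "z \<in> ?J'"
      then show "z \<in> ?J" using iff[of "fst z" "snd z"] by (cases z) (auto simp: joined_def)
    qed
    have "ends ?H e = ends ?H' e" if e: "e \<in> support t" for e
    proof -
      have "e \<in> edges ?H" using e le by auto
      then have "ends ?H' (\<phi> e) = image_mset f (ends ?H e)" using iso by (auto simp: graph_iso_def)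
      then have "ends ?H' e = image_mset f (ends ?H e)" using \<phi>[OF e] by simp
      also have "\<dots> = image_mset (\<lambda>v. f (?J `` {v})) (E e)"
        by (simp add: collapse_def multiset.map_comp comp_def)
      also have "\<dots> = image_mset (\<lambda>v. ?J' `` {v}) (E e)"
      proof (rule image_mset_cong)
        fix x assume "x \<in># E e"
        moreover have "set_mset (E e) \<subseteq> {1..Suc n}" using A.E_verts e le unfolding E_def by blast
        ultimately show "f (?J `` {x}) = ?J' `` {x}" using fleg by blast
      qed
      also have "\<dots> = ends ?H e" by (simp add: collapse_def J)
      finally show ?thesis by simp
    qed
    then have "same_collapse n (support t) E E'"
      unfolding same_collapse_def using J tu by simp
    then show "t = u \<and> same_collapse n (support t) E E'" using tu by blast
  qed
  finally show ?thesis .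
qed

section \<open>Admissible graphs of rank one are cycles\<close>

lemma sum_count_subset_le:
  assumes "finite A" "F \<subseteq> A"
  shows "(\<Sum>e\<in>F. count (f e) v) \<le> (\<Sum>e\<in>A. count (f e) v)"
  using assms by (intro sum_mono2) auto

lemma joined_first_edge:
  assumes "(v, w) \<in> joined G F" "v \<noteq> w"
  shows "\<exists>e\<in>F. v \<in># ends G e"
proof -
  have "(v, w) \<in> {(u, v). \<exists>e\<in>F. ends G e = {#u, v#}}\<^sup>*" using assms(1) by (simp add: joined_def)
  then show ?thesis using assms(2)
  proof (cases rule: converse_rtranclE)
    case (step y)
    then obtain e where "e \<in> F" "ends G e = {#v, y#}" by blast
    then show ?thesis by (intro bexI[of _ e]) simp
  qed simp
qed

locale rank_one_graph =
  fixes s :: nat and G :: "('v, 'e) legged_graph"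
  assumes adm: "admissible s G" and betti: "first_betti G = 1"
begin

lemma wf: "wf_graph s G" using adm by (simp add: admissible_def)
lemma finite_verts: "finite (verts G)" and finite_edges: "finite (edges G)" and verts_nonempty: "verts G \<noteq> {}"
  using wf by (auto simp: wf_graph_def)

lemma joined_edges: "joined G (edges G) = verts G \<times> verts G"
  using adm by (simp add: admissible_def connected_by_def)

lemma card_edges: "card (edges G) = card (verts G)"
proof -
  have "comps G (edges G) = {verts G}"
    using verts_nonempty by (auto simp: comps_def joined_edges quotient_def)
  then show ?thesis using betti by (simp add: first_betti_def)
qed

definition degree where "degree v = (\<Sum>e\<in>edges G. count (ends G e) v)"

lemma sum_degree: "(\<Sum>v\<in>verts G. degree v) = 2 * card (verts G)"
proof -
  have "(\<Sum>v\<in>verts G. degree v) = (\<Sum>e\<in>edges G. \<Sum>v\<in>verts G. count (ends G e) v)"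
    unfolding degree_def by (rule sum.swap)
  also have "\<dots> = (\<Sum>e\<in>edges G. 2)"
  proof (rule sum.cong[OF refl])
    fix e assume e: "e \<in> edges G"
    then have "size (ends G e) = 2" "set_mset (ends G e) \<subseteq> verts G"
      using wf by (auto simp: wf_graph_def)
    moreover from this(2) have "(\<Sum>v\<in>verts G. count (ends G e) v) = size (ends G e)"
      unfolding size_multiset_overloaded_eq
      by (intro sum.mono_neutral_right finite_verts) (auto simp: not_in_iff)
    ultimately show "(\<Sum>v\<in>verts G. count (ends G e) v) = 2" by simp
  qed
  finally show ?thesis by (simp add: card_edges)
qed

lemma degree_ge_2:
  assumes v: "v \<in> verts G"
  shows "2 \<le> degree v"
proof (cases "\<exists>w\<in>verts G. w \<noteq> v")
  case True
  then obtain w where w: "w \<in> verts G" "v \<noteq> w" by blast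
  have "(v, w) \<in> joined G (edges G)" using v w(1) by (simp add: joined_edges)
  then obtain e where e: "e \<in> edges G" "v \<in># ends G e" using joined_first_edge w(2) by metis
  have "connected_by G (edges G - {e})" using adm e(1) by (simp add: admissible_def)
  then have "(v, w) \<in> joined G (edges G - {e})" using v w(1) by (simp add: connected_by_def)
  then obtain e' where e': "e' \<in> edges G - {e}" "v \<in># ends G e'" using joined_first_edge w(2) by metis
  have "(\<Sum>d\<in>{e, e'}. count (ends G d) v) \<le> degree v"
    unfolding degree_def using e e' by (intro sum_count_subset_le finite_edges) auto
  moreover have "(\<Sum>d\<in>{e, e'}. count (ends G d) v) = count (ends G e) v + count (ends G e') v"
    using e' by auto
  moreover have "0 < count (ends G e) v" "0 < count (ends G e') v" using e(2) e'(2) by auto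
  ultimately show ?thesis by linarith
next
  case False
  then have "verts G = {v}" using v by blast
  then show ?thesis using sum_degree by simp
qed

text \<open>Edges and vertices are equally many, so the degrees average two; none is smaller because
  no edge is a bridge.\<close>

lemma degree_eq_2:
  assumes v: "v \<in> verts G"
  shows "degree v = 2"
proof (rule ccontr)
  assume "degree v \<noteq> 2"
  then have "2 < degree v" using degree_ge_2[OF v] by simp
  then have "(\<Sum>v\<in>verts G. 2) < (\<Sum>v\<in>verts G. degree v)"
    using v degree_ge_2 by (intro sum_strict_mono_ex1 finite_verts) auto
  then show False by (simp add: sum_degree)
qed

lemma ends_count_le_2:
  assumes "v \<in> verts G" "F \<subseteq> edges G"
  shows "(\<Sum>e\<in>F. count (ends G e) v) \<le> 2"
  using sum_count_subset_le[OF finite_edges assms(2), of "ends G" v] degree_eq_2[OF assms(1)]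
  by (simp add: degree_def)

lemma leg_at:
  assumes v: "v \<in> verts G"
  shows "\<exists>i\<in>{1..s}. leg G i = v"
proof -
  have "3 \<le> degree v + card {i \<in> {1..s}. leg G i = v}"
    using adm v by (simp add: admissible_def valency_def degree_def)
  then have "card {i \<in> {1..s}. leg G i = v} \<noteq> 0" using degree_eq_2[OF v] by linarith
  then have "{i \<in> {1..s}. leg G i = v} \<noteq> {}" by (metis card.empty)
  then show ?thesis by blast
qed

definition path where
  "path vs es \<longleftrightarrow> length vs = Suc (length es) \<and> distinct vs \<and> distinct es \<and>
     set vs \<subseteq> verts G \<and> set es \<subseteq> edges G \<and>
     (\<forall>i<length es. ends G (es ! i) = {#vs ! i, vs ! Suc i#})"

text \<open>A path of maximal length closes up, since all vertices have degree two.\<close>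

lemma ex_cycle: "\<exists>vs es. is_cycle G vs es \<and> set vs \<subseteq> verts G \<and> set es \<subseteq> edges G"
proof -
  obtain v0 where v0: "v0 \<in> verts G" using verts_nonempty by blast
  let ?P = "\<lambda>z. path (fst z) (snd z)"
  have "?P ([v0], [])" using v0 by (simp add: path_def)
  moreover have "\<forall>z. ?P z \<longrightarrow> length (fst z) < Suc (card (verts G))"
  proof (intro allI impI)
    fix z assume "?P z"
    then have "card (set (fst z)) \<le> card (verts G)" "card (set (fst z)) = length (fst z)"
      unfolding path_def using card_mono[OF finite_verts] distinct_card by metis+
    then show "length (fst z) < Suc (card (verts G))" by simp
  qed
  ultimately obtain z where z: "?P z" "\<forall>y. ?P y \<longrightarrow> length (fst y) \<le> length (fst z)"
    using ex_has_greatest_nat[of ?P "([v0], [])" "\<lambda>z. length (fst z)"] by blast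
  obtain vs es where vses: "z = (vs, es)" by (cases z)
  have path: "path vs es" using z(1) vses by simp
  have max: "length vs' \<le> length vs" if "path vs' es'" for vs' es'
    using z(2)[THEN spec, of "(vs', es')"] that vses by simp
  define m where "m = length es"
  have len: "length vs = Suc m" "length es = m" and dist: "distinct vs" "distinct es"
    and sub: "set vs \<subseteq> verts G" "set es \<subseteq> edges G"
    and ends: "\<And>i. i < m \<Longrightarrow> ends G (es ! i) = {#vs ! i, vs ! Suc i#}"
    using path by (auto simp: path_def m_def)
  have nth_eq: "vs ! i = vs ! j \<longleftrightarrow> i = j" if "i \<le> m" "j \<le> m" for i j
    using dist(1) len(1) that by (simp add: nth_eq_iff_index_eq)
  have es_in: "es ! i \<in> edges G" if "i < m" for i using sub(2) nth_mem[of i es] that len by auto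
  have vs_in: "vs ! i \<in> verts G" if "i \<le> m" for i using sub(1) nth_mem[of i vs] that len by auto
  let ?x = "vs ! m"
  have xV: "?x \<in> verts G" by (rule vs_in) simp
  \<comment> \<open>The last path edge is no loop and contributes only one to the degree of the end
    vertex, which is two.\<close>
  have "\<exists>e\<in>edges G. ?x \<in># ends G e \<and> (0 < m \<longrightarrow> e \<noteq> es ! (m - 1))"
  proof (rule ccontr)
    assume no: "\<not> ?thesis"
    let ?D = "if 0 < m then {es ! (m - 1)} else {}"
    have "degree ?x = (\<Sum>e\<in>?D. count (ends G e) ?x)"
      unfolding degree_def using no es_in by (intro sum.mono_neutral_right finite_edges) (auto simp: not_in_iff)
    moreover have "(\<Sum>e\<in>?D. count (ends G e) ?x) \<le> 1"
      using ends[of "m - 1"] nth_eq[of "m - 1" m] by auto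
    ultimately show False using degree_eq_2[OF xV] by simp
  qed
  then obtain e where e: "e \<in> edges G" "?x \<in># ends G e" "0 < m \<Longrightarrow> e \<noteq> es ! (m - 1)" by blast
  obtain a b where ab: "ends G e = {#a, b#}" "a \<in> verts G" "b \<in> verts G" by (rule wf_ends[OF wf e(1)])
  obtain y where y: "ends G e = {#?x, y#}" "y \<in> verts G"
  proof (cases "a = ?x")
    case True
    then show thesis using that ab by blast
  next
    case False
    then have "b = ?x" using e(2) ab(1) by simp
    then show thesis using that[of a] ab by (simp add: add_mset_commute)
  qed
  have e_new: "e \<notin> set es"
  proof
    assume "e \<in> set es"
    then obtain i where i: "i < m" "e = es ! i" using len(2) by (auto simp: in_set_conv_nth)
    then have "?x = vs ! i \<or> ?x = vs ! Suc i" using e(2) ends[OF i(1)] by auto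
    then have "m = i \<or> m = Suc i" using nth_eq[of m i] nth_eq[of m "Suc i"] i(1) by auto
    then show False using i e(3) by auto
  qed
  have "y \<in> set vs"
  proof (rule ccontr)
    assume y': "y \<notin> set vs"
    have "path (vs @ [y]) (es @ [e])"
      unfolding path_def
    proof (intro conjI allI impI)
      fix i assume "i < length (es @ [e])"
      then consider "i < m" | "i = m" using len by fastforce
      then show "ends G ((es @ [e]) ! i) = {#(vs @ [y]) ! i, (vs @ [y]) ! Suc i#}"
        by cases (use len ends y(1) in \<open>auto simp: nth_append\<close>)
    qed (use len dist sub y' e_new e(1) y(2) in auto)
    from max[OF this] show False by simp
  qed
  then obtain j where j: "j \<le> m" "y = vs ! j"
    using len(1) by (metis in_set_conv_nth less_Suc_eq_le)
  \<comment> \<open>An inner vertex of the path already has two path edges, and at the end vertex a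
    loop would add two to the last path edge; either way the degree would exceed two. Only the first
    vertex is left.\<close>
  have "j = 0"
  proof (rule ccontr)
    assume j0: "j \<noteq> 0"
    let ?c = "\<lambda>d. count (ends G d) y"
    have d1: "j - 1 < m" "?c (es ! (j - 1)) = 1"
      using j j0 ends[of "j - 1"] nth_eq[of "j - 1" j] by auto
    show False
    proof (cases "j = m")
      case True
      then have "?c e = 2" using y(1) j(2) by simp
      moreover have "(\<Sum>d\<in>{e, es ! (j - 1)}. ?c d) = ?c e + ?c (es ! (j - 1))"
        using e_new nth_mem[of "j - 1" es] d1(1) len(2) by (subst sum.insert) auto
      ultimately show False
        using ends_count_le_2[OF y(2), of "{e, es ! (j - 1)}"] d1 e(1) es_in by simp
    next
      case False
      then have jm: "j < m" using j(1) by simp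
      have c2: "?c (es ! j) = 1" using ends[OF jm] nth_eq[of "Suc j" j] jm j(2) by auto
      have c3: "1 \<le> ?c e" using y(1) by simp
      have "es ! (j - 1) \<noteq> es ! j" using dist(2) len(2) jm j0 by (simp add: nth_eq_iff_index_eq)
      moreover have "e \<noteq> es ! (j - 1)" "e \<noteq> es ! j"
        using e_new nth_mem[of "j - 1" es] nth_mem[of j es] d1(1) jm len(2) by auto
      ultimately have "(\<Sum>d\<in>{e, es ! (j - 1), es ! j}. ?c d) = ?c e + (?c (es ! (j - 1)) + ?c (es ! j))"
        by simp
      then show False
        using ends_count_le_2[OF y(2), of "{e, es ! (j - 1), es ! j}"] d1 c2 c3 e(1) es_in jm by simp
    qed
  qed
  then have y0: "y = vs ! 0" using j(2) by simp
  have "is_cycle G vs (es @ [e])"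
    unfolding is_cycle_def
  proof (intro conjI allI impI)
    fix i assume "i < length (es @ [e])"
    then consider "i < m" | "i = m" using len by fastforce
    then show "ends G ((es @ [e]) ! i) = {#vs ! i, vs ! ((i + 1) mod length (es @ [e]))#}"
      by cases (use len ends y(1) y0 in \<open>auto simp: nth_append\<close>)
  qed (use len dist e_new in auto)
  then show ?thesis using sub e(1) by (intro exI[of _ vs] exI[of _ "es @ [e]"]) auto
qed

text \<open>A cycle uses up the degree of all its vertices, so no other edge touches it, and
  connectedness makes it the whole graph.\<close>

theorem rank_one_is_cycle: "\<exists>vs es. is_cycle G vs es \<and> set vs = verts G \<and> set es = edges G"
proof -
  obtain vs es where cyc: "is_cycle G vs es" and sub: "set vs \<subseteq> verts G" "set es \<subseteq> edges G"
    using ex_cycle by blast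
  let ?k = "length es"
  have k: "0 < ?k" "length vs = ?k"
    and ends: "\<And>i. i < ?k \<Longrightarrow> ends G (es ! i) = {#vs ! i, vs ! ((i + 1) mod ?k)#}"
    using cyc by (auto simp: is_cycle_def)
  have ends_vs: "set_mset (ends G e) \<subseteq> set vs" if e: "e \<in> set es" for e
  proof -
    obtain i where i: "i < ?k" "e = es ! i" using e by (auto simp: in_set_conv_nth)
    moreover have "vs ! i \<in> set vs" "vs ! ((i + 1) mod ?k) \<in> set vs" using i(1) k by simp_all
    ultimately show ?thesis using ends by simp
  qed
  have closed: "e \<in> set es" if e: "e \<in> edges G" "x \<in># ends G e" and x: "x \<in> set vs" for e x
  proof (rule ccontr)
    assume new: "e \<notin> set es"
    obtain i where i: "i < ?k" "x = vs ! i" using x k(2) by (auto simp: in_set_conv_nth)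
    have xV: "x \<in> verts G" using x sub(1) by blast
    let ?c = "\<lambda>d. count (ends G d) x"
    have c: "1 \<le> ?c e" using e(2) by simp
    have ei: "es ! i \<in> set es" using i(1) by simp
    show False
    proof (cases "?k = 1")
      case True
      then have "?c (es ! i) = 2" using ends[OF i(1)] i by simp
      moreover have "(\<Sum>d\<in>{e, es ! i}. ?c d) = ?c e + ?c (es ! i)"
        using new ei by (subst sum.insert) auto
      ultimately show False using ends_count_le_2[OF xV, of "{e, es ! i}"] c e(1) ei sub(2) by auto
    next
      case False
      then have "1 < ?k" using k(1) by linarith
      then obtain e' where e': "e' \<in> set es" "e' \<noteq> es ! i" "x \<in># ends G e'"
        using cycle_two_edges[OF cyc _ i(1)] i(2) by blast
      have "(\<Sum>d\<in>{e, es ! i, e'}. ?c d) = ?c e + (?c (es ! i) + ?c e')"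
      proof -
        have "e \<noteq> es ! i" "e \<noteq> e'" "es ! i \<noteq> e'" using new ei e'(1,2) by metis+
        then show ?thesis by simp
      qed
      moreover have "1 \<le> ?c e'" using e'(3) by simp
      moreover have "1 \<le> ?c (es ! i)" using ends[OF i(1)] i(2) by simp
      moreover have "{e, es ! i, e'} \<subseteq> edges G" using e(1) ei e'(1) sub(2) by blast
      ultimately show False using ends_count_le_2[OF xV, of "{e, es ! i, e'}"] c by linarith
    qed
  qed
  have "verts G \<subseteq> set vs"
  proof
    fix w assume w: "w \<in> verts G"
    have v0: "vs ! 0 \<in> set vs" using k by simp
    then have "(vs ! 0, w) \<in> joined G (edges G)" using w sub(1) by (auto simp: joined_edges)
    then have "vs ! 0 \<in> set vs \<longrightarrow> w \<in> set vs"
    proof (rule joined_subset[rotated 4])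
      fix e u v assume e: "e \<in> edges G" "ends G e = {#u, v#}"
      show "u \<in> set vs \<longrightarrow> v \<in> set vs"
      proof
        assume "u \<in> set vs"
        then have "e \<in> set es" using closed[OF e(1), of u] e(2) by simp
        then show "v \<in> set vs" using ends_vs[of e] e(2) by simp
      qed
    next
      show "set_mset (ends G e) \<subseteq> verts G" if "e \<in> edges G" for e
        using that wf by (simp add: wf_graph_def)
    qed blast+
    then show "w \<in> set vs" using v0 by blast
  qed
  then have vs: "set vs = verts G" using sub(1) by blast
  have "edges G \<subseteq> set es"
  proof
    fix e assume e: "e \<in> edges G"
    obtain a b where "ends G e = {#a, b#}" "a \<in> verts G" by (rule wf_ends[OF wf e])
    then show "e \<in> set es" using closed[OF e, of a] vs by simp
  qed
  then show ?thesis using cyc vs sub(2) by blast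
qed

end

section \<open>Expanding a colored cycle to one leg per vertex\<close>

lemma extend_to_permutation:
  assumes "finite S" "B \<subseteq> S" "inj_on d B" "d ` B \<subseteq> S"
  obtains \<rho> where "\<rho> permutes S" "\<And>j. j \<in> B \<Longrightarrow> \<rho> j = d j"
proof -
  have "card (S - B) = card (S - d ` B)"
    using assms by (simp add: card_Diff_subset card_image finite_subset)
  then obtain h where h: "bij_betw h (S - B) (S - d ` B)"
    using finite_same_card_bij[of "S - B" "S - d ` B"] assms(1) by auto
  let ?\<rho> = "\<lambda>j. if j \<in> B then d j else if j \<in> S then h j else j"
  have "bij_betw ?\<rho> (B \<union> (S - B)) (d ` B \<union> (S - d ` B))"
  proof (rule bij_betw_combine)
    show "bij_betw ?\<rho> B (d ` B)"
      using bij_betw_cong[of B ?\<rho> d "d ` B"] assms(3) by (simp add: inj_on_imp_bij_betw)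
    show "bij_betw ?\<rho> (S - B) (S - d ` B)"
      using bij_betw_cong[of "S - B" ?\<rho> h "S - d ` B"] h by simp
  qed blast
  then have "bij_betw ?\<rho> S S" using assms(2,4) by (simp add: Un_absorb1)
  then have "?\<rho> permutes S" using assms(2) by (intro bij_imp_permutes) auto
  then show thesis by (rule that) simp
qed

text \<open>In the application \<open>\<beta> j\<close> is the cycle vertex of the
  \<open>j\<close>-th listed leg, so positions fall into blocks of legs at a common vertex.
  \<open>B\<close> consists of the last position of each block and always contains \<open>n\<close>,
  where the cycle closes.\<close>

lemma monotone_surjection_blocks:
  fixes \<beta> :: "nat \<Rightarrow> nat"
  assumes mono: "\<And>i j. i \<le> j \<Longrightarrow> j \<le> n \<Longrightarrow> \<beta> i \<le> \<beta> j" and surj: "\<beta> ` {..n} = {..<k}"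
  defines "B \<equiv> {j. j \<le> n \<and> (j < n \<longrightarrow> \<beta> (Suc j) \<noteq> \<beta> j)}"
  shows "\<beta> 0 = 0" "Suc (\<beta> n) = k" "\<And>j. j < n \<Longrightarrow> \<beta> (Suc j) \<noteq> \<beta> j \<Longrightarrow> \<beta> (Suc j) = Suc (\<beta> j)"
    "bij_betw \<beta> B {..<k}"
proof -
  have att: "\<exists>j\<le>n. \<beta> j = i" if "i < k" for i
  proof -
    have "i \<in> \<beta> ` {..n}" using that surj by simp
    then show ?thesis by auto
  qed
  have lt: "\<beta> j < k" if "j \<le> n" for j
  proof -
    have "\<beta> j \<in> \<beta> ` {..n}" using that by simp
    then show ?thesis using surj by simp
  qed
  show "\<beta> 0 = 0"
  proof -
    obtain j where "j \<le> n" "\<beta> j = 0" using att[of 0] lt[of 0] by auto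
    then show ?thesis using mono[of 0 j] by simp
  qed
  show "Suc (\<beta> n) = k"
  proof -
    obtain j where "j \<le> n" "\<beta> j = k - 1" using att[of "k - 1"] lt[of 0] by auto
    then show ?thesis using mono[of j n] lt[of n] by simp
  qed
  show step: "\<beta> (Suc j) = Suc (\<beta> j)" if "j < n" "\<beta> (Suc j) \<noteq> \<beta> j" for j
  proof (rule ccontr)
    assume "\<beta> (Suc j) \<noteq> Suc (\<beta> j)"
    then have gt: "Suc (\<beta> j) < \<beta> (Suc j)" using mono[of j "Suc j"] that by simp
    moreover have "\<beta> (Suc j) < k" using lt[of "Suc j"] that(1) by simp
    ultimately obtain i where i: "i \<le> n" "\<beta> i = Suc (\<beta> j)"
      using att[of "Suc (\<beta> j)"] by auto
    show False
    proof (cases "i \<le> j")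
      case True
      then show False using mono[of i j] i that(1) by simp
    next
      case False
      then show False using mono[of "Suc j" i] i gt by simp
    qed
  qed
  show "bij_betw \<beta> B {..<k}"
  proof (rule bij_betw_imageI)
    have "\<beta> i < \<beta> j" if "i \<in> B" "j \<in> B" "i < j" for i j
    proof -
      have "\<beta> (Suc i) = Suc (\<beta> i)" using that step[of i] by (auto simp: B_def)
      then show ?thesis using mono[of "Suc i" j] that by (auto simp: B_def)
    qed
    then show "inj_on \<beta> B" by (metis inj_onI linorder_neq_iff)
    show "\<beta> ` B = {..<k}"
    proof
      show "\<beta> ` B \<subseteq> {..<k}" using lt by (auto simp: B_def)
      show "{..<k} \<subseteq> \<beta> ` B"
      proof
        fix i assume "i \<in> {..<k}"
        then obtain j0 where j0: "j0 \<le> n" "\<beta> j0 = i" using att by auto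
        define j where "j = Max {j. j \<le> n \<and> \<beta> j = i}"
        have fin: "finite {j. j \<le> n \<and> \<beta> j = i}" by simp
        have "j \<in> {j. j \<le> n \<and> \<beta> j = i}"
          unfolding j_def using j0 by (intro Max_in[OF fin]) auto
        then have j: "j \<le> n" "\<beta> j = i" by simp_all
        have "\<beta> (Suc j) \<noteq> \<beta> j" if "j < n"
        proof
          assume "\<beta> (Suc j) = \<beta> j"
          then have "Suc j \<le> j" using Max_ge[OF fin, of "Suc j"] that j(2) unfolding j_def by simp
          then show False by simp
        qed
        then have "j \<in> B" using j by (simp add: B_def)
        then show "i \<in> \<beta> ` B" using j(2) by blast
      qed
    qed
  qed
qed

text \<open>
  Every colored cycle with \<open>s\<close> legs arises by collapsing edges of one with \<open>s\<close> vertices: list the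
  legs vertex by vertex along the cycle, and give the edges between legs at a common vertex the
  unused colors.
\<close>

lemma holocolored_expansion:
  assumes n2: "2 \<le> n" and Gc: "(G, c) \<in> holocolored_graphs (Suc n)"
  obtains \<rho> p where "\<rho> permutes {..n}" "p permutes {..n}"
    "inj_on (\<lambda>e. c e - 1) (edges G)" "(\<lambda>e. c e - 1) ` edges G \<subseteq> {..n}" "\<And>e. e \<in> edges G \<Longrightarrow> 1 \<le> c e"
    "\<And>W. W \<subseteq> edges G \<Longrightarrow> \<exists>f. graph_iso (Suc n) (collapse G W)
      (collapse (leg_graph n (cyc_ends n \<rho> p))
        (({..n} - (\<lambda>e. c e - 1) ` edges G) \<union> (\<lambda>e. c e - 1) ` W)) f (\<lambda>e. c e - 1)"
proof -
  let ?s = "Suc n"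
  let ?\<psi> = "\<lambda>e. c e - 1"
  have adm: "admissible ?s G" and betti: "first_betti G = 1" and c: "c \<in> holocolorings ?s G"
    using Gc by (auto simp: holocolored_graphs_def)
  interpret rank_one_graph ?s G by unfold_locales (fact adm betti)+
  have c_range: "c e \<in> {1..?s}" if "e \<in> edges G" for e
    using c that by (auto simp: holocolorings_def)
  have c_inj: "inj_on c (edges G)" using c by (simp add: holocolorings_def)
  have \<psi>_inj: "inj_on ?\<psi> (edges G)"
  proof (rule inj_onI)
    fix e e' assume e: "e \<in> edges G" "e' \<in> edges G" and "?\<psi> e = ?\<psi> e'"
    then have "c e = c e'" using c_range[OF e(1)] c_range[OF e(2)] by auto
    then show "e = e'" using inj_onD[OF c_inj] e by blast
  qed
  have \<psi>_range: "?\<psi> ` edges G \<subseteq> {..n}" using c_range by fastforce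
  obtain vs es where cyc: "is_cycle G vs es" and vs: "set vs = verts G" and es: "set es = edges G"
    using rank_one_is_cycle by blast
  define k where "k = length es"
  have k: "0 < k" "length vs = k" "length es = k" and dist: "distinct vs" "distinct es"
    and ends: "\<And>i. i < k \<Longrightarrow> ends G (es ! i) = {#vs ! i, vs ! ((i + 1) mod k)#}"
    using cyc by (auto simp: is_cycle_def k_def)
  have "\<exists>i<k. vs ! i = leg G a" if "a \<in> {1..?s}" for a
  proof -
    have "leg G a \<in> set vs" using that wf vs by (simp add: wf_graph_def)
    then show ?thesis using k(2) by (auto simp: in_set_conv_nth)
  qed
  then obtain g where g: "\<And>a. a \<in> {1..?s} \<Longrightarrow> g a < k \<and> vs ! g a = leg G a" by metis
  have g_surj: "g ` {1..?s} = {..<k}"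
  proof
    show "g ` {1..?s} \<subseteq> {..<k}" using g by auto
    show "{..<k} \<subseteq> g ` {1..?s}"
    proof
      fix i assume i: "i \<in> {..<k}"
      then have "vs ! i \<in> verts G" using vs k(2) by (metis lessThan_iff nth_mem)
      then obtain a where a: "a \<in> {1..?s}" "leg G a = vs ! i" using leg_at by blast
      then have "vs ! g a = vs ! i" "g a < k" using g[OF a(1)] by auto
      then have "g a = i" using dist(1) k(2) i by (simp add: nth_eq_iff_index_eq)
      then show "i \<in> g ` {1..?s}" using a(1) by blast
    qed
  qed
  \<comment> \<open>Sorting by the index of the vertex puts legs at a common vertex next to each
    other; their order within a block is immaterial.\<close>
  define L where "L = sort_key g [1..<Suc ?s]"
  have L: "length L = ?s" "set L = {1..?s}" "distinct L" "sorted (map g L)"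
    by (auto simp: L_def)
  have L_in: "L ! j \<in> {1..?s}" if "j \<le> n" for j using L(1,2) that nth_mem[of j L] by auto
  define p where "p j = (if j \<le> n then L ! j - 1 else j)" for j
  have Sp: "Suc (p j) = L ! j" if "j \<le> n" for j using L_in[OF that] that by (simp add: p_def)
  have p: "p permutes {..n}"
  proof (rule bij_imp_permutes)
    show "bij_betw p {..n} {..n}"
    proof (rule bij_betw_imageI)
      show inj: "inj_on p {..n}"
      proof (rule inj_onI)
        fix i j assume ij: "i \<in> {..n}" "j \<in> {..n}" "p i = p j"
        then have "L ! i = L ! j" using Sp[of i] Sp[of j] by simp
        then show "i = j" using L(1,3) ij by (simp add: nth_eq_iff_index_eq)
      qed
      have "p ` {..n} \<subseteq> {..n}"
      proof
        fix x assume "x \<in> p ` {..n}"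
        then obtain j where "j \<le> n" "x = p j" by auto
        then show "x \<in> {..n}" using Sp[of j] L_in[of j] by auto
      qed
      then show "p ` {..n} = {..n}" by (intro card_subset_eq) (simp_all add: card_image[OF inj])
    qed
  qed (simp add: p_def)
  define \<beta> where "\<beta> j = g (L ! j)" for j
  have \<beta>_mono: "\<beta> i \<le> \<beta> j" if "i \<le> j" "j \<le> n" for i j
    using sorted_nth_mono[OF L(4), of i j] that L(1) by (simp add: \<beta>_def)
  have \<beta>_surj: "\<beta> ` {..n} = {..<k}"
  proof -
    have "(!) L ` {..n} = set L" using L(1) by (auto simp: set_conv_nth less_Suc_eq_le)
    then have "\<beta> ` {..n} = g ` set L" unfolding \<beta>_def by (metis image_image)
    then show ?thesis using L(2) g_surj by simp
  qed
  define B where "B = {j. j \<le> n \<and> (j < n \<longrightarrow> \<beta> (Suc j) \<noteq> \<beta> j)}"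
  note blocks = monotone_surjection_blocks[OF \<beta>_mono \<beta>_surj, folded B_def]
  \<comment> \<open>At the end of a block, the edge to the next position is the original edge to the
    next vertex and keeps its color, shifted to start at \<open>0\<close>.\<close>
  define d where "d j = ?\<psi> (es ! \<beta> j)" for j
  have esb: "bij_betw (\<lambda>j. es ! \<beta> j) B (edges G)"
  proof -
    have "bij_betw ((!) es) {..<k} (edges G)"
      using bij_betw_nth[OF dist(2)] k(3) es by auto
    then show ?thesis using bij_betw_trans[OF blocks(4)] by (simp add: comp_def)
  qed
  have \<psi>_bij: "bij_betw ?\<psi> (edges G) (?\<psi> ` edges G)" using \<psi>_inj by (rule inj_on_imp_bij_betw)
  have d_bij: "bij_betw d B (?\<psi> ` edges G)"
    using bij_betw_trans[OF esb \<psi>_bij] by (simp add: comp_def d_def[abs_def])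
  have Bn: "B \<subseteq> {..n}" by (auto simp: B_def)
  have dB: "d ` B \<subseteq> {..n}" using bij_betw_imp_surj_on[OF d_bij] \<psi>_range by simp
  obtain \<rho> where \<rho>: "\<rho> permutes {..n}" "\<And>j. j \<in> B \<Longrightarrow> \<rho> j = d j"
    using extend_to_permutation[OF finite_atMost Bn bij_betw_imp_inj_on[OF d_bij] dB] by blast
  interpret cg: cycle_graph n \<rho> p by unfold_locales (fact n2 \<rho>(1) p)+
  have \<rho>B: "\<rho> j \<in> ?\<psi> ` edges G \<longleftrightarrow> j \<in> B" if "j \<le> n" for j
  proof -
    have "\<rho> ` B = ?\<psi> ` edges G"
      using bij_betw_imp_surj_on[OF d_bij] \<rho>(2) by (metis image_cong)
    then show ?thesis using cg.\<rho>_eq by (metis imageE imageI)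
  qed
  let ?Z = "{..n} - ?\<psi> ` edges G"
  have legv: "leg G (cg.v j) = vs ! \<beta> j" if "j \<le> n" for j
    using g[OF L_in[OF that]] Sp[OF that] by (simp add: \<beta>_def)
  have \<beta>k: "\<beta> j < k" if "j \<le> n" for j
    using \<beta>_surj that by (metis atMost_iff imageI lessThan_iff)
  have leg_eq: "leg G (cg.v i) = leg G (cg.v j) \<longleftrightarrow> \<beta> i = \<beta> j" if "i \<le> n" "j \<le> n" for i j
    using legv that \<beta>k dist(1) k(2) by (simp add: nth_eq_iff_index_eq)
  have chain: "(cg.v i, cg.v j) \<in> joined cg.G ?Z" if "i \<le> j" "j \<le> n" "\<beta> i = \<beta> j" for i j
    using that
  proof (induction j rule: dec_induct)
    case base
    then show ?case using cg.v_verts[of i] by (simp add: joined_refl)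
  next
    case (step j)
    have eq: "\<beta> i = \<beta> j" "\<beta> (Suc j) = \<beta> j"
      using \<beta>_mono[of i j] \<beta>_mono[of j "Suc j"] step.prems step.hyps by auto
    have "j \<notin> B" using eq(2) step.prems(1) by (simp add: B_def)
    then have "\<rho> j \<in> ?Z" using \<rho>B[of j] cg.\<rho>_le[of j] step.prems(1) by auto
    then have "(cg.v j, cg.v (Suc j)) \<in> joined cg.G ?Z"
      using cg.E_at[of j] cg.v_verts[of j] cg.v_verts[of "Suc j"] step.prems(1)
      by (intro joined_edge[where e = "\<rho> j"]) (simp_all add: nx_def)
    moreover have "(cg.v i, cg.v j) \<in> joined cg.G ?Z" using step.IH step.prems(1) eq(1) by simp
    ultimately show ?case using transD[OF trans_joined] by metis
  qed
  have iso: "\<exists>f. graph_iso ?s (collapse G W) (collapse cg.G (?Z \<union> ?\<psi> ` W)) f ?\<psi>" if W: "W \<subseteq> edges G" for W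
  proof (rule exI, rule graph_iso_contraction[where F = "leg G"])
    show "wf_graph ?s cg.G" by (rule cg.wf_cycle_graph)
    show "wf_graph ?s G" by (rule wf)
    show "?Z \<subseteq> edges cg.G" by auto
    show "leg G ` verts cg.G = verts G"
      using leg_at wf by (auto simp: wf_graph_def image_iff)
    show "leg G u = leg G w \<longleftrightarrow> (u, w) \<in> joined cg.G ?Z" if uw: "u \<in> verts cg.G" "w \<in> verts cg.G" for u w
    proof -
      obtain i j where ij: "i \<le> n" "u = cg.v i" "j \<le> n" "w = cg.v j"
        using cg.vertex_at uw by (metis leg_graph_simps(1))
      show ?thesis
      proof
        assume "leg G u = leg G w"
        then have eq: "\<beta> i = \<beta> j" using leg_eq ij by simp
        show "(u, w) \<in> joined cg.G ?Z"
        proof (cases "i \<le> j")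
          case True
          then show ?thesis using chain[OF True ij(3) eq] ij by simp
        next
          case False
          then have "(w, u) \<in> joined cg.G ?Z" using chain[of j i] eq ij by simp
          then show ?thesis by (rule symD[OF sym_joined])
        qed
      next
        assume uw: "(u, w) \<in> joined cg.G ?Z"
        show "leg G u = leg G w"
        proof (rule joined_subset[OF _ _ _ _ uw])
          fix e u w assume e: "e \<in> ?Z" "ends cg.G e = {#u, w#}"
          obtain j where j: "j \<le> n" "e = \<rho> j" using cg.color_at[of e] e(1) by auto
          then have "j \<notin> B" using \<rho>B[OF j(1)] e(1) by blast
          then have jn: "j < n" "\<beta> (Suc j) = \<beta> j" using j(1) by (auto simp: B_def)
          have "{#u, w#} = {#cg.v j, cg.v (Suc j)#}"
            using e(2) cg.E_at[OF j(1)] j(2) jn(1) by (simp add: nx_def)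
          moreover have "leg G (cg.v j) = leg G (cg.v (Suc j))" using leg_eq[of j "Suc j"] jn by simp
          ultimately show "leg G u = leg G w" unfolding pair_mset_eq_iff by metis
        next
          show "set_mset (ends cg.G e) \<subseteq> verts cg.G" if "e \<in> ?Z" for e
            using that cg.E_verts[of e] by simp
        qed simp_all
      qed
    qed
    show "bij_betw ?\<psi> (edges G) (edges cg.G - ?Z)"
      using \<psi>_bij \<psi>_range by (simp add: Diff_Diff_Int Int_absorb1)
    show "ends G e = image_mset (leg G) (ends cg.G (?\<psi> e))" if e: "e \<in> edges G" for e
    proof -
      obtain j where j: "j \<in> B" "e = es ! \<beta> j" using bij_betw_imp_surj_on[OF esb] e by blast
      have jn: "j \<le> n" using j(1) Bn by auto
      have next_vertex: "\<beta> (nx n j) = (\<beta> j + 1) mod k"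
      proof (cases "j = n")
        case True
        then show ?thesis using blocks(1,2) by (simp add: nx_def)
      next
        case False
        then have "\<beta> (Suc j) = Suc (\<beta> j)" using j(1) blocks(3)[of j] by (auto simp: B_def)
        moreover have "\<beta> (Suc j) < k" using \<beta>k[of "Suc j"] False jn by simp
        ultimately show ?thesis using False by (simp add: nx_def)
      qed
      have "image_mset (leg G) (ends cg.G (?\<psi> e)) = image_mset (leg G) (cg.E (\<rho> j))"
        using \<rho>(2)[OF j(1)] j(2) by (simp add: d_def)
      also have "\<dots> = {#vs ! \<beta> j, vs ! \<beta> (nx n j)#}"
        using cg.E_at[OF jn] legv[OF jn] legv[OF nx_le[OF jn]] by simp
      also have "\<dots> = ends G e" using ends[OF \<beta>k[OF jn]] j(2) next_vertex by simp
      finally show ?thesis by simp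
    qed
    show "leg G i = leg G (leg cg.G i)" for i by simp
    show "W \<subseteq> edges G" by (rule W)
  qed
  have c1: "1 \<le> c e" if "e \<in> edges G" for e using c_range[OF that] by simp
  show thesis by (rule that[OF \<rho>(1) p \<psi>_inj \<psi>_range c1 iso])
qed

text \<open>The index set consists of the incidence functions and not of the pairs
  \<open>(\<rho>, p)\<close>: pairs that differ by a rotation or reflection of the positions
  describe the same graph and give the same function.\<close>

definition top_gluings :: "nat \<Rightarrow> (nat \<Rightarrow> nat multiset) set" where
  "top_gluings n = {cyc_ends n \<rho> p | \<rho> p. \<rho> permutes {..n} \<and> p permutes {..n}}"

definition glue :: "nat \<Rightarrow> (nat \<Rightarrow> nat multiset) \<Rightarrow> (nat \<Rightarrow> real) \<Rightarrow> metric_graph set" where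
  "glue n E t = mhg_rel (Suc n) `` {leg_metric_graph n E t}"

lemma finite_top_gluings: "finite (top_gluings n)"
proof -
  have "top_gluings n = (\<lambda>(\<rho>, p). cyc_ends n \<rho> p) ` ({\<rho>. \<rho> permutes {..n}} \<times> {p. p permutes {..n}})"
    by (auto simp: top_gluings_def)
  then show ?thesis by (simp add: finite_permutations)
qed

lemma top_gluingsE:
  assumes "2 \<le> n" "E \<in> top_gluings n"
  obtains \<rho> p where "cycle_graph n \<rho> p" "E = cyc_ends n \<rho> p"
  using assms by (auto simp: top_gluings_def cycle_graph_def)

lemma topspace_metric_simplex:
  "topspace (metric_simplex G) = {l \<in> regular_metrics G. (\<Sum>e\<in>edges G. l e) = 1}"
  by (auto simp: metric_simplex_def regular_metrics_def)

lemma continuous_map_edge_length: "e \<in> edges G \<Longrightarrow> continuous_map (metric_simplex G) euclideanreal (\<lambda>l. l e)"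
  unfolding metric_simplex_def
  by (intro continuous_map_from_subtopology continuous_map_product_projection)

lemma holocolored_factor:
  assumes n2: "2 \<le> n" and Gc: "(G, c) \<in> holocolored_graphs (Suc n)"
  obtains E \<tau> where "E \<in> top_gluings n" "continuous_map (metric_simplex G) (simplex_space n) \<tau>"
    "\<And>l. l \<in> topspace (metric_simplex G) \<Longrightarrow> mhg_rel (Suc n) `` {(G, l, c)} = glue n E (\<tau> l)"
proof -
  obtain \<rho> p where \<rho>: "\<rho> permutes {..n}" and p: "p permutes {..n}"
    and inj: "inj_on (\<lambda>e. c e - 1) (edges G)" and range: "(\<lambda>e. c e - 1) ` edges G \<subseteq> {..n}"
    and c1: "\<And>e. e \<in> edges G \<Longrightarrow> 1 \<le> c e"
    and iso: "\<And>W. W \<subseteq> edges G \<Longrightarrow> \<exists>f. graph_iso (Suc n) (collapse G W)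
      (collapse (leg_graph n (cyc_ends n \<rho> p))
        (({..n} - (\<lambda>e. c e - 1) ` edges G) \<union> (\<lambda>e. c e - 1) ` W)) f (\<lambda>e. c e - 1)"
    using holocolored_expansion[OF n2 Gc] by metis
  let ?\<psi> = "\<lambda>e. c e - 1" and ?E = "cyc_ends n \<rho> p"
  interpret cg: cycle_graph n \<rho> p by unfold_locales (fact n2 \<rho> p)+
  have wf: "wf_graph (Suc n) G" using Gc by (simp add: holocolored_graphs_def admissible_def)
  define \<tau> where "\<tau> l k = (if k \<in> ?\<psi> ` edges G then l (inv_into (edges G) ?\<psi> k) else 0)"
    for l :: "nat \<Rightarrow> real" and k
  have \<tau>\<psi>: "\<tau> l (?\<psi> e) = l e" if "e \<in> edges G" for l e
    using that inv_into_f_f[OF inj that] by (simp add: \<tau>_def)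
  have \<tau>_simplex: "\<tau> l \<in> standard_simplex n" if l: "l \<in> topspace (metric_simplex G)" for l
  proof (rule simplexI[OF _ _ range])
    have "\<forall>e\<in>edges G. 0 \<le> l e" using l by (auto simp: topspace_metric_simplex regular_metrics_def)
    then show "0 \<le> \<tau> l k" for k using \<tau>\<psi> by (cases "k \<in> ?\<psi> ` edges G") (auto simp: \<tau>_def inv_into_into)
    show "support (\<tau> l) \<subseteq> ?\<psi> ` edges G" by (auto simp: support_def \<tau>_def)
    have "sum (\<tau> l) (?\<psi> ` edges G) = (\<Sum>e\<in>edges G. \<tau> l (?\<psi> e))"
      by (rule sum.reindex[OF inj, unfolded comp_def])
    also have "\<dots> = (\<Sum>e\<in>edges G. l e)" by (rule sum.cong[OF refl \<tau>\<psi>])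
    finally have "sum (\<tau> l) (?\<psi> ` edges G) = (\<Sum>e\<in>edges G. l e)" .
    then show "sum (\<tau> l) (?\<psi> ` edges G) = 1" using l by (simp add: topspace_metric_simplex)
  qed
  show thesis
  proof (rule that)
    show "?E \<in> top_gluings n" using \<rho> p by (auto simp: top_gluings_def)
    have "continuous_map (metric_simplex G) euclideanreal (\<lambda>l. \<tau> l k)" for k
    proof (cases "k \<in> ?\<psi> ` edges G")
      case True
      then have "inv_into (edges G) ?\<psi> k \<in> edges G" by (rule inv_into_into)
      from continuous_map_edge_length[OF this] show ?thesis using True by (simp add: \<tau>_def)
    next
      case False
      then show ?thesis by (simp add: \<tau>_def)
    qed
    then have "continuous_map (metric_simplex G) (powertop_real UNIV) \<tau>"
      by (simp add: continuous_map_componentwise_UNIV)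
    then show "continuous_map (metric_simplex G) (simplex_space n) \<tau>"
      using \<tau>_simplex by (simp add: continuous_map_in_subtopology Pi_iff)
  next
    fix l assume l: "l \<in> topspace (metric_simplex G)"
    let ?t = "\<tau> l"
    note t = \<tau>_simplex[OF l]
    have mem: "(G, l, c) \<in> holocolored_metric_graphs (Suc n)"
      using Gc l by (simp add: holocolored_metric_graphs_def topspace_metric_simplex)
    have mem': "leg_metric_graph n ?E ?t \<in> holocolored_metric_graphs (Suc n)"
      by (rule cg.leg_metric_graph_in[OF t])
    have zeros: "{..n} - support ?t = ({..n} - ?\<psi> ` edges G) \<union> ?\<psi> ` zeros G l"
    proof (intro equalityI subsetI)
      fix k assume k: "k \<in> {..n} - support ?t"
      show "k \<in> ({..n} - ?\<psi> ` edges G) \<union> ?\<psi> ` zeros G l"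
      proof (cases "k \<in> ?\<psi> ` edges G")
        case True
        then obtain e where e: "e \<in> edges G" "k = ?\<psi> e" by blast
        then have "l e = 0" using k \<tau>\<psi>[OF e(1)] by (simp add: support_def)
        then have "e \<in> zeros G l" using e(1) by (simp add: zeros_def)
        then show ?thesis using e(2) by blast
      next
        case False
        then show ?thesis using k by blast
      qed
    next
      fix k assume "k \<in> ({..n} - ?\<psi> ` edges G) \<union> ?\<psi> ` zeros G l"
      then consider "k \<in> {..n}" "k \<notin> ?\<psi> ` edges G" | e where "e \<in> zeros G l" "k = ?\<psi> e" by blast
      then show "k \<in> {..n} - support ?t"
      proof cases
        case 1
        then show ?thesis by (simp add: support_def \<tau>_def)
      next
        case 2
        then have "e \<in> edges G" "l e = 0" by (auto simp: zeros_def)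
        then show ?thesis using 2(2) \<tau>\<psi>[of e l] range by (auto simp: support_def)
      qed
    qed
    have "zeros G l \<subseteq> edges G" by (auto simp: zeros_def)
    then obtain f where f: "graph_iso (Suc n) (collapse G (zeros G l))
        (collapse (leg_graph n ?E) (zeros (leg_graph n ?E) (restrict ?t {..n}))) f ?\<psi>"
      using iso unfolding zeros_leg_graph zeros by blast
    have "restrict ?t {..n} (?\<psi> e) = 1 * l e \<and> restrict Suc {..n} (?\<psi> e) = c e" if "e \<in> edges G" for e
    proof -
      have "?\<psi> e \<in> {..n}" using range that by blast
      then show ?thesis using \<tau>\<psi>[OF that] c1[OF that] by simp
    qed
    then have "\<forall>e\<in>edges G - zeros G l. restrict ?t {..n} (?\<psi> e) = 1 * l e \<and> restrict Suc {..n} (?\<psi> e) = c e"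
      by blast
    then have "\<exists>f \<phi> a. graph_iso (Suc n) (collapse G (zeros G l))
        (collapse (leg_graph n ?E) (zeros (leg_graph n ?E) (restrict ?t {..n}))) f \<phi> \<and> 0 < a \<and>
        (\<forall>e\<in>edges G - zeros G l. restrict ?t {..n} (\<phi> e) = a * l e \<and> restrict Suc {..n} (\<phi> e) = c e)"
      using f zero_less_one by blast
    then have "((G, l, c), leg_metric_graph n ?E ?t) \<in> mhg_rel (Suc n)"
      using mem mem' unfolding mhg_rel_def leg_metric_graph_def by simp
    then show "mhg_rel (Suc n) `` {(G, l, c)} = glue n ?E ?t"
      unfolding glue_def by (rule equiv_class_eq[OF equiv_mhg_rel])
  qed
qed

lemma openin_discrete_prod:
  "openin (prod_topology (discrete_topology I) Y) S \<longleftrightarrow>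
    S \<subseteq> I \<times> topspace Y \<and> (\<forall>i\<in>I. openin Y {y. (i, y) \<in> S})"
proof
  assume S: "openin (prod_topology (discrete_topology I) Y) S"
  then have sub: "S \<subseteq> I \<times> topspace Y" using openin_subset by fastforce
  have "openin Y {y. (i, y) \<in> S}" if "i \<in> I" for i
  proof -
    have "continuous_map Y (prod_topology (discrete_topology I) Y) (\<lambda>y. (i, y))"
      using that by (intro continuous_map_pairedI) auto
    from openin_continuous_map_preimage[OF this S]
    have "openin Y {y \<in> topspace Y. (i, y) \<in> S}" .
    moreover have "{y \<in> topspace Y. (i, y) \<in> S} = {y. (i, y) \<in> S}" using sub by blast
    ultimately show ?thesis by simp
  qed
  with sub show "S \<subseteq> I \<times> topspace Y \<and> (\<forall>i\<in>I. openin Y {y. (i, y) \<in> S})" by blast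
next
  assume S: "S \<subseteq> I \<times> topspace Y \<and> (\<forall>i\<in>I. openin Y {y. (i, y) \<in> S})"
  show "openin (prod_topology (discrete_topology I) Y) S"
    unfolding openin_prod_topology_alt
  proof (intro allI impI)
    fix i y assume iy: "(i, y) \<in> S"
    then have "i \<in> I" using S by blast
    then show "\<exists>U V. openin (discrete_topology I) U \<and> openin Y V \<and> i \<in> U \<and> y \<in> V \<and> U \<times> V \<subseteq> S"
      using S iy by (intro exI[of _ "{i}"] exI[of _ "{y. (i, y) \<in> S}"]) auto
  qed
qed

text \<open>The top simplices occur among the summands defining \<open>MHG1\<close>, and every other
  summand maps continuously into a top simplex over the quotient. So openness can be tested on the
  finitely many top simplices.\<close>

theorem quotient_map_glue:
  assumes n2: "2 \<le> n"
  shows "quotient_map (prod_topology (discrete_topology (top_gluings n)) (simplex_space n))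
    (MHG1 (Suc n)) (\<lambda>(E, t). glue n E t)"
proof -
  let ?S = "sum_topology (\<lambda>(G, c). metric_simplex G) (holocolored_graphs (Suc n))"
  let ?qq = "\<lambda>((G, c), l). mhg_rel (Suc n) `` {(G, l, c)}"
  have MHG: "MHG1 (Suc n) = quotient_space ?S ?qq" by (simp add: MHG1_def)
  have topS: "((G, c), l) \<in> topspace ?S \<longleftrightarrow> (G, c) \<in> holocolored_graphs (Suc n) \<and> l \<in> topspace (metric_simplex G)" for G c l
    by auto
  have top: "topspace (MHG1 (Suc n)) = ?qq ` topspace ?S"
    unfolding MHG by (rule topspace_quotient_space)
  have cont: "continuous_map (simplex_space n) (metric_simplex (leg_graph n E)) (\<lambda>t. restrict t {..n})"
    and holo: "(leg_graph n E, restrict Suc {..n}) \<in> holocolored_graphs (Suc n)" if in_I: "E \<in> top_gluings n" for E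
  proof -
    obtain \<rho> p where "cycle_graph n \<rho> p" and E: "E = cyc_ends n \<rho> p" by (rule top_gluingsE[OF n2 in_I])
    then interpret cg: cycle_graph n \<rho> p by simp
    show "(leg_graph n E, restrict Suc {..n}) \<in> holocolored_graphs (Suc n)"
      unfolding E by (rule cg.holocolored_cycle_graph)
    have "continuous_map (simplex_space n) (product_topology (\<lambda>_. euclideanreal) {..n}) (\<lambda>t. restrict t {..n})"
      unfolding continuous_map_componentwise using continuous_map_coordinate by auto
    moreover have "restrict t {..n} \<in> regular_metrics (leg_graph n E) \<and> (\<Sum>e\<in>{..n}. restrict t {..n} e) = 1"
      if "t \<in> standard_simplex n" for t
      using cg.regular_cycle_graph[OF that] that unfolding E by (simp add: standard_simplex_def)
    ultimately show "continuous_map (simplex_space n) (metric_simplex (leg_graph n E)) (\<lambda>t. restrict t {..n})"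
      unfolding metric_simplex_def by (simp add: continuous_map_in_subtopology Pi_iff)
  qed
  have glue_qq: "glue n E t = ?qq ((leg_graph n E, restrict Suc {..n}), restrict t {..n})" for E t
    by (simp add: glue_def leg_metric_graph_def)
  have restrict_in: "restrict t {..n} \<in> topspace (metric_simplex (leg_graph n E))"
    if "E \<in> top_gluings n" "t \<in> standard_simplex n" for E t
    using continuous_map_image_subset_topspace[OF cont[OF that(1)]] that(2) by auto
  show ?thesis
    unfolding quotient_map_def
  proof (intro conjI allI impI)
    show "(\<lambda>(E, t). glue n E t) ` topspace (prod_topology (discrete_topology (top_gluings n)) (simplex_space n))
        = topspace (MHG1 (Suc n))"
    proof (intro equalityI subsetI)
      fix x assume "x \<in> (\<lambda>(E, t). glue n E t) ` topspace (prod_topology (discrete_topology (top_gluings n)) (simplex_space n))"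
      then obtain E t where Et: "E \<in> top_gluings n" "t \<in> standard_simplex n" "x = glue n E t" by auto
      then have "((leg_graph n E, restrict Suc {..n}), restrict t {..n}) \<in> topspace ?S"
        using topS holo restrict_in by blast
      then show "x \<in> topspace (MHG1 (Suc n))" unfolding top Et(3) glue_qq by (rule imageI)
    next
      fix x assume "x \<in> topspace (MHG1 (Suc n))"
      then obtain z where z: "z \<in> topspace ?S" "x = ?qq z" unfolding top by blast
      obtain G c l where zz: "z = ((G, c), l)" by (cases z) auto
      have Gc: "(G, c) \<in> holocolored_graphs (Suc n)" and l: "l \<in> topspace (metric_simplex G)"
        using z(1) topS unfolding zz by blast+
      obtain E \<tau> where E: "E \<in> top_gluings n" and \<tau>: "continuous_map (metric_simplex G) (simplex_space n) \<tau>"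
        and eq: "\<And>l. l \<in> topspace (metric_simplex G) \<Longrightarrow> mhg_rel (Suc n) `` {(G, l, c)} = glue n E (\<tau> l)"
        using holocolored_factor[OF n2 Gc] by metis
      have "\<tau> l \<in> standard_simplex n" using continuous_map_image_subset_topspace[OF \<tau>] l by auto
      moreover have "x = glue n E (\<tau> l)" using eq[OF l] z(2) zz by simp
      ultimately show "x \<in> (\<lambda>(E, t). glue n E t) ` topspace (prod_topology (discrete_topology (top_gluings n)) (simplex_space n))"
        using E by (intro image_eqI[of _ _ "(E, \<tau> l)"]) auto
    qed
  next
    fix U assume U: "U \<subseteq> topspace (MHG1 (Suc n))"
    have L: "openin (prod_topology (discrete_topology (top_gluings n)) (simplex_space n))
          {x \<in> topspace (prod_topology (discrete_topology (top_gluings n)) (simplex_space n)). (case x of (E, t) \<Rightarrow> glue n E t) \<in> U}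
        \<longleftrightarrow> (\<forall>E\<in>top_gluings n. openin (simplex_space n) {t \<in> standard_simplex n. glue n E t \<in> U})"
      unfolding openin_discrete_prod by (auto cong: conj_cong)
    have R: "openin (MHG1 (Suc n)) U
        \<longleftrightarrow> (\<forall>(G, c)\<in>holocolored_graphs (Suc n). openin (metric_simplex G)
            {l \<in> topspace (metric_simplex G). mhg_rel (Suc n) `` {(G, l, c)} \<in> U})"
      using U unfolding MHG openin_quotient_space openin_sum_topology top[unfolded MHG]
      by (auto simp: split_beta cong: conj_cong)
    have "(\<forall>E\<in>top_gluings n. openin (simplex_space n) {t \<in> standard_simplex n. glue n E t \<in> U})
        \<longleftrightarrow> (\<forall>(G, c)\<in>holocolored_graphs (Suc n). openin (metric_simplex G)
            {l \<in> topspace (metric_simplex G). mhg_rel (Suc n) `` {(G, l, c)} \<in> U})"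
    proof
      assume *: "\<forall>E\<in>top_gluings n. openin (simplex_space n) {t \<in> standard_simplex n. glue n E t \<in> U}"
      show "\<forall>(G, c)\<in>holocolored_graphs (Suc n). openin (metric_simplex G)
            {l \<in> topspace (metric_simplex G). mhg_rel (Suc n) `` {(G, l, c)} \<in> U}"
      proof (rule ballI, rule case_prodI2)
        fix Gc G c assume "Gc \<in> holocolored_graphs (Suc n)" "Gc = (G, c)"
        then have Gc: "(G, c) \<in> holocolored_graphs (Suc n)" by simp
        obtain E \<tau> where E: "E \<in> top_gluings n" and \<tau>: "continuous_map (metric_simplex G) (simplex_space n) \<tau>"
          and eq: "\<And>l. l \<in> topspace (metric_simplex G) \<Longrightarrow> mhg_rel (Suc n) `` {(G, l, c)} = glue n E (\<tau> l)"
          using holocolored_factor[OF n2 Gc] by metis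
        have "\<tau> l \<in> standard_simplex n" if "l \<in> topspace (metric_simplex G)" for l
          using continuous_map_image_subset_topspace[OF \<tau>] that by auto
        then have "{l \<in> topspace (metric_simplex G). mhg_rel (Suc n) `` {(G, l, c)} \<in> U}
            = {l \<in> topspace (metric_simplex G). \<tau> l \<in> {t \<in> standard_simplex n. glue n E t \<in> U}}"
          using eq by auto
        then show "openin (metric_simplex G) {l \<in> topspace (metric_simplex G). mhg_rel (Suc n) `` {(G, l, c)} \<in> U}"
          using openin_continuous_map_preimage[OF \<tau> *[rule_format, OF E]] by (simp only:)
      qed
    next
      assume *: "\<forall>(G, c)\<in>holocolored_graphs (Suc n). openin (metric_simplex G)
            {l \<in> topspace (metric_simplex G). mhg_rel (Suc n) `` {(G, l, c)} \<in> U}"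
      show "\<forall>E\<in>top_gluings n. openin (simplex_space n) {t \<in> standard_simplex n. glue n E t \<in> U}"
      proof
        fix E assume E: "E \<in> top_gluings n"
        let ?G = "leg_graph n E" and ?c = "restrict Suc {..n}"
        have "openin (metric_simplex ?G) {l \<in> topspace (metric_simplex ?G). mhg_rel (Suc n) `` {(?G, l, ?c)} \<in> U}"
          using bspec[OF * holo[OF E]] by simp
        from openin_continuous_map_preimage[OF cont[OF E] this]
        have "openin (simplex_space n) {t \<in> standard_simplex n. restrict t {..n} \<in>
            {l \<in> topspace (metric_simplex ?G). mhg_rel (Suc n) `` {(?G, l, ?c)} \<in> U}}"
          unfolding topspace_standard_simplex .
        moreover have "{t \<in> standard_simplex n. restrict t {..n} \<in>
            {l \<in> topspace (metric_simplex ?G). mhg_rel (Suc n) `` {(?G, l, ?c)} \<in> U}}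
          = {t \<in> standard_simplex n. glue n E t \<in> U}"
          using restrict_in[OF E] by (auto simp: glue_def leg_metric_graph_def)
        ultimately show "openin (simplex_space n) {t \<in> standard_simplex n. glue n E t \<in> U}" by (simp only:)
      qed
    qed
    then show "openin (prod_topology (discrete_topology (top_gluings n)) (simplex_space n))
          {x \<in> topspace (prod_topology (discrete_topology (top_gluings n)) (simplex_space n)). (case x of (E, t) \<Rightarrow> glue n E t) \<in> U}
        \<longleftrightarrow> openin (MHG1 (Suc n)) U"
      unfolding L R .
  qed
qed

lemma same_collapse_top:
  assumes E: "cycle_graph n \<rho> p" and E': "cycle_graph n \<rho>' p'"
    and same: "same_collapse n {..n} (cyc_ends n \<rho> p) (cyc_ends n \<rho>' p')"
  shows "cyc_ends n \<rho> p = cyc_ends n \<rho>' p'"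
proof -
  interpret A: cycle_graph n \<rho> p by (rule E)
  interpret B: cycle_graph n \<rho>' p' by (rule E')
  show ?thesis
  proof (rule extensionalityI[OF A.E_extensional B.E_extensional])
    fix e assume e: "e \<in> {..n}"
    obtain u v where uv: "A.E e = {#u, v#}"
      by (rule wf_ends[OF A.wf_cycle_graph, of e]) (use e in auto)
    obtain u' v' where uv': "B.E e = {#u', v'#}" "(u, u') \<in> joined A.G ({..n} - {..n})"
      "(v, v') \<in> joined A.G ({..n} - {..n})"
      by (rule same_collapse_ends[OF A.wf_cycle_graph B.wf_cycle_graph same _ e uv]) (use e in auto)
    then have "u = u'" "v = v'" by (auto simp: joined_def)
    then show "A.E e = B.E e" using uv uv'(1) by simp
  qed
qed

theorem simplex_gluing_MHG1:
  assumes n2: "2 \<le> n"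
  shows "simplex_gluing_top n (MHG1 (Suc n)) (top_gluings n) (same_collapse n) (glue n)"
proof unfold_locales
  show "finite (top_gluings n)" by (rule finite_top_gluings)
  show "quotient_map (prod_topology (discrete_topology (top_gluings n)) (simplex_space n)) (MHG1 (Suc n)) (\<lambda>(i, t). glue n i t)"
    by (rule quotient_map_glue[OF n2])
  show "glue n E t = glue n E' u \<longleftrightarrow> t = u \<and> same_collapse n (support t) E E'"
    if "E \<in> top_gluings n" "E' \<in> top_gluings n" "t \<in> standard_simplex n" "u \<in> standard_simplex n" for E E' t u
  proof -
    note in_I = that(1,2)
    obtain \<rho> p where A: "cycle_graph n \<rho> p" "E = cyc_ends n \<rho> p" by (rule top_gluingsE[OF n2 in_I(1)])
    obtain \<rho>' p' where B: "cycle_graph n \<rho>' p'" "E' = cyc_ends n \<rho>' p'" by (rule top_gluingsE[OF n2 in_I(2)])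
    show ?thesis unfolding glue_def A(2) B(2) by (rule mhg_class_eq_iff[OF A(1) B(1) that(3,4)])
  qed
  show "same_collapse n C E E'"
    if "E \<in> top_gluings n" "E' \<in> top_gluings n" "C \<subseteq> D" "same_collapse n D E E'" for E E' C D
  proof -
    note in_I = that(1,2)
    obtain \<rho> p where A: "cycle_graph n \<rho> p" "E = cyc_ends n \<rho> p" by (rule top_gluingsE[OF n2 in_I(1)])
    obtain \<rho>' p' where B: "cycle_graph n \<rho>' p'" "E' = cyc_ends n \<rho>' p'" by (rule top_gluingsE[OF n2 in_I(2)])
    show ?thesis
      using same_collapse_antimono[OF cycle_graph.wf_cycle_graph[OF A(1)] cycle_graph.wf_cycle_graph[OF B(1)]] that(3,4)
      unfolding A(2) B(2) by blast
  qed
  show "0 < n" using n2 by simp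
  show "E = E'" if "E \<in> top_gluings n" "E' \<in> top_gluings n" "same_collapse n {..n} E E'" for E E'
  proof -
    note in_I = that(1,2)
    obtain \<rho> p where A: "cycle_graph n \<rho> p" "E = cyc_ends n \<rho> p" by (rule top_gluingsE[OF n2 in_I(1)])
    obtain \<rho>' p' where B: "cycle_graph n \<rho>' p'" "E' = cyc_ends n \<rho>' p'" by (rule top_gluingsE[OF n2 in_I(2)])
    show ?thesis using same_collapse_top[OF A(1) B(1)] that(3) unfolding A(2) B(2) by blast
  qed
qed

section \<open>Facets and adjacent transpositions of legs\<close>

abbreviation (input) swap :: "nat \<Rightarrow> nat \<Rightarrow> nat \<Rightarrow> nat" where
  "swap \<equiv> Transposition.transpose"

lemma joined_cong:
  assumes "verts G = verts H" "\<And>e. e \<in> F \<Longrightarrow> ends G e = ends H e"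
  shows "joined G F = joined H F"
proof -
  have "{(u, v). \<exists>e\<in>F. ends G e = {#u, v#}} = {(u, v). \<exists>e\<in>F. ends H e = {#u, v#}}"
    using assms(2) by auto
  then show ?thesis by (simp add: joined_def assms(1))
qed

context cycle_graph
begin

lemma cycle_graph_swap: "i \<le> n \<Longrightarrow> cycle_graph n \<rho> (p \<circ> swap i (nx n i))"
  using n2 \<rho> p nx_le[of i n] by unfold_locales (auto intro: permutes_compose permutes_swap_id)

lemma two_edges_at:
  assumes "w \<in> {1..Suc n}"
  shows "\<exists>e1 e2. e1 \<noteq> e2 \<and> (\<forall>e\<le>n. w \<in># E e \<longleftrightarrow> e = e1 \<or> e = e2)"
proof -
  obtain i where i: "i \<le> n" "w = v i" using vertex_at[OF assms] by blast
  have "\<rho> i \<noteq> \<rho> (pv n i)" using \<rho>_eq pv_neq[OF i(1)] n2 by fastforce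
  moreover have "w \<in># E e \<longleftrightarrow> e = \<rho> i \<or> e = \<rho> (pv n i)" if en: "e \<le> n" for e
  proof -
    obtain j where j: "j \<le> n" "e = \<rho> j" using color_at[OF en] by blast
    then show ?thesis using mem_E_iff[OF i(1) j(1)] i(2) \<rho>_eq by simp
  qed
  ultimately show ?thesis by blast
qed

text \<open>The collapsed edge puts the two exchanged legs on one vertex, so their exchange becomes
  invisible.\<close>

lemma same_collapse_swap:
  assumes i: "i \<le> n"
  shows "same_collapse n ({..n} - {\<rho> i}) E (cyc_ends n \<rho> (p \<circ> swap i (nx n i)))"
proof -
  let ?t = "swap i (nx n i)"
  interpret B: cycle_graph n \<rho> "p \<circ> ?t" by (rule cycle_graph_swap[OF i])
  have Z: "{..n} - ({..n} - {\<rho> i}) = {\<rho> i}" using \<rho>_le[OF i] by auto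
  have Ei: "B.E (\<rho> i) = E (\<rho> i)"
    by (simp add: B.E_at[OF i] E_at[OF i] add_mset_commute)
  have J: "joined G {\<rho> i} = joined B.G {\<rho> i}"
    by (rule joined_cong) (simp_all add: Ei)
  let ?J = "joined G {\<rho> i}"
  have "(v i, v (nx n i)) \<in> ?J"
    using v_verts[OF i] v_verts[OF nx_le[OF i]] E_at[OF i] by (intro joined_edge[where e = "\<rho> i"]) simp_all
  then have cl: "?J `` {v i} = ?J `` {v (nx n i)}" by (rule equiv_class_eq[OF equiv_joined])
  have cl': "?J `` {v (?t x)} = ?J `` {v x}" for x
    using cl by (cases "x = i"; cases "x = nx n i") simp_all
  have "ends (collapse G {\<rho> i}) e = ends (collapse B.G {\<rho> i}) e" if en: "e \<le> n" for e
  proof -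
    obtain k where k: "k \<le> n" "e = \<rho> k" using color_at[OF en] by blast
    have "ends (collapse G {\<rho> i}) e = {#?J `` {v k}, ?J `` {v (nx n k)}#}"
      using E_at[OF k(1)] k(2) by (simp add: collapse_def)
    also have "\<dots> = ends (collapse B.G {\<rho> i}) e"
      using B.E_at[OF k(1)] k(2) cl' by (simp add: collapse_def J[symmetric])
    finally show ?thesis .
  qed
  then show ?thesis unfolding same_collapse_def Z using J by simp
qed

text \<open>
  After collapsing the edge between the legs \<open>a\<close> and \<open>b\<close>, only the distribution of the two
  neighbouring edges between \<open>a\<close> and \<open>b\<close> is lost, which leaves two possibilities.
\<close>

lemma same_collapse_facet:
  assumes B: "cycle_graph n \<rho>' p'" and i: "i \<le> n"
    and same: "same_collapse n ({..n} - {\<rho> i}) E (cyc_ends n \<rho>' p')"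
  shows "cyc_ends n \<rho>' p' = E \<or> cyc_ends n \<rho>' p' = cyc_ends n \<rho> (p \<circ> swap i (nx n i))"
proof -
  interpret B: cycle_graph n \<rho>' p' by (rule B)
  let ?t = "swap i (nx n i)" and ?c = "\<rho> i"
  interpret S: cycle_graph n \<rho> "p \<circ> ?t" by (rule cycle_graph_swap[OF i])
  \<comment> \<open>Around the collapsed edge the cycle reads \<open>x, a, b, y\<close>. For
    \<open>n = 2\<close> the outer vertices \<open>x\<close> and \<open>y\<close> coincide, but the
    two neighbouring edges are still distinct.\<close>
  define a b where "a = v i" and "b = v (nx n i)"
  define x y where "x = v (pv n i)" and "y = v (nx n (nx n i))"
  have nxi: "nx n i \<le> n" "nx n i \<noteq> i" and pvi: "pv n i \<le> n" "pv n i \<noteq> i" "nx n (pv n i) = i"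
    using i nx_le nx_neq[OF i] pv_le[OF i] pv_neq[OF i] n2 nx_eq_iff[of i n "pv n i"] by auto
  have nxnx: "nx n (nx n i) \<le> n" "nx n (nx n i) \<noteq> i" "nx n (nx n i) \<noteq> nx n i" "pv n i \<noteq> nx n i"
    using i n2 by (auto simp: nx_def pv_def)
  have ab: "a \<noteq> b" "x \<noteq> a" "x \<noteq> b" "y \<noteq> a" "y \<noteq> b"
    unfolding a_def b_def x_def y_def v_eq using nxi pvi nxnx by auto
  have V: "a \<in> {1..Suc n}" "b \<in> {1..Suc n}"
    unfolding a_def b_def using v_verts i nxi(1) by blast+
  have Ec: "E ?c = {#a, b#}" using E_at[OF i] by (simp add: a_def b_def)
  have Z: "{..n} - ({..n} - {?c}) = {?c}" using \<rho>_le[OF i] by auto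
  have J: "joined G {?c} = joined B.G {?c}" using same unfolding same_collapse_def Z by simp
  have J_cases: "u = w \<or> u \<in> {a, b} \<and> w \<in> {a, b}" if uw: "(u, w) \<in> joined G {?c}" for u w
  proof (rule joined_subset[OF _ _ _ _ uw])
    fix e u w assume "e \<in> {?c}" "ends G e = {#u, w#}"
    then have "{#u, w#} = {#a, b#}" using Ec by simp
    then show "u = w \<or> u \<in> {a, b} \<and> w \<in> {a, b}" unfolding pair_mset_eq_iff by blast
  next
    show "set_mset (ends G e) \<subseteq> verts G" if "e \<in> {?c}" for e
      using that Ec V by simp
  qed auto
  have E'c: "B.E ?c = {#a, b#}"
  proof -
    have "(a, b) \<in> joined G {?c}" using Ec V by (intro joined_edge[where e = ?c]) auto
    then have "(a, b) \<in> joined B.G {?c}" unfolding J .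
    moreover from this have "(b, a) \<in> joined B.G {?c}" by (rule symD[OF sym_joined])
    ultimately have mem: "a \<in># B.E ?c" "b \<in># B.E ?c"
      using joined_first_edge[of a b B.G "{?c}"] joined_first_edge[of b a B.G "{?c}"] ab(1) by auto
    obtain u w where "B.E ?c = {#u, w#}"
      by (rule wf_ends[OF B.wf_cycle_graph, of ?c]) (use \<rho>_le[OF i] in auto)
    then show ?thesis using mem ab(1) by (auto simp: pair_mset_eq_iff)
  qed
  have other: "\<exists>u' w'. B.E (\<rho> k) = {#u', w'#} \<and> (v k = u' \<or> v k \<in> {a, b} \<and> u' \<in> {a, b}) \<and>
      (v (nx n k) = w' \<or> v (nx n k) \<in> {a, b} \<and> w' \<in> {a, b})" if k: "k \<le> n" "k \<noteq> i" for k
  proof -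
    have mem: "\<rho> k \<in> {..n} - {?c}" using \<rho>_le[OF k(1)] k(2) \<rho>_eq by simp
    obtain u' w' where u': "B.E (\<rho> k) = {#u', w'#}" "(v k, u') \<in> joined G ({..n} - ({..n} - {?c}))"
      "(v (nx n k), w') \<in> joined G ({..n} - ({..n} - {?c}))"
      by (rule same_collapse_ends[OF wf_cycle_graph B.wf_cycle_graph same \<rho>_le[OF k(1)] mem E_at[OF k(1)]])
    show ?thesis using u' J_cases unfolding Z by blast
  qed
  have far: "B.E (\<rho> k) = E (\<rho> k) \<and> a \<notin># B.E (\<rho> k)" if k: "k \<le> n" "k \<noteq> i" "k \<noteq> pv n i" "k \<noteq> nx n i" for k
  proof -
    have "v k \<notin> {a, b}" "v (nx n k) \<notin> {a, b}"
      unfolding a_def b_def using k nx_eq_iff[OF i k(1)] nx_eq_iff[OF nxi(1) k(1)] nx_eq_iff[OF nxi(1) i] v_eq by auto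
    then show ?thesis using other[OF k(1,2)] E_at[OF k(1)] by auto
  qed
  have near1: "B.E (\<rho> (pv n i)) = {#x, a#} \<or> B.E (\<rho> (pv n i)) = {#x, b#}"
    using other[OF pvi(1,2)] ab unfolding pvi(3) by (auto simp: x_def[symmetric] a_def[symmetric])
  have near2: "B.E (\<rho> (nx n i)) = {#a, y#} \<or> B.E (\<rho> (nx n i)) = {#b, y#}"
    using other[OF nxi] ab by (auto simp: y_def[symmetric] b_def[symmetric])
  \<comment> \<open>In the second cycle \<open>a\<close> also meets exactly two edges. One is the
    collapsed edge, so exactly one of the two neighbouring edges is at \<open>a\<close>, and the
    other is at \<open>b\<close>.\<close>
  obtain e1 e2 where two: "e1 \<noteq> e2" "\<And>e. e \<le> n \<Longrightarrow> a \<in># B.E e \<longleftrightarrow> e = e1 \<or> e = e2"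
    using B.two_edges_at[OF V(1)] by blast
  have dist: "\<rho> (pv n i) \<noteq> ?c" "\<rho> (nx n i) \<noteq> ?c" "\<rho> (pv n i) \<noteq> \<rho> (nx n i)"
    using \<rho>_eq pvi(2) nxi(2) nxnx(4) by auto
  have le: "\<rho> (pv n i) \<le> n" "\<rho> (nx n i) \<le> n" "?c \<le> n" using \<rho>_le pvi(1) nxi(1) i by auto
  have c12: "?c = e1 \<or> ?c = e2" using two(2)[OF le(3)] E'c by simp
  have not_both: "\<not> (a \<in># B.E (\<rho> (pv n i)) \<and> a \<in># B.E (\<rho> (nx n i)))"
    using two(2)[OF le(1)] two(2)[OF le(2)] c12 dist by metis
  have one: "a \<in># B.E (\<rho> (pv n i)) \<or> a \<in># B.E (\<rho> (nx n i))"
  proof -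
    have "\<exists>e\<le>n. e \<noteq> ?c \<and> a \<in># B.E e"
    proof -
      obtain l where l: "l \<le> n" "a = B.v l" using B.vertex_at[OF V(1)] by blast
      have "\<rho>' l \<noteq> \<rho>' (pv n l)" using B.\<rho>_eq pv_neq[OF l(1)] n2 by fastforce
      moreover have "a \<in># B.E (\<rho>' l)" "a \<in># B.E (\<rho>' (pv n l))"
        using B.mem_E_iff[OF l(1) l(1)] B.mem_E_iff[OF l(1) pv_le[OF l(1)]] l(2) by auto
      ultimately show ?thesis using B.\<rho>_le[OF l(1)] B.\<rho>_le[OF pv_le[OF l(1)]] by metis
    qed
    then obtain e where e: "e \<le> n" "e \<noteq> ?c" "a \<in># B.E e" by blast
    obtain k where k: "k \<le> n" "e = \<rho> k" using color_at[OF e(1)] by blast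
    then have "k = pv n i \<or> k = nx n i" using far[of k] e by blast
    then show ?thesis using e(3) k(2) by blast
  qed
  have all: "B.E = F" if "F \<in> extensional {..n}" "\<And>k. k \<le> n \<Longrightarrow> B.E (\<rho> k) = F (\<rho> k)" for F
  proof (rule extensionalityI[OF B.E_extensional that(1)])
    fix e assume "e \<in> {..n}"
    then obtain k where "k \<le> n" "e = \<rho> k" using color_at by auto
    then show "B.E e = F e" using that(2) by simp
  qed
  show ?thesis
  proof (cases "a \<in># B.E (\<rho> (pv n i))")
    case True
    then have "a \<notin># B.E (\<rho> (nx n i))" using not_both by blast
    then have n1: "B.E (\<rho> (pv n i)) = {#x, a#}" "B.E (\<rho> (nx n i)) = {#b, y#}"
      using near1 near2 True ab by auto
    have "B.E = E"
    proof (rule all[OF E_extensional])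
      fix k assume k: "k \<le> n"
      consider "k = i" | "k = pv n i" | "k = nx n i" | "k \<noteq> i" "k \<noteq> pv n i" "k \<noteq> nx n i" by blast
      then show "B.E (\<rho> k) = E (\<rho> k)"
        by cases (use E'c Ec n1 E_at[OF pvi(1)] E_at[OF nxi(1)] pvi(3) far[OF k] in
            \<open>simp_all add: x_def a_def b_def y_def\<close>)
    qed
    then show ?thesis ..
  next
    case False
    then have "a \<in># B.E (\<rho> (nx n i))" using one by blast
    then have n1: "B.E (\<rho> (pv n i)) = {#x, b#}" "B.E (\<rho> (nx n i)) = {#a, y#}"
      using near1 near2 False ab by auto
    have St: "S.v i = b" "S.v (nx n i) = a" "S.v (pv n i) = x" "S.v (nx n (nx n i)) = y"
      using nxi pvi nxnx by (simp_all add: a_def b_def x_def y_def transpose_apply_other)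
    have "B.E = S.E"
    proof (rule all[OF S.E_extensional])
      fix k assume k: "k \<le> n"
      consider "k = i" | "k = pv n i" | "k = nx n i" | "k \<noteq> i" "k \<noteq> pv n i" "k \<noteq> nx n i" by blast
      then show "B.E (\<rho> k) = S.E (\<rho> k)"
      proof cases
        case 1
        then show ?thesis using E'c S.E_at[OF i] St by (simp add: add_mset_commute)
      next
        case 2
        then show ?thesis using n1 S.E_at[OF pvi(1)] pvi(3) St by simp
      next
        case 3
        then show ?thesis using n1 S.E_at[OF nxi(1)] St by simp
      next
        case 4
        have "nx n k \<noteq> i" "nx n k \<noteq> nx n i"
          using 4 k nx_eq_iff[OF i k] nx_eq_iff[OF nxi(1) k] nx_eq_iff[OF nxi(1) i] by auto
        then have "S.E (\<rho> k) = E (\<rho> k)"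
          using S.E_at[OF k] E_at[OF k] 4 by (simp add: transpose_apply_other)
        then show ?thesis using far[OF k 4] by simp
      qed
    qed
    then show ?thesis ..
  qed
qed

end

section \<open>Counting cyclic arrangements\<close>

text \<open>Normal forms for cyclic arrangements of the colors: color \<open>0\<close> at position
  \<open>0\<close> fixes the rotation, and comparing its two neighbours fixes the
  reflection.\<close>

definition canonical_colorings :: "nat \<Rightarrow> (nat \<Rightarrow> nat) set" where
  "canonical_colorings n = {\<rho>. \<rho> permutes {..n} \<and> \<rho> 0 = 0 \<and> \<rho> 1 < \<rho> n}"

text \<open>The edge of color \<open>0\<close> has the same ends on both sides. Matching them in
  reverse would exchange the two neighbouring colors, against the normalisation; matched in order,
  the cycles agree step by step.\<close>

lemma cyc_ends_canonical_unique:
  assumes A: "cycle_graph n \<rho> p" "\<rho> \<in> canonical_colorings n"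
    and B: "cycle_graph n \<rho>' p'" "\<rho>' \<in> canonical_colorings n"
    and eq: "cyc_ends n \<rho> p = cyc_ends n \<rho>' p'"
  shows "\<rho> = \<rho>'" "p = p'"
proof -
  interpret A: cycle_graph n \<rho> p by (rule A)
  interpret B: cycle_graph n \<rho>' p' by (rule B)
  have n2: "2 \<le> n" by (rule A.n2)
  have r0: "\<rho> 0 = 0" "\<rho>' 0 = 0" and lt: "\<rho> 1 < \<rho> n" "\<rho>' 1 < \<rho>' n"
    using A(2) B(2) by (auto simp: canonical_colorings_def)
  have nx0: "nx n 0 = 1" "pv n 0 = n" "pv n 1 = 0" using n2 by (simp_all add: nx_def pv_def)
  have "{#A.v 0, A.v 1#} = {#B.v 0, B.v 1#}"
    using A.E_at[of 0] B.E_at[of 0] eq r0 nx0 by simp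
  then consider "A.v 0 = B.v 0" "A.v 1 = B.v 1" | "A.v 0 = B.v 1" "A.v 1 = B.v 0"
    unfolding pair_mset_eq_iff by blast
  then have "A.v 0 = B.v 0 \<and> A.v 1 = B.v 1"
  proof cases
    case 2
    have "A.v 0 \<in># B.E (\<rho>' 1)" using B.mem_E_iff[of 1 1] n2 2(1) by simp
    moreover obtain k where k: "k \<le> n" "\<rho>' 1 = \<rho> k" using A.color_at[OF B.\<rho>_le[of 1]] n2 by auto
    ultimately have "k = 0 \<or> k = n" using A.mem_E_iff[of 0 k] eq nx0 by simp
    moreover have "\<rho>' 1 \<noteq> \<rho>' 0" using B.\<rho>_eq by simp
    ultimately have r1: "\<rho>' 1 = \<rho> n" using k(2) r0 by auto
    have "A.v 1 \<in># B.E (\<rho>' n)" using B.mem_E_iff[of 0 n] n2 2(2) nx0 by simp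
    moreover obtain l where l: "l \<le> n" "\<rho>' n = \<rho> l" using A.color_at[OF B.\<rho>_le[of n]] by auto
    ultimately have "l = 1 \<or> l = 0" using A.mem_E_iff[of 1 l] eq nx0 n2 by simp
    moreover have "\<rho>' n \<noteq> \<rho>' 0" using B.\<rho>_eq n2 by simp
    ultimately have "\<rho>' n = \<rho> 1" using l(2) r0 by auto
    then show ?thesis using r1 lt by simp
  qed simp
  then have start: "A.v 0 = B.v 0" "A.v 1 = B.v 1" by auto
  have step: "\<rho> i = \<rho>' i \<and> A.v i = B.v i \<and> A.v (nx n i) = B.v (nx n i)" if "i \<le> n" for i
    using that
  proof (induction i)
    case 0
    then show ?case using start r0 nx0 by simp
  next
    case (Suc i)
    then have IH: "\<rho> i = \<rho>' i" "A.v (Suc i) = B.v (Suc i)" by (simp_all add: nx_def)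
    have pv: "pv n (Suc i) = i" by (simp add: pv_def)
    have "A.v (Suc i) \<in># B.E (\<rho>' (Suc i))" using B.mem_E_iff[of "Suc i" "Suc i"] Suc.prems IH(2) by simp
    moreover obtain k where k: "k \<le> n" "\<rho>' (Suc i) = \<rho> k" using A.color_at[OF B.\<rho>_le[OF Suc.prems]] by auto
    ultimately have "k = Suc i \<or> k = i" using A.mem_E_iff[of "Suc i" k] eq Suc.prems pv by simp
    moreover have "\<rho>' (Suc i) \<noteq> \<rho>' i" using B.\<rho>_eq by simp
    ultimately have r: "\<rho> (Suc i) = \<rho>' (Suc i)" using k(2) IH(1) by auto
    then have "{#A.v (Suc i), A.v (nx n (Suc i))#} = {#B.v (Suc i), B.v (nx n (Suc i))#}"
      using A.E_at[OF Suc.prems] B.E_at[OF Suc.prems] eq by simp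
    then have "A.v (nx n (Suc i)) = B.v (nx n (Suc i))" unfolding IH(2) pair_mset_eq_iff by auto
    then show ?case using r IH(2) by simp
  qed
  show "\<rho> = \<rho>'"
  proof
    fix i show "\<rho> i = \<rho>' i"
      using step[of i] permutes_not_in[OF A.\<rho>, of i] permutes_not_in[OF B.\<rho>, of i] by (cases "i \<le> n") auto
  qed
  show "p = p'"
  proof
    fix i show "p i = p' i"
      using step[of i] permutes_not_in[OF A.p, of i] permutes_not_in[OF B.p, of i] by (cases "i \<le> n") auto
  qed
qed

text \<open>Edges and vertices need separate reindexings \<open>g\<close> and \<open>h\<close>: edge
  \<open>i\<close> sits between the positions \<open>i\<close> and \<open>i + 1\<close>, so a
  reflection acts on vertices with a shift relative to edges.\<close>

lemma cyc_ends_reindex: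
  assumes A: "cycle_graph n \<rho> p" and g: "g permutes {..n}" and h: "h permutes {..n}"
    and gh: "\<And>i. i \<le> n \<Longrightarrow> {#h i, h (nx n i)#} = {#g i, nx n (g i)#}"
  shows "cyc_ends n (\<rho> \<circ> g) (p \<circ> h) = cyc_ends n \<rho> p"
proof -
  interpret A: cycle_graph n \<rho> p by (rule A)
  interpret B: cycle_graph n "\<rho> \<circ> g" "p \<circ> h"
    by unfold_locales (use A.n2 A.\<rho> A.p g h in \<open>auto intro: permutes_compose\<close>)
  show ?thesis
  proof (rule extensionalityI[OF B.E_extensional A.E_extensional])
    fix e assume "e \<in> {..n}"
    then obtain i where i: "i \<le> n" "e = (\<rho> \<circ> g) i" using B.color_at by auto
    have gi: "g i \<le> n" using permutes_in_image[OF g, of i] i(1) by simp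
    have "B.E e = image_mset (\<lambda>x. A.v x) {#h i, h (nx n i)#}" using B.E_at[OF i(1)] i(2) by simp
    also have "\<dots> = image_mset (\<lambda>x. A.v x) {#g i, nx n (g i)#}" by (simp only: gh[OF i(1)])
    also have "\<dots> = A.E e" using A.E_at[OF gi] i(2) by simp
    finally show "B.E e = A.E e" .
  qed
qed

definition nx_perm :: "nat \<Rightarrow> nat \<Rightarrow> nat" where "nx_perm n i = (if i \<le> n then nx n i else i)"

lemma nx_perm_permutes: "nx_perm n permutes {..n}"
proof (rule bij_imp_permutes)
  show "bij_betw (nx_perm n) {..n} {..n}"
    by (rule bij_betwI[where g = "pv n"])
      (auto simp: nx_perm_def nx_def pv_def split: if_splits)
qed (simp add: nx_perm_def)

lemma funpow_nx_perm_permutes: "(nx_perm n ^^ m) permutes {..n}"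
proof (induction m)
  case 0
  show ?case using permutes_id by (simp add: id_def)
next
  case (Suc m)
  then show ?case using permutes_compose[OF Suc nx_perm_permutes] by (simp only: funpow.simps)
qed

lemma cyc_ends_canonical_exists:
  assumes A: "cycle_graph n \<rho> p"
  obtains \<rho>' p' where "\<rho>' \<in> canonical_colorings n" "p' permutes {..n}" "cyc_ends n \<rho> p = cyc_ends n \<rho>' p'"
proof -
  interpret A: cycle_graph n \<rho> p by (rule A)
  have n2: "2 \<le> n" by (rule A.n2)
  obtain m where m: "m \<le> n" "0 = \<rho> m" using A.color_at[of 0] by auto
  let ?r = "nx_perm n ^^ m"
  have r: "?r permutes {..n}" by (rule funpow_nx_perm_permutes)
  have r_le: "?r i \<le> n" if "i \<le> n" for i using permutes_in_image[OF r, of i] that by simp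
  have "(nx_perm n ^^ k) 0 = k" if "k \<le> n" for k
    using that by (induction k) (simp_all add: nx_perm_def nx_def)
  then have r0: "?r 0 = m" using m(1) by simp
  have r_nx: "?r (nx n i) = nx n (?r i)" if "i \<le> n" for i
    using funpow_swap1[of "nx_perm n" m i] that r_le[OF that] by (simp add: nx_perm_def)
  define \<rho>1 p1 where "\<rho>1 = \<rho> \<circ> ?r" and "p1 = p \<circ> ?r"
  have eq1: "cyc_ends n \<rho>1 p1 = cyc_ends n \<rho> p"
    unfolding \<rho>1_def p1_def by (rule cyc_ends_reindex[OF A r r]) (simp add: r_nx)
  have \<rho>1: "\<rho>1 permutes {..n}" "\<rho>1 0 = 0" and p1: "p1 permutes {..n}"
    unfolding \<rho>1_def p1_def using A.\<rho> A.p r r0 m(2) by (auto intro: permutes_compose)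
  have A1: "cycle_graph n \<rho>1 p1" by unfold_locales (fact n2 \<rho>1(1) p1)+
  have "\<rho>1 1 \<noteq> \<rho>1 n" using injD[OF permutes_inj[OF \<rho>1(1)], of 1 n] n2 by auto
  then consider "\<rho>1 1 < \<rho>1 n" | "\<rho>1 n < \<rho>1 1" by linarith
  then show thesis
  proof cases
    case 1
    then show thesis using that[of \<rho>1 p1] \<rho>1 p1 eq1 by (simp add: canonical_colorings_def)
  next
    case 2
    \<comment> \<open>The reflection that fixes edge \<open>0\<close> and sends edge
      \<open>i\<close> to \<open>n + 1 - i\<close>. It exchanges the vertices at positions
      \<open>0\<close> and \<open>1\<close>, whence the extra \<open>nx_perm\<close> on
      vertices.\<close>
    let ?g = "\<lambda>i. if 1 \<le> i \<and> i \<le> n then Suc n - i else i"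
    have g: "?g permutes {..n}"
    proof (rule bij_imp_permutes)
      show "bij_betw ?g {..n} {..n}" by (rule bij_betwI[where g = ?g]) auto
    qed auto
    have h: "nx_perm n \<circ> ?g permutes {..n}" by (rule permutes_compose[OF g nx_perm_permutes])
    have gh: "{#(nx_perm n \<circ> ?g) i, (nx_perm n \<circ> ?g) (nx n i)#} = {#?g i, nx n (?g i)#}" if i: "i \<le> n" for i
    proof -
      have "(nx_perm n \<circ> ?g) i = nx n (?g i)" using i by (auto simp: nx_perm_def)
      moreover have "(nx_perm n \<circ> ?g) (nx n i) = ?g i" using i n2 by (auto simp: nx_perm_def nx_def)
      ultimately show ?thesis by (simp only: add_mset_commute)
    qed
    have eq2: "cyc_ends n (\<rho>1 \<circ> ?g) (p1 \<circ> (nx_perm n \<circ> ?g)) = cyc_ends n \<rho>1 p1"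
      by (rule cyc_ends_reindex[OF A1 g h gh])
    have "\<rho>1 \<circ> ?g \<in> canonical_colorings n"
      using 2 \<rho>1(2) permutes_compose[OF g \<rho>1(1)] n2 by (simp add: canonical_colorings_def)
    then show thesis by (rule that[OF _ permutes_compose[OF h p1]]) (simp only: eq1 eq2)
  qed
qed

text \<open>Fixing \<open>0\<close> leaves the permutations of \<open>{1..n}\<close>, and exchanging
  the arguments \<open>1\<close> and \<open>n\<close> reverses the inequality; so exactly half of
  them qualify.\<close>

lemma card_canonical_colorings:
  assumes n2: "2 \<le> n"
  shows "finite (canonical_colorings n)" "card (canonical_colorings n) = fact n div 2"
proof -
  let ?K = "canonical_colorings n"
  let ?A = "{\<sigma>. \<sigma> permutes {1..n}}" and ?K' = "{\<sigma>. \<sigma> permutes {1..n} \<and> \<sigma> n < \<sigma> 1}"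
  have "\<rho> permutes {..n} \<and> \<rho> 0 = 0 \<longleftrightarrow> \<rho> permutes {1..n}" for \<rho>
  proof
    assume \<rho>: "\<rho> permutes {..n} \<and> \<rho> 0 = 0"
    have "\<rho> x = x" if "x \<in> {..n} - {1..n}" for x
    proof -
      have "x = 0" using that by auto
      then show ?thesis using \<rho> by simp
    qed
    then show "\<rho> permutes {1..n}" by (rule permutes_superset[OF conjunct1[OF \<rho>]])
  next
    assume \<rho>: "\<rho> permutes {1..n}"
    then show "\<rho> permutes {..n} \<and> \<rho> 0 = 0"
      by (intro conjI permutes_subset[OF \<rho>] permutes_not_in[OF \<rho>]) auto
  qed
  then have K: "?K = {\<sigma>. \<sigma> permutes {1..n} \<and> \<sigma> 1 < \<sigma> n}"
    unfolding canonical_colorings_def by blast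
  have finA: "finite ?A" by (simp add: finite_permutations)
  then show fin: "finite ?K" unfolding K by (rule rev_finite_subset) auto
  have fin': "finite ?K'" using finA by (rule rev_finite_subset) auto
  have neq: "\<sigma> 1 \<noteq> \<sigma> n" if "\<sigma> permutes {1..n}" for \<sigma>
    using injD[OF permutes_inj[OF that], of 1 n] n2 by auto
  have "?A = ?K \<union> ?K'" unfolding K using neq by (auto simp: neq_iff)
  moreover have "?K \<inter> ?K' = {}" unfolding K by auto
  ultimately have "card ?A = card ?K + card ?K'" using card_Un_disjoint[OF fin fin'] by simp
  moreover have "card ?K' = card ?K"
  proof (rule bij_betw_same_card)
    have t: "swap 1 n permutes {1..n}" using n2 by (intro permutes_swap_id) auto
    have "\<sigma> \<circ> swap 1 n permutes {1..n}" if "\<sigma> permutes {1..n}" for \<sigma>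
      using permutes_compose[OF t that] .
    then show "bij_betw (\<lambda>\<sigma>. \<sigma> \<circ> swap 1 n) ?K' ?K"
      unfolding K by (intro bij_betwI[where g = "\<lambda>\<sigma>. \<sigma> \<circ> swap 1 n"]) (auto simp: comp_assoc)
  qed
  moreover have "card ?A = fact n" by (rule card_permutations) auto
  ultimately show "card ?K = fact n div 2" by simp
qed

lemma sign_comp_swap:
  assumes p: "p permutes {..n :: nat}" and "a \<noteq> b"
  shows "sign (p \<circ> swap a b) = - sign p"
  unfolding sign_compose[OF permutes_imp_permutation[OF finite_atMost p] permutation_swap_id]
  using assms(2) by (simp add: sign_swap_id)

text \<open>The exchange of \<open>a\<close> and \<open>b\<close> is the exchange of
  \<open>a\<close> and \<open>b - 1\<close> conjugated by an adjacent one. By induction it is an odd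
  number of sign changes, and transpositions generate all permutations.\<close>

lemma permutation_alternating:
  fixes f :: "(nat \<Rightarrow> nat) \<Rightarrow> int"
  assumes adj: "\<And>p i. p permutes {..n} \<Longrightarrow> i < n \<Longrightarrow> f (p \<circ> swap i (Suc i)) = - f p"
    and p: "p permutes {..n}"
  shows "f p = sign p * f id"
proof -
  have swap_lt: "f (p \<circ> swap a b) = - f p" if "a < b" "b \<le> n" "p permutes {..n}" for a b p
    using that
  proof (induction b arbitrary: p rule: less_induct)
    case (less b)
    show ?case
    proof (cases "b = Suc a")
      case True
      then show ?thesis unfolding True using less.prems(2)[unfolded True] by (intro adj less.prems(3)) simp
    next
      case False
      obtain c where c: "b = Suc c" "a < c" using less.prems(1) False by (cases b) auto
      let ?t = "swap c (Suc c)"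
      have t: "?t permutes {..n}" using c less.prems(2) by (intro permutes_swap_id) auto
      have u: "swap a c permutes {..n}" using c less.prems(2) by (intro permutes_swap_id) auto
      have pt: "p \<circ> ?t permutes {..n}" by (rule permutes_compose[OF t less.prems(3)])
      have ptu: "p \<circ> ?t \<circ> swap a c permutes {..n}" by (rule permutes_compose[OF u pt])
      have "swap (Suc c) c \<circ> swap c a \<circ> swap (Suc c) c = swap (Suc c) a"
        using c(2) by (intro transpose_comp_triple) auto
      then have "?t \<circ> swap a c \<circ> ?t = swap a b"
        by (simp add: c(1) transpose_commute[of "Suc c"] transpose_commute[of c a])
      then have "p \<circ> swap a b = p \<circ> ?t \<circ> swap a c \<circ> ?t" by (metis comp_assoc)
      moreover have cn: "c < n" using c less.prems(2) by simp
      ultimately have "f (p \<circ> swap a b) = - f (p \<circ> ?t \<circ> swap a c)"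
        using adj[OF ptu cn] by (simp only:)
      also have "f (p \<circ> ?t \<circ> swap a c) = - f (p \<circ> ?t)"
        by (rule less.IH[OF _ c(2) _ pt]) (use c(1) cn in auto)
      also have "f (p \<circ> ?t) = - f p" by (rule adj[OF less.prems(3) cn])
      also have "- (- (- f p)) = - f p" by simp
      finally show ?thesis .
    qed
  qed
  show ?thesis
    using finite_atMost p
  proof (induction p rule: permutes_rev_induct)
    case id
    show ?case by simp
  next
    case (swap a b p)
    have fs: "f (p \<circ> Transposition.transpose a b) = - f p"
    proof (cases "a < b")
      case True
      then show ?thesis by (rule swap_lt) (use swap in auto)
    next
      case False
      then have "b < a" using swap by simp
      then show ?thesis unfolding transpose_commute[of a b] by (rule swap_lt) (use swap in auto)
    qed
    then show ?case
      unfolding sign_comp_swap[OF \<open>p permutes {..n}\<close> \<open>a \<noteq> b\<close>] fs swap.IH by (simp only: mult_minus_left)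
  qed
qed

lemma same_collapse_class:
  assumes A: "cycle_graph n \<rho> p" and i: "i \<le> n"
  defines "S \<equiv> {E \<in> top_gluings n. same_collapse n ({..n} - {\<rho> i}) E (cyc_ends n \<rho> p)}"
  shows "S = {cyc_ends n \<rho> p, cyc_ends n \<rho> (p \<circ> swap i (nx n i))}"
proof -
  interpret A: cycle_graph n \<rho> p by (rule A)
  interpret B: cycle_graph n \<rho> "p \<circ> swap i (nx n i)" by (rule A.cycle_graph_swap[OF i])
  have in_top: "A.E \<in> top_gluings n" "B.E \<in> top_gluings n"
    using A.\<rho> A.p B.p unfolding top_gluings_def by blast+
  show ?thesis
  proof (intro equalityI subsetI)
    fix E assume "E \<in> S"
    then have E: "E \<in> top_gluings n" "same_collapse n ({..n} - {\<rho> i}) E A.E"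
      unfolding S_def by auto
    obtain \<rho>' p' where C: "cycle_graph n \<rho>' p'" and E': "E = cyc_ends n \<rho>' p'"
      by (rule top_gluingsE[OF A.n2 E(1)])
    have "E = A.E \<or> E = B.E"
      using A.same_collapse_facet[OF C i] same_collapse_sym[OF E(2)] unfolding E' by blast
    then show "E \<in> {A.E, B.E}" by blast
  next
    fix E assume "E \<in> {A.E, B.E}"
    moreover have "A.E \<in> S" unfolding S_def using in_top(1) same_collapse_refl by blast
    moreover have "B.E \<in> S"
      unfolding S_def using in_top(2) same_collapse_sym[OF A.same_collapse_swap[OF i]] by blast
    ultimately show "E \<in> S" by blast
  qed
qed

text \<open>The two simplices at the facet are distinct: their leg permutations differ in sign, and
  over a fixed canonical coloring the incidence function determines the permutation. So the sum has
  two terms.\<close>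

lemma sum_class_zero_iff:
  fixes a :: "(nat \<Rightarrow> nat multiset) \<Rightarrow> int"
  assumes A: "cycle_graph n \<rho> p" "\<rho> \<in> canonical_colorings n" and i: "i \<le> n"
  shows "(\<Sum>E\<in>{E \<in> top_gluings n. same_collapse n ({..n} - {\<rho> i}) E (cyc_ends n \<rho> p)}. a E) = 0
    \<longleftrightarrow> a (cyc_ends n \<rho> (p \<circ> swap i (nx n i))) = - a (cyc_ends n \<rho> p)"
proof -
  interpret A: cycle_graph n \<rho> p by (rule A)
  have B: "cycle_graph n \<rho> (p \<circ> swap i (nx n i))" by (rule A.cycle_graph_swap[OF i])
  have "i \<noteq> nx n i" using nx_neq[OF i] A.n2 by fastforce
  then have "sign (p \<circ> swap i (nx n i)) \<noteq> sign p" using sign_comp_swap[OF A.p] by simp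
  then have "p \<noteq> p \<circ> swap i (nx n i)" by metis
  then have "cyc_ends n \<rho> p \<noteq> cyc_ends n \<rho> (p \<circ> swap i (nx n i))"
    using cyc_ends_canonical_unique(2)[OF A B A(2)] by blast
  then show ?thesis unfolding same_collapse_class[OF A(1) i] by auto
qed

theorem homology_MHG1:
  assumes n2: "2 \<le> n"
  shows "homology_group (int n) (MHG1 (Suc n)) \<cong> product_group {..<(fact n div 2 :: nat)} (\<lambda>_. integer_group)"
proof -
  let ?N = "fact n div 2 :: nat" and ?K = "canonical_colorings n" and ?I = "top_gluings n"
  let ?G = "product_group {..<?N} (\<lambda>_. integer_group)"
  interpret simplex_gluing_top n "MHG1 (Suc n)" ?I "same_collapse n" "glue n"
    by (rule simplex_gluing_MHG1[OF n2])
  have cg: "cycle_graph n \<rho> p" if "\<rho> \<in> ?K" "p permutes {..n}" for \<rho> p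
    using that n2 by (simp add: cycle_graph_def canonical_colorings_def)
  have in_I: "cyc_ends n \<rho> p \<in> ?I" if "\<rho> \<in> ?K" "p permutes {..n}" for \<rho> p
    using that unfolding top_gluings_def canonical_colorings_def by blast
  have rep: "\<exists>\<rho> p. \<rho> \<in> ?K \<and> p permutes {..n} \<and> E = cyc_ends n \<rho> p" if E: "E \<in> ?I" for E
  proof -
    obtain \<rho> p where A: "cycle_graph n \<rho> p" "E = cyc_ends n \<rho> p" by (rule top_gluingsE[OF n2 E])
    show ?thesis using cyc_ends_canonical_exists[OF A(1)] unfolding A(2) by metis
  qed
  then obtain col pos where cp: "\<And>E. E \<in> ?I \<Longrightarrow> col E \<in> ?K \<and> pos E permutes {..n} \<and> E = cyc_ends n (col E) (pos E)"
    by metis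
  have col: "col (cyc_ends n \<rho> p) = \<rho>" and pos: "pos (cyc_ends n \<rho> p) = p"
    if "\<rho> \<in> ?K" "p permutes {..n}" for \<rho> p
    using cyc_ends_canonical_unique[OF cg[OF that] that(1) cg, of "col (cyc_ends n \<rho> p)" "pos (cyc_ends n \<rho> p)"]
      cp[OF in_I[OF that]] by metis+
  have "card ?K = card {..<?N}" using card_canonical_colorings[OF n2] by simp
  then obtain \<kappa> where \<kappa>: "bij_betw \<kappa> ?K {..<?N}"
    using finite_same_card_bij[OF card_canonical_colorings(1)[OF n2]] by blast
  \<comment> \<open>One free integer per canonical coloring, spread over all leg permutations by the
    sign.\<close>
  define h :: "(nat \<Rightarrow> int) \<Rightarrow> (nat \<Rightarrow> nat multiset) \<Rightarrow> int"
    where "h x = (\<lambda>E\<in>?I. sign (pos E) * x (\<kappa> (col E)))" for x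
  have h_at: "h x (cyc_ends n \<rho> p) = sign p * x (\<kappa> \<rho>)" if "\<rho> \<in> ?K" "p permutes {..n}" for x \<rho> p
    using in_I[OF that] col[OF that] pos[OF that] by (simp add: h_def)
  have swap_perm: "p \<circ> swap i (nx n i) permutes {..n}" if "p permutes {..n}" "i \<le> n" for p i
    using permutes_compose[OF permutes_swap_id that(1)] nx_le[OF that(2)] that(2) by simp
  have balanced_iff: "a \<in> balanced \<longleftrightarrow> a \<in> ?I \<rightarrow>\<^sub>E UNIV \<and>
      (\<forall>\<rho>\<in>?K. \<forall>p i. p permutes {..n} \<longrightarrow> i \<le> n \<longrightarrow>
        a (cyc_ends n \<rho> (p \<circ> swap i (nx n i))) = - a (cyc_ends n \<rho> p))" for a :: "(nat \<Rightarrow> nat multiset) \<Rightarrow> int"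
  proof (intro iffI conjI)
    assume a: "a \<in> balanced"
    then show "a \<in> ?I \<rightarrow>\<^sub>E UNIV" by (simp add: balanced_def)
    show "\<forall>\<rho>\<in>?K. \<forall>p i. p permutes {..n} \<longrightarrow> i \<le> n \<longrightarrow>
        a (cyc_ends n \<rho> (p \<circ> swap i (nx n i))) = - a (cyc_ends n \<rho> p)"
    proof (intro ballI allI impI)
      fix \<rho> p i assume \<rho>: "\<rho> \<in> ?K" and p: "p permutes {..n}" and i: "i \<le> n"
      have "\<rho> i \<le> n" using cycle_graph.\<rho>_le[OF cg[OF \<rho> p] i] .
      then have "(\<Sum>E\<in>{E \<in> ?I. same_collapse n ({..n} - {\<rho> i}) E (cyc_ends n \<rho> p)}. a E) = 0"
        using a in_I[OF \<rho> p] unfolding balanced_def by blast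
      then show "a (cyc_ends n \<rho> (p \<circ> swap i (nx n i))) = - a (cyc_ends n \<rho> p)"
        unfolding sum_class_zero_iff[OF cg[OF \<rho> p] \<rho> i] .
    qed
  next
    assume a: "a \<in> ?I \<rightarrow>\<^sub>E UNIV \<and> (\<forall>\<rho>\<in>?K. \<forall>p i. p permutes {..n} \<longrightarrow> i \<le> n \<longrightarrow>
        a (cyc_ends n \<rho> (p \<circ> swap i (nx n i))) = - a (cyc_ends n \<rho> p))"
    have "(\<Sum>E\<in>{E \<in> ?I. same_collapse n ({..n} - {j}) E E1}. a E) = 0" if j: "j \<le> n" and E1: "E1 \<in> ?I" for j E1
    proof -
      obtain \<rho> p where \<rho>: "\<rho> \<in> ?K" and p: "p permutes {..n}" and E: "E1 = cyc_ends n \<rho> p"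
        using rep[OF E1] by blast
      obtain i where i: "i \<le> n" "j = \<rho> i" using cycle_graph.color_at[OF cg[OF \<rho> p] j] by blast
      show ?thesis
        unfolding E i(2) sum_class_zero_iff[OF cg[OF \<rho> p] \<rho> i(1)] using a \<rho> p i(1) by blast
    qed
    then show "a \<in> balanced" using a unfolding balanced_def by blast
  qed
  have "bij_betw h (carrier ?G) balanced"
  proof (rule bij_betw_imageI)
    show "inj_on h (carrier ?G)"
    proof (rule inj_onI)
      fix x y assume x: "x \<in> carrier ?G" and y: "y \<in> carrier ?G" and eq: "h x = h y"
      show "x = y"
      proof (rule extensionalityI[of _ "{..<?N}"])
        show "x \<in> extensional {..<?N}" "y \<in> extensional {..<?N}"
          using x y by (auto simp: PiE_def)
        fix k assume "k \<in> {..<?N}"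
        then obtain \<rho> where \<rho>: "\<rho> \<in> ?K" "k = \<kappa> \<rho>" using bij_betw_imp_surj_on[OF \<kappa>] by blast
        have "h x (cyc_ends n \<rho> id) = h y (cyc_ends n \<rho> id)" by (simp only: eq)
        then show "x k = y k" using h_at[OF \<rho>(1) permutes_id] \<rho>(2) by simp
      qed
    qed
    show "h ` carrier ?G = balanced"
    proof (intro equalityI subsetI)
      fix a assume "a \<in> h ` carrier ?G"
      then obtain x where x: "a = h x" by blast
      have "h x \<in> ?I \<rightarrow>\<^sub>E UNIV" by (simp add: h_def)
      \<comment> \<open>For \<open>i = n\<close> this is the exchange of the last and the first
        position; it too is a transposition, so the sign meets this condition as well.\<close>
      moreover have "h x (cyc_ends n \<rho> (p \<circ> swap i (nx n i))) = - h x (cyc_ends n \<rho> p)"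
        if "\<rho> \<in> ?K" "p permutes {..n}" "i \<le> n" for \<rho> p i
      proof -
        have "i \<noteq> nx n i" using nx_neq[OF that(3)] n2 by fastforce
        then show ?thesis
          unfolding h_at[OF that(1,2)] h_at[OF that(1) swap_perm[OF that(2,3)]]
          using sign_comp_swap[OF that(2)] by simp
      qed
      ultimately show "a \<in> balanced" unfolding balanced_iff x by blast
    next
      fix a assume a: "a \<in> balanced"
      define x where "x = (\<lambda>k\<in>{..<?N}. a (cyc_ends n (inv_into ?K \<kappa> k) id))"
      have x\<kappa>: "x (\<kappa> \<rho>) = a (cyc_ends n \<rho> id)" if "\<rho> \<in> ?K" for \<rho>
        using bij_betw_inv_into_left[OF \<kappa> that] bij_betw_apply[OF \<kappa> that] by (simp add: x_def)
      have "h x = a"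
      proof (rule extensionalityI[of _ ?I])
        show "h x \<in> extensional ?I" by (simp add: h_def)
        show "a \<in> extensional ?I" using a unfolding balanced_iff by (simp add: PiE_def)
        fix E assume "E \<in> ?I"
        then obtain \<rho> p where \<rho>: "\<rho> \<in> ?K" and p: "p permutes {..n}" and E: "E = cyc_ends n \<rho> p"
          using rep by blast
        \<comment> \<open>The exchanges with \<open>i < n\<close> already determine \<open>a\<close>
          from its values at the identity, which makes \<open>h\<close> surjective.\<close>
        have alt: "a (cyc_ends n \<rho> (p \<circ> swap i (Suc i))) = - a (cyc_ends n \<rho> p)"
          if "p permutes {..n}" "i < n" for p i
        proof -
          have "nx n i = Suc i" using that(2) by (simp add: nx_def)
          moreover have "a (cyc_ends n \<rho> (p \<circ> swap i (nx n i))) = - a (cyc_ends n \<rho> p)"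
            using a \<rho> that unfolding balanced_iff by (meson less_imp_le)
          ultimately show ?thesis by (simp only:)
        qed
        have "a (cyc_ends n \<rho> p) = sign p * a (cyc_ends n \<rho> id)"
          by (rule permutation_alternating[of n "\<lambda>p. a (cyc_ends n \<rho> p)", OF alt p])
        then show "h x E = a E" unfolding E h_at[OF \<rho> p] x\<kappa>[OF \<rho>] by simp
      qed
      moreover have "x \<in> carrier ?G" by (simp add: x_def)
      ultimately show "a \<in> h ` carrier ?G" by blast
    qed
  qed
  moreover have "h (x \<otimes>\<^bsub>?G\<^esub> y) E = h x E + h y E" if "x \<in> carrier ?G" "y \<in> carrier ?G" "E \<in> ?I" for x y E
  proof -
    have "\<kappa> (col E) \<in> {..<?N}" using cp[OF that(3)] bij_betw_apply[OF \<kappa>] by blast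
    then show ?thesis using that(3) by (simp add: h_def distrib_left)
  qed
  moreover have "group ?G" by simp
  ultimately show ?thesis by (intro top_homology_isomorphic)
qed

theorem proposition5p2:
  fixes s :: nat
  assumes "s \<ge> 3"
  shows "homology_group (int s - 1) (MHG1 s) \<cong>
         product_group {..<(fact (s - 1) div 2 :: nat)} (\<lambda>_. integer_group)"
proof -
  have "2 \<le> s - 1" "Suc (s - 1) = s" "int (s - 1) = int s - 1" using assms by auto
  then show ?thesis using homology_MHG1[of "s - 1"] by simp
qed

end
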